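(* Let $\Bbbk$ be a field, let $\mathcal{C}$ be a rigid ($\Bbbk$-linear) abelian monoidal category and let $\mathcal{M}$ be a ($\Bbbk$-linear) abelian left $\mathcal{C}$-module category with action $\triangleright$. (Projective version.) Assume that $\mathcal{C}$ and $\mathcal{M}$ have enough projectives and that there is an object $X\in\mathcal{M}$ such that: (1) the functor $-\triangleright X\colon\mathcal{C}\to\mathcal{M}$ has a right adjoint $\lfloor X,-\rfloor$; (2) for every projective $P\in\mathcal{C}$ the object $P\triangleright X$ is projective in $\mathcal{M}$; (3) every projective object of $\mathcal{M}$ is a direct summand of an object of the form $P\triangleright X$ with $P\in\mathcal{C}$ projective. Then $\mathcal{M}$ is equivalent, as a $\mathcal{C}$-module category, to $\mathrm{mod}_{\mathcal{C}}(\lfloor X,X\rfloor)$. (Injective version.) Assume that $\mathcal{C}$ and $\mathcal{M}$ have enough injectives and that there is an object $X\in\mathcal{M}$ such that: (1) the functor $-\triangleright X\colon\mathcal{C}\to\mathcal{M}$ has a left adjoint $\lceil X,-\rceil$; (2) for every injective $I\in\mathcal{C}$ the object $I\triangleright X$ is injective in $\mathcal{M}$; (3) every injective object of $\mathcal{M}$ is a direct summand of an object of the form $I\triangleright X$ with $I\in\mathcal{C}$ injective. Then $\mathcal{M}$ is equivalent, as a $\mathcal{C}$-module category, to $\mathrm{comod}_{\mathcal{C}}(\lceil X,X\rceil)$.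
   Context: Categories and functors are $\Bbbk$-linear, and tensor products and actions are $\Bbbk$-bilinear. Rigid means that every object has a left and a right dual. A left $\mathcal{C}$-module category is a category $\mathcal{M}$ with a functor $\triangleright\colon\mathcal{C}\times\mathcal{M}\to\mathcal{M}$ and coherent isomorphisms $(V\otimes W)\triangleright M\cong V\triangleright(W\triangleright M)$ and $\mathbb{1}\triangleright M\cong M$. The functor $-\triangleright X$ is a strong $\mathcal{C}$-module functor, so its right adjoint $\lfloor X,-\rfloor$ is canonically a lax $\mathcal{C}$-module functor and its left adjoint $\lceil X,-\rceil$ is canonically an oplax one; since $\mathcal{C}$ is rigid these are strong. Hence the monad $\lfloor X,-\triangleright X\rfloor$ on $\mathcal{C}$ (respectively the comonad $\lceil X,-\triangleright X\rceil$) is a strong $\mathcal{C}$-module (co)monad, isomorphic to $-\otimes\lfloor X,X\rfloor$ (respectively $-\otimes\lceil X,X\rceil$); this equips $\lfloor X,X\rfloor$ with an algebra structure and $\lceil X,X\rceil$ with a coalgebra structure in $\mathcal{C}$. For an algebra object $A\in\mathcal{C}$, $\mathrm{mod}_{\mathcal{C}}(A)$ is the category of right $A$-module objects in $\mathcal{C}$, with $\mathcal{C}$ acting by tensoring on the left. For a coalgebra object $K\in\mathcal{C}$, $\mathrm{comod}_{\mathcal{C}}(K)$ is the category of right $K$-comodule objects in $\mathcal{C}$, with $\mathcal{C}$ acting by tensoring on the left. *)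

theory Defs
  imports Main
begin

section \<open>Categories\<close>

text \<open>
  Every arrow determines its source and target, and all operations are only constrained on the
  carriers \<^term>\<open>obj\<close> and \<^term>\<open>arr\<close>. Composition is written in diagram-reversed order:
  \<open>g \<cdot> f\<close> is \<open>f\<close> followed by \<open>g\<close>.
\<close>

record ('o, 'a) cat =
  obj :: "'o set"
  arr :: "'a set"
  src :: "'a \<Rightarrow> 'o"
  trg :: "'a \<Rightarrow> 'o"
  idt :: "'o \<Rightarrow> 'a"
  cmp :: "'a \<Rightarrow> 'a \<Rightarrow> 'a" (infixr "\<cdot>\<index>" 60)

definition hom :: "('o, 'a, 'm) cat_scheme \<Rightarrow> 'o \<Rightarrow> 'o \<Rightarrow> 'a set" where
  "hom C A B = {f \<in> arr C. src C f = A \<and> trg C f = B}"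

locale category =
  fixes C :: "('o, 'a, 'm) cat_scheme" (structure)
  assumes src_obj: "f \<in> arr C \<Longrightarrow> src C f \<in> obj C"
    and trg_obj: "f \<in> arr C \<Longrightarrow> trg C f \<in> obj C"
    and idt_hom: "A \<in> obj C \<Longrightarrow> idt C A \<in> hom C A A"
    and cmp_hom: "\<lbrakk>f \<in> hom C A B; g \<in> hom C B D\<rbrakk> \<Longrightarrow> g \<cdot> f \<in> hom C A D"
    and idt_cmp: "f \<in> hom C A B \<Longrightarrow> idt C B \<cdot> f = f"
    and cmp_idt: "f \<in> hom C A B \<Longrightarrow> f \<cdot> idt C A = f"
    and cmp_assoc: "\<lbrakk>f \<in> hom C A B; g \<in> hom C B D; h \<in> hom C D E\<rbrakk>
      \<Longrightarrow> (h \<cdot> g) \<cdot> f = h \<cdot> (g \<cdot> f)"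

definition inverse_arrows :: "('o, 'a, 'm) cat_scheme \<Rightarrow> 'a \<Rightarrow> 'a \<Rightarrow> bool" where
  "inverse_arrows C f g \<longleftrightarrow>
     f \<in> arr C \<and> g \<in> hom C (trg C f) (src C f) \<and>
     g \<cdot>\<^bsub>C\<^esub> f = idt C (src C f) \<and> f \<cdot>\<^bsub>C\<^esub> g = idt C (trg C f)"

definition iso :: "('o, 'a, 'm) cat_scheme \<Rightarrow> 'a \<Rightarrow> bool" where
  "iso C f \<longleftrightarrow> (\<exists>g. inverse_arrows C f g)"

definition inv_arr :: "('o, 'a, 'm) cat_scheme \<Rightarrow> 'a \<Rightarrow> 'a" where
  "inv_arr C f = (THE g. inverse_arrows C f g)"

definition mono :: "('o, 'a, 'm) cat_scheme \<Rightarrow> 'a \<Rightarrow> bool" where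
  "mono C f \<longleftrightarrow> f \<in> arr C \<and>
     (\<forall>A. \<forall>g \<in> hom C A (src C f). \<forall>h \<in> hom C A (src C f).
        f \<cdot>\<^bsub>C\<^esub> g = f \<cdot>\<^bsub>C\<^esub> h \<longrightarrow> g = h)"

definition epi :: "('o, 'a, 'm) cat_scheme \<Rightarrow> 'a \<Rightarrow> bool" where
  "epi C f \<longleftrightarrow> f \<in> arr C \<and>
     (\<forall>A. \<forall>g \<in> hom C (trg C f) A. \<forall>h \<in> hom C (trg C f) A.
        g \<cdot>\<^bsub>C\<^esub> f = h \<cdot>\<^bsub>C\<^esub> f \<longrightarrow> g = h)"

definition projective :: "('o, 'a, 'm) cat_scheme \<Rightarrow> 'o \<Rightarrow> bool" where
  "projective C P \<longleftrightarrow> P \<in> obj C \<and>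
     (\<forall>e. epi C e \<longrightarrow> (\<forall>f \<in> hom C P (trg C e). \<exists>g \<in> hom C P (src C e). e \<cdot>\<^bsub>C\<^esub> g = f))"

definition injective :: "('o, 'a, 'm) cat_scheme \<Rightarrow> 'o \<Rightarrow> bool" where
  "injective C I \<longleftrightarrow> I \<in> obj C \<and>
     (\<forall>m. mono C m \<longrightarrow> (\<forall>f \<in> hom C (src C m) I. \<exists>g \<in> hom C (trg C m) I. g \<cdot>\<^bsub>C\<^esub> m = f))"

definition enough_projectives :: "('o, 'a, 'm) cat_scheme \<Rightarrow> bool" where
  "enough_projectives C \<longleftrightarrow>
     (\<forall>A \<in> obj C. \<exists>P. projective C P \<and> (\<exists>e \<in> hom C P A. epi C e))"

definition enough_injectives :: "('o, 'a, 'm) cat_scheme \<Rightarrow> bool" where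
  "enough_injectives C \<longleftrightarrow>
     (\<forall>A \<in> obj C. \<exists>I. injective C I \<and> (\<exists>m \<in> hom C A I. mono C m))"


section \<open>Linear and abelian categories\<close>

record ('k, 'o, 'a) lincat = "('o, 'a) cat" +
  vadd :: "'a \<Rightarrow> 'a \<Rightarrow> 'a" (infixl "\<oplus>\<index>" 55)
  vzero :: "'o \<Rightarrow> 'o \<Rightarrow> 'a"
  vscale :: "'k \<Rightarrow> 'a \<Rightarrow> 'a"

locale linear_category = category C
  for C :: "('k::field, 'o, 'a, 'm) lincat_scheme" (structure) +
  assumes vadd_hom: "\<lbrakk>f \<in> hom C A B; g \<in> hom C A B\<rbrakk> \<Longrightarrow> f \<oplus> g \<in> hom C A B"
    and vzero_hom: "\<lbrakk>A \<in> obj C; B \<in> obj C\<rbrakk> \<Longrightarrow> vzero C A B \<in> hom C A B"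
    and vscale_hom: "f \<in> hom C A B \<Longrightarrow> vscale C c f \<in> hom C A B"
    and vadd_assoc: "\<lbrakk>f \<in> hom C A B; g \<in> hom C A B; h \<in> hom C A B\<rbrakk>
      \<Longrightarrow> (f \<oplus> g) \<oplus> h = f \<oplus> (g \<oplus> h)"
    and vadd_commute: "\<lbrakk>f \<in> hom C A B; g \<in> hom C A B\<rbrakk> \<Longrightarrow> f \<oplus> g = g \<oplus> f"
    and vzero_add: "f \<in> hom C A B \<Longrightarrow> vzero C A B \<oplus> f = f"
    and vadd_inverse: "f \<in> hom C A B \<Longrightarrow> \<exists>g \<in> hom C A B. f \<oplus> g = vzero C A B"
    and vscale_add_right: "\<lbrakk>f \<in> hom C A B; g \<in> hom C A B\<rbrakk>
      \<Longrightarrow> vscale C c (f \<oplus> g) = vscale C c f \<oplus> vscale C c g"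
    and vscale_add_left: "f \<in> hom C A B
      \<Longrightarrow> vscale C (c + d) f = vscale C c f \<oplus> vscale C d f"
    and vscale_vscale: "f \<in> hom C A B \<Longrightarrow> vscale C c (vscale C d f) = vscale C (c * d) f"
    and vscale_one: "f \<in> hom C A B \<Longrightarrow> vscale C 1 f = f"
    and cmp_add_left: "\<lbrakk>f \<in> hom C A B; g \<in> hom C B D; h \<in> hom C B D\<rbrakk>
      \<Longrightarrow> (g \<oplus> h) \<cdot> f = (g \<cdot> f) \<oplus> (h \<cdot> f)"
    and cmp_add_right: "\<lbrakk>f \<in> hom C A B; g \<in> hom C A B; h \<in> hom C B D\<rbrakk>
      \<Longrightarrow> h \<cdot> (f \<oplus> g) = (h \<cdot> f) \<oplus> (h \<cdot> g)"
    and cmp_scale_left: "\<lbrakk>f \<in> hom C A B; g \<in> hom C B D\<rbrakk>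
      \<Longrightarrow> vscale C c g \<cdot> f = vscale C c (g \<cdot> f)"
    and cmp_scale_right: "\<lbrakk>f \<in> hom C A B; g \<in> hom C B D\<rbrakk>
      \<Longrightarrow> g \<cdot> vscale C c f = vscale C c (g \<cdot> f)"

definition zero_object :: "('o, 'a, 'm) cat_scheme \<Rightarrow> 'o \<Rightarrow> bool" where
  "zero_object C Z \<longleftrightarrow> Z \<in> obj C \<and>
     (\<forall>A \<in> obj C. (\<exists>!f. f \<in> hom C A Z) \<and> (\<exists>!f. f \<in> hom C Z A))"

definition biproduct ::
  "('k, 'o, 'a, 'm) lincat_scheme \<Rightarrow> 'o \<Rightarrow> 'o \<Rightarrow> 'o \<Rightarrow> 'a \<Rightarrow> 'a \<Rightarrow> 'a \<Rightarrow> 'a \<Rightarrow> bool" where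
  "biproduct C A B S i j p q \<longleftrightarrow>
     i \<in> hom C A S \<and> j \<in> hom C B S \<and> p \<in> hom C S A \<and> q \<in> hom C S B \<and>
     p \<cdot>\<^bsub>C\<^esub> i = idt C A \<and> q \<cdot>\<^bsub>C\<^esub> j = idt C B \<and>
     p \<cdot>\<^bsub>C\<^esub> j = vzero C B A \<and> q \<cdot>\<^bsub>C\<^esub> i = vzero C A B \<and>
     (i \<cdot>\<^bsub>C\<^esub> p) \<oplus>\<^bsub>C\<^esub> (j \<cdot>\<^bsub>C\<^esub> q) = idt C S"

definition direct_summand :: "('k, 'o, 'a, 'm) lincat_scheme \<Rightarrow> 'o \<Rightarrow> 'o \<Rightarrow> bool" where
  "direct_summand C A S \<longleftrightarrow>
     A \<in> obj C \<and> S \<in> obj C \<and> (\<exists>B \<in> obj C. \<exists>i j p q. biproduct C A B S i j p q)"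

definition is_kernel :: "('k, 'o, 'a, 'm) lincat_scheme \<Rightarrow> 'a \<Rightarrow> 'a \<Rightarrow> bool" where
  "is_kernel C k f \<longleftrightarrow>
     f \<in> arr C \<and> k \<in> arr C \<and> trg C k = src C f \<and>
     f \<cdot>\<^bsub>C\<^esub> k = vzero C (src C k) (trg C f) \<and>
     (\<forall>A. \<forall>h \<in> hom C A (src C f). f \<cdot>\<^bsub>C\<^esub> h = vzero C A (trg C f) \<longrightarrow>
        (\<exists>!h'. h' \<in> hom C A (src C k) \<and> k \<cdot>\<^bsub>C\<^esub> h' = h))"

definition is_cokernel :: "('k, 'o, 'a, 'm) lincat_scheme \<Rightarrow> 'a \<Rightarrow> 'a \<Rightarrow> bool" where
  "is_cokernel C c f \<longleftrightarrow>
     f \<in> arr C \<and> c \<in> arr C \<and> src C c = trg C f \<and>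
     c \<cdot>\<^bsub>C\<^esub> f = vzero C (src C f) (trg C c) \<and>
     (\<forall>A. \<forall>h \<in> hom C (trg C f) A. h \<cdot>\<^bsub>C\<^esub> f = vzero C (src C f) A \<longrightarrow>
        (\<exists>!h'. h' \<in> hom C (trg C c) A \<and> h' \<cdot>\<^bsub>C\<^esub> c = h))"

locale abelian_category = linear_category C
  for C :: "('k::field, 'o, 'a, 'm) lincat_scheme" (structure) +
  assumes ex_zero_object: "\<exists>Z. zero_object C Z"
    and ex_biproduct: "\<lbrakk>A \<in> obj C; B \<in> obj C\<rbrakk> \<Longrightarrow> \<exists>S \<in> obj C. \<exists>i j p q. biproduct C A B S i j p q"
    and ex_kernel: "f \<in> arr C \<Longrightarrow> \<exists>k. is_kernel C k f"
    and ex_cokernel: "f \<in> arr C \<Longrightarrow> \<exists>c. is_cokernel C c f"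
    and mono_is_kernel: "mono C f \<Longrightarrow> \<exists>g. is_kernel C f g"
    and epi_is_cokernel: "epi C f \<Longrightarrow> \<exists>g. is_cokernel C f g"


section \<open>Functors, natural transformations, adjunctions, equivalences\<close>

record ('o, 'a, 'p, 'b) functr =
  fobj :: "'o \<Rightarrow> 'p"
  farr :: "'a \<Rightarrow> 'b"

locale linear_functor = A: linear_category A + B: linear_category B
  for A :: "('k::field, 'o, 'a, 'm) lincat_scheme"
    and B :: "('k, 'p, 'b, 'n) lincat_scheme"
    and F :: "('o, 'a, 'p, 'b) functr" +
  assumes fobj_obj: "X \<in> obj A \<Longrightarrow> fobj F X \<in> obj B"
    and farr_hom: "f \<in> hom A X Y \<Longrightarrow> farr F f \<in> hom B (fobj F X) (fobj F Y)"
    and farr_idt: "X \<in> obj A \<Longrightarrow> farr F (idt A X) = idt B (fobj F X)"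
    and farr_cmp: "\<lbrakk>f \<in> hom A X Y; g \<in> hom A Y Z\<rbrakk>
      \<Longrightarrow> farr F (g \<cdot>\<^bsub>A\<^esub> f) = farr F g \<cdot>\<^bsub>B\<^esub> farr F f"
    and farr_add: "\<lbrakk>f \<in> hom A X Y; g \<in> hom A X Y\<rbrakk>
      \<Longrightarrow> farr F (f \<oplus>\<^bsub>A\<^esub> g) = farr F f \<oplus>\<^bsub>B\<^esub> farr F g"
    and farr_scale: "f \<in> hom A X Y \<Longrightarrow> farr F (vscale A c f) = vscale B c (farr F f)"

definition id_functr :: "('o, 'a, 'o, 'a) functr" where
  "id_functr = \<lparr>fobj = (\<lambda>X. X), farr = (\<lambda>f. f)\<rparr>"

definition comp_functr ::
  "('p, 'b, 'q, 'c) functr \<Rightarrow> ('o, 'a, 'p, 'b) functr \<Rightarrow> ('o, 'a, 'q, 'c) functr" where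
  "comp_functr G F = \<lparr>fobj = (\<lambda>X. fobj G (fobj F X)), farr = (\<lambda>f. farr G (farr F f))\<rparr>"

definition natural_transformation ::
  "('o, 'a, 'm) cat_scheme \<Rightarrow> ('p, 'b, 'n) cat_scheme \<Rightarrow>
   ('o, 'a, 'p, 'b) functr \<Rightarrow> ('o, 'a, 'p, 'b) functr \<Rightarrow> ('o \<Rightarrow> 'b) \<Rightarrow> bool" where
  "natural_transformation A B F G t \<longleftrightarrow>
     (\<forall>X \<in> obj A. t X \<in> hom B (fobj F X) (fobj G X)) \<and>
     (\<forall>f \<in> arr A. t (trg A f) \<cdot>\<^bsub>B\<^esub> farr F f = farr G f \<cdot>\<^bsub>B\<^esub> t (src A f))"

definition natural_isomorphism ::
  "('o, 'a, 'm) cat_scheme \<Rightarrow> ('p, 'b, 'n) cat_scheme \<Rightarrow>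
   ('o, 'a, 'p, 'b) functr \<Rightarrow> ('o, 'a, 'p, 'b) functr \<Rightarrow> ('o \<Rightarrow> 'b) \<Rightarrow> bool" where
  "natural_isomorphism A B F G t \<longleftrightarrow>
     natural_transformation A B F G t \<and> (\<forall>X \<in> obj A. iso B (t X))"

text \<open>\<open>F \<stileturn> G\<close> with unit \<open>\<eta>\<close> and counit \<open>\<epsilon>\<close>, where \<open>F : A \<rightarrow> B\<close> and \<open>G : B \<rightarrow> A\<close>.\<close>

locale adjunction = F: linear_functor A B F + G: linear_functor B A G
  for A :: "('k::field, 'o, 'a, 'm) lincat_scheme"
    and B :: "('k, 'p, 'b, 'n) lincat_scheme"
    and F :: "('o, 'a, 'p, 'b) functr"
    and G :: "('p, 'b, 'o, 'a) functr"
    and \<eta> :: "'o \<Rightarrow> 'a"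
    and \<epsilon> :: "'p \<Rightarrow> 'b" +
  assumes unit_natural: "natural_transformation A A id_functr (comp_functr G F) \<eta>"
    and counit_natural: "natural_transformation B B (comp_functr F G) id_functr \<epsilon>"
    and triangle_left: "X \<in> obj A \<Longrightarrow> \<epsilon> (fobj F X) \<cdot>\<^bsub>B\<^esub> farr F (\<eta> X) = idt B (fobj F X)"
    and triangle_right: "Y \<in> obj B \<Longrightarrow> farr G (\<epsilon> Y) \<cdot>\<^bsub>A\<^esub> \<eta> (fobj G Y) = idt A (fobj G Y)"

definition equivalence_of_categories ::
  "('k::field, 'o, 'a, 'm) lincat_scheme \<Rightarrow> ('k, 'p, 'b, 'n) lincat_scheme \<Rightarrow>
   ('o, 'a, 'p, 'b) functr \<Rightarrow> bool" where
  "equivalence_of_categories A B F \<longleftrightarrow>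
     linear_functor A B F \<and>
     (\<exists>G s t. linear_functor B A G \<and>
        natural_isomorphism A A id_functr (comp_functr G F) s \<and>
        natural_isomorphism B B (comp_functr F G) id_functr t)"


section \<open>Monoidal and rigid categories\<close>

text \<open>
  Tensor product on objects is \<open>\<otimes>\<close> and on arrows \<open>\<boxtimes>\<close>. The constraints are
  \<open>tassoc U V W : (U \<otimes> V) \<otimes> W \<rightarrow> U \<otimes> (V \<otimes> W)\<close>,
  \<open>tlunit V : 1 \<otimes> V \<rightarrow> V\<close> and \<open>trunit V : V \<otimes> 1 \<rightarrow> V\<close>.
\<close>

record ('k, 'o, 'a) moncat = "('k, 'o, 'a) lincat" +
  tobj :: "'o \<Rightarrow> 'o \<Rightarrow> 'o" (infixl "\<otimes>\<index>" 75)
  tarr :: "'a \<Rightarrow> 'a \<Rightarrow> 'a" (infixl "\<boxtimes>\<index>" 75)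
  tone :: "'o"
  tassoc :: "'o \<Rightarrow> 'o \<Rightarrow> 'o \<Rightarrow> 'a"
  tlunit :: "'o \<Rightarrow> 'a"
  trunit :: "'o \<Rightarrow> 'a"

locale monoidal_category = linear_category C
  for C :: "('k::field, 'o, 'a, 'm) moncat_scheme" (structure) +
  assumes tobj_obj: "\<lbrakk>V \<in> obj C; W \<in> obj C\<rbrakk> \<Longrightarrow> V \<otimes> W \<in> obj C"
    and tone_obj: "tone C \<in> obj C"
    and tarr_hom: "\<lbrakk>f \<in> hom C V V'; g \<in> hom C W W'\<rbrakk> \<Longrightarrow> f \<boxtimes> g \<in> hom C (V \<otimes> W) (V' \<otimes> W')"
    and tarr_idt: "\<lbrakk>V \<in> obj C; W \<in> obj C\<rbrakk> \<Longrightarrow> idt C V \<boxtimes> idt C W = idt C (V \<otimes> W)"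
    and tarr_cmp: "\<lbrakk>f \<in> hom C V V'; f' \<in> hom C V' V''; g \<in> hom C W W'; g' \<in> hom C W' W''\<rbrakk>
      \<Longrightarrow> (f' \<cdot> f) \<boxtimes> (g' \<cdot> g) = (f' \<boxtimes> g') \<cdot> (f \<boxtimes> g)"
    and tarr_add_left: "\<lbrakk>f \<in> hom C V V'; f' \<in> hom C V V'; g \<in> hom C W W'\<rbrakk>
      \<Longrightarrow> (f \<oplus> f') \<boxtimes> g = (f \<boxtimes> g) \<oplus> (f' \<boxtimes> g)"
    and tarr_add_right: "\<lbrakk>f \<in> hom C V V'; g \<in> hom C W W'; g' \<in> hom C W W'\<rbrakk>
      \<Longrightarrow> f \<boxtimes> (g \<oplus> g') = (f \<boxtimes> g) \<oplus> (f \<boxtimes> g')"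
    and tarr_scale_left: "\<lbrakk>f \<in> hom C V V'; g \<in> hom C W W'\<rbrakk>
      \<Longrightarrow> vscale C c f \<boxtimes> g = vscale C c (f \<boxtimes> g)"
    and tarr_scale_right: "\<lbrakk>f \<in> hom C V V'; g \<in> hom C W W'\<rbrakk>
      \<Longrightarrow> f \<boxtimes> vscale C c g = vscale C c (f \<boxtimes> g)"
    and tassoc_hom: "\<lbrakk>U \<in> obj C; V \<in> obj C; W \<in> obj C\<rbrakk>
      \<Longrightarrow> tassoc C U V W \<in> hom C ((U \<otimes> V) \<otimes> W) (U \<otimes> (V \<otimes> W))"
    and tassoc_iso: "\<lbrakk>U \<in> obj C; V \<in> obj C; W \<in> obj C\<rbrakk> \<Longrightarrow> iso C (tassoc C U V W)"
    and tassoc_natural: "\<lbrakk>f \<in> hom C U U'; g \<in> hom C V V'; h \<in> hom C W W'\<rbrakk>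
      \<Longrightarrow> tassoc C U' V' W' \<cdot> ((f \<boxtimes> g) \<boxtimes> h) = (f \<boxtimes> (g \<boxtimes> h)) \<cdot> tassoc C U V W"
    and tlunit_hom: "V \<in> obj C \<Longrightarrow> tlunit C V \<in> hom C (tone C \<otimes> V) V"
    and tlunit_iso: "V \<in> obj C \<Longrightarrow> iso C (tlunit C V)"
    and tlunit_natural: "f \<in> hom C V W
      \<Longrightarrow> tlunit C W \<cdot> (idt C (tone C) \<boxtimes> f) = f \<cdot> tlunit C V"
    and trunit_hom: "V \<in> obj C \<Longrightarrow> trunit C V \<in> hom C (V \<otimes> tone C) V"
    and trunit_iso: "V \<in> obj C \<Longrightarrow> iso C (trunit C V)"
    and trunit_natural: "f \<in> hom C V W
      \<Longrightarrow> trunit C W \<cdot> (f \<boxtimes> idt C (tone C)) = f \<cdot> trunit C V"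
    and pentagon: "\<lbrakk>U \<in> obj C; V \<in> obj C; W \<in> obj C; Z \<in> obj C\<rbrakk>
      \<Longrightarrow> (idt C U \<boxtimes> tassoc C V W Z) \<cdot> tassoc C U (V \<otimes> W) Z \<cdot> (tassoc C U V W \<boxtimes> idt C Z)
        = tassoc C U V (W \<otimes> Z) \<cdot> tassoc C (U \<otimes> V) W Z"
    and triangle: "\<lbrakk>V \<in> obj C; W \<in> obj C\<rbrakk>
      \<Longrightarrow> (idt C V \<boxtimes> tlunit C W) \<cdot> tassoc C V (tone C) W = trunit C V \<boxtimes> idt C W"

text \<open>
  \<open>dual_pair C Y X ev coev\<close>: the object \<open>Y\<close> is a left dual of \<open>X\<close>, equivalently \<open>X\<close> is a right
  dual of \<open>Y\<close>, with \<open>ev : Y \<otimes> X \<rightarrow> 1\<close> and \<open>coev : 1 \<rightarrow> X \<otimes> Y\<close>.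
\<close>

definition dual_pair ::
  "('k, 'o, 'a, 'm) moncat_scheme \<Rightarrow> 'o \<Rightarrow> 'o \<Rightarrow> 'a \<Rightarrow> 'a \<Rightarrow> bool" where
  "dual_pair C Y X ev coev \<longleftrightarrow>
     X \<in> obj C \<and> Y \<in> obj C \<and>
     ev \<in> hom C (Y \<otimes>\<^bsub>C\<^esub> X) (tone C) \<and> coev \<in> hom C (tone C) (X \<otimes>\<^bsub>C\<^esub> Y) \<and>
     trunit C X \<cdot>\<^bsub>C\<^esub> (idt C X \<boxtimes>\<^bsub>C\<^esub> ev) \<cdot>\<^bsub>C\<^esub> tassoc C X Y X
       \<cdot>\<^bsub>C\<^esub> (coev \<boxtimes>\<^bsub>C\<^esub> idt C X) \<cdot>\<^bsub>C\<^esub> inv_arr C (tlunit C X) = idt C X \<and>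
     tlunit C Y \<cdot>\<^bsub>C\<^esub> (ev \<boxtimes>\<^bsub>C\<^esub> idt C Y) \<cdot>\<^bsub>C\<^esub> inv_arr C (tassoc C Y X Y)
       \<cdot>\<^bsub>C\<^esub> (idt C Y \<boxtimes>\<^bsub>C\<^esub> coev) \<cdot>\<^bsub>C\<^esub> inv_arr C (trunit C Y) = idt C Y"

locale rigid_category = monoidal_category C
  for C :: "('k::field, 'o, 'a, 'm) moncat_scheme" (structure) +
  assumes ex_left_dual: "X \<in> obj C \<Longrightarrow> \<exists>Y ev coev. dual_pair C Y X ev coev"
    and ex_right_dual: "X \<in> obj C \<Longrightarrow> \<exists>Y ev coev. dual_pair C X Y ev coev"


section \<open>Module categories and their equivalences\<close>

text \<open>
  The action is \<open>\<rhd>\<close> on objects and \<open>\<unrhd>\<close> on arrows. The constraints are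
  \<open>aassoc V W N : (V \<otimes> W) \<rhd> N \<rightarrow> V \<rhd> (W \<rhd> N)\<close> and \<open>aunit N : 1 \<rhd> N \<rightarrow> N\<close>.
\<close>

record ('k, 'o, 'a, 'p, 'b) modcat = "('k, 'p, 'b) lincat" +
  aobj :: "'o \<Rightarrow> 'p \<Rightarrow> 'p" (infixr "\<rhd>\<index>" 75)
  aarr :: "'a \<Rightarrow> 'b \<Rightarrow> 'b" (infixr "\<unrhd>\<index>" 75)
  aassoc :: "'o \<Rightarrow> 'o \<Rightarrow> 'p \<Rightarrow> 'b"
  aunit :: "'p \<Rightarrow> 'b"

locale module_category = C: monoidal_category C + M: linear_category M
  for C :: "('k::field, 'o, 'a, 'm) moncat_scheme"
    and M :: "('k, 'o, 'a, 'p, 'b, 'n) modcat_scheme" +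
  assumes aobj_obj: "\<lbrakk>V \<in> obj C; N \<in> obj M\<rbrakk> \<Longrightarrow> V \<rhd>\<^bsub>M\<^esub> N \<in> obj M"
    and aarr_hom: "\<lbrakk>f \<in> hom C V V'; g \<in> hom M N N'\<rbrakk>
      \<Longrightarrow> f \<unrhd>\<^bsub>M\<^esub> g \<in> hom M (V \<rhd>\<^bsub>M\<^esub> N) (V' \<rhd>\<^bsub>M\<^esub> N')"
    and aarr_idt: "\<lbrakk>V \<in> obj C; N \<in> obj M\<rbrakk> \<Longrightarrow> idt C V \<unrhd>\<^bsub>M\<^esub> idt M N = idt M (V \<rhd>\<^bsub>M\<^esub> N)"
    and aarr_cmp: "\<lbrakk>f \<in> hom C V V'; f' \<in> hom C V' V''; g \<in> hom M N N'; g' \<in> hom M N' N''\<rbrakk>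
      \<Longrightarrow> (f' \<cdot>\<^bsub>C\<^esub> f) \<unrhd>\<^bsub>M\<^esub> (g' \<cdot>\<^bsub>M\<^esub> g) = (f' \<unrhd>\<^bsub>M\<^esub> g') \<cdot>\<^bsub>M\<^esub> (f \<unrhd>\<^bsub>M\<^esub> g)"
    and aarr_add_left: "\<lbrakk>f \<in> hom C V V'; f' \<in> hom C V V'; g \<in> hom M N N'\<rbrakk>
      \<Longrightarrow> (f \<oplus>\<^bsub>C\<^esub> f') \<unrhd>\<^bsub>M\<^esub> g = (f \<unrhd>\<^bsub>M\<^esub> g) \<oplus>\<^bsub>M\<^esub> (f' \<unrhd>\<^bsub>M\<^esub> g)"
    and aarr_add_right: "\<lbrakk>f \<in> hom C V V'; g \<in> hom M N N'; g' \<in> hom M N N'\<rbrakk>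
      \<Longrightarrow> f \<unrhd>\<^bsub>M\<^esub> (g \<oplus>\<^bsub>M\<^esub> g') = (f \<unrhd>\<^bsub>M\<^esub> g) \<oplus>\<^bsub>M\<^esub> (f \<unrhd>\<^bsub>M\<^esub> g')"
    and aarr_scale_left: "\<lbrakk>f \<in> hom C V V'; g \<in> hom M N N'\<rbrakk>
      \<Longrightarrow> vscale C c f \<unrhd>\<^bsub>M\<^esub> g = vscale M c (f \<unrhd>\<^bsub>M\<^esub> g)"
    and aarr_scale_right: "\<lbrakk>f \<in> hom C V V'; g \<in> hom M N N'\<rbrakk>
      \<Longrightarrow> f \<unrhd>\<^bsub>M\<^esub> vscale M c g = vscale M c (f \<unrhd>\<^bsub>M\<^esub> g)"
    and aassoc_hom: "\<lbrakk>V \<in> obj C; W \<in> obj C; N \<in> obj M\<rbrakk>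
      \<Longrightarrow> aassoc M V W N \<in> hom M ((V \<otimes>\<^bsub>C\<^esub> W) \<rhd>\<^bsub>M\<^esub> N) (V \<rhd>\<^bsub>M\<^esub> (W \<rhd>\<^bsub>M\<^esub> N))"
    and aassoc_iso: "\<lbrakk>V \<in> obj C; W \<in> obj C; N \<in> obj M\<rbrakk> \<Longrightarrow> iso M (aassoc M V W N)"
    and aassoc_natural: "\<lbrakk>f \<in> hom C V V'; f' \<in> hom C W W'; g \<in> hom M N N'\<rbrakk>
      \<Longrightarrow> aassoc M V' W' N' \<cdot>\<^bsub>M\<^esub> ((f \<boxtimes>\<^bsub>C\<^esub> f') \<unrhd>\<^bsub>M\<^esub> g)
        = (f \<unrhd>\<^bsub>M\<^esub> (f' \<unrhd>\<^bsub>M\<^esub> g)) \<cdot>\<^bsub>M\<^esub> aassoc M V W N"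
    and aunit_hom: "N \<in> obj M \<Longrightarrow> aunit M N \<in> hom M (tone C \<rhd>\<^bsub>M\<^esub> N) N"
    and aunit_iso: "N \<in> obj M \<Longrightarrow> iso M (aunit M N)"
    and aunit_natural: "g \<in> hom M N N'
      \<Longrightarrow> aunit M N' \<cdot>\<^bsub>M\<^esub> (idt C (tone C) \<unrhd>\<^bsub>M\<^esub> g) = g \<cdot>\<^bsub>M\<^esub> aunit M N"
    and action_pentagon: "\<lbrakk>U \<in> obj C; V \<in> obj C; W \<in> obj C; N \<in> obj M\<rbrakk>
      \<Longrightarrow> (idt C U \<unrhd>\<^bsub>M\<^esub> aassoc M V W N) \<cdot>\<^bsub>M\<^esub> aassoc M U (V \<otimes>\<^bsub>C\<^esub> W) N
            \<cdot>\<^bsub>M\<^esub> (tassoc C U V W \<unrhd>\<^bsub>M\<^esub> idt M N)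
        = aassoc M U V (W \<rhd>\<^bsub>M\<^esub> N) \<cdot>\<^bsub>M\<^esub> aassoc M (U \<otimes>\<^bsub>C\<^esub> V) W N"
    and action_triangle: "\<lbrakk>V \<in> obj C; N \<in> obj M\<rbrakk>
      \<Longrightarrow> (idt C V \<unrhd>\<^bsub>M\<^esub> aunit M N) \<cdot>\<^bsub>M\<^esub> aassoc M V (tone C) N = trunit C V \<unrhd>\<^bsub>M\<^esub> idt M N"

text \<open>
  Strong module functors: \<open>s V X : F (V \<rhd> X) \<rightarrow> V \<rhd> F X\<close> is invertible.
\<close>

locale module_functor =
  dom: module_category C M + cod: module_category C N + linear_functor M N F
  for C :: "('k::field, 'o, 'a, 'm) moncat_scheme"
    and M :: "('k, 'o, 'a, 'p, 'b, 'n) modcat_scheme"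
    and N :: "('k, 'o, 'a, 'q, 'c, 'l) modcat_scheme"
    and F :: "('p, 'b, 'q, 'c) functr"
    and s :: "'o \<Rightarrow> 'p \<Rightarrow> 'c" +
  assumes str_hom: "\<lbrakk>V \<in> obj C; X \<in> obj M\<rbrakk>
      \<Longrightarrow> s V X \<in> hom N (fobj F (V \<rhd>\<^bsub>M\<^esub> X)) (V \<rhd>\<^bsub>N\<^esub> fobj F X)"
    and str_iso: "\<lbrakk>V \<in> obj C; X \<in> obj M\<rbrakk> \<Longrightarrow> iso N (s V X)"
    and str_natural: "\<lbrakk>f \<in> hom C V V'; g \<in> hom M X X'\<rbrakk>
      \<Longrightarrow> s V' X' \<cdot>\<^bsub>N\<^esub> farr F (f \<unrhd>\<^bsub>M\<^esub> g) = (f \<unrhd>\<^bsub>N\<^esub> farr F g) \<cdot>\<^bsub>N\<^esub> s V X"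
    and str_assoc: "\<lbrakk>V \<in> obj C; W \<in> obj C; X \<in> obj M\<rbrakk>
      \<Longrightarrow> aassoc N V W (fobj F X) \<cdot>\<^bsub>N\<^esub> s (V \<otimes>\<^bsub>C\<^esub> W) X
        = (idt C V \<unrhd>\<^bsub>N\<^esub> s W X) \<cdot>\<^bsub>N\<^esub> s V (W \<rhd>\<^bsub>M\<^esub> X) \<cdot>\<^bsub>N\<^esub> farr F (aassoc M V W X)"
    and str_unit: "X \<in> obj M
      \<Longrightarrow> aunit N (fobj F X) \<cdot>\<^bsub>N\<^esub> s (tone C) X = farr F (aunit M X)"

definition module_equivalent ::
  "('k::field, 'o, 'a, 'm) moncat_scheme \<Rightarrow> ('k, 'o, 'a, 'p, 'b, 'n) modcat_scheme \<Rightarrow>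
   ('k, 'o, 'a, 'q, 'c, 'l) modcat_scheme \<Rightarrow> bool" where
  "module_equivalent C M N \<longleftrightarrow>
     (\<exists>F s. module_functor C M N F s \<and> equivalence_of_categories M N F)"


section \<open>Algebras, coalgebras and their (co)modules\<close>

record ('o, 'a) algebra =
  alg_obj :: "'o"
  alg_mult :: "'a"
  alg_unit :: "'a"

definition algebra_object ::
  "('k, 'o, 'a, 'm) moncat_scheme \<Rightarrow> ('o, 'a) algebra \<Rightarrow> bool" where
  "algebra_object C R \<longleftrightarrow>
     (let A = alg_obj R; \<mu> = alg_mult R; \<iota> = alg_unit R in
      A \<in> obj C \<and> \<mu> \<in> hom C (A \<otimes>\<^bsub>C\<^esub> A) A \<and> \<iota> \<in> hom C (tone C) A \<and>
      \<mu> \<cdot>\<^bsub>C\<^esub> (\<mu> \<boxtimes>\<^bsub>C\<^esub> idt C A) = \<mu> \<cdot>\<^bsub>C\<^esub> (idt C A \<boxtimes>\<^bsub>C\<^esub> \<mu>) \<cdot>\<^bsub>C\<^esub> tassoc C A A A \<and>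
      \<mu> \<cdot>\<^bsub>C\<^esub> (\<iota> \<boxtimes>\<^bsub>C\<^esub> idt C A) = tlunit C A \<and>
      \<mu> \<cdot>\<^bsub>C\<^esub> (idt C A \<boxtimes>\<^bsub>C\<^esub> \<iota>) = trunit C A)"

definition right_module ::
  "('k, 'o, 'a, 'm) moncat_scheme \<Rightarrow> ('o, 'a) algebra \<Rightarrow> 'o \<times> 'a \<Rightarrow> bool" where
  "right_module C R X \<longleftrightarrow>
     (let A = alg_obj R; \<mu> = alg_mult R; \<iota> = alg_unit R; N = fst X; \<rho> = snd X in
      N \<in> obj C \<and> \<rho> \<in> hom C (N \<otimes>\<^bsub>C\<^esub> A) N \<and>
      \<rho> \<cdot>\<^bsub>C\<^esub> (\<rho> \<boxtimes>\<^bsub>C\<^esub> idt C A) = \<rho> \<cdot>\<^bsub>C\<^esub> (idt C N \<boxtimes>\<^bsub>C\<^esub> \<mu>) \<cdot>\<^bsub>C\<^esub> tassoc C N A A \<and>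
      \<rho> \<cdot>\<^bsub>C\<^esub> (idt C N \<boxtimes>\<^bsub>C\<^esub> \<iota>) = trunit C N)"

record ('o, 'a) coalgebra =
  coalg_obj :: "'o"
  coalg_comult :: "'a"
  coalg_counit :: "'a"

definition coalgebra_object ::
  "('k, 'o, 'a, 'm) moncat_scheme \<Rightarrow> ('o, 'a) coalgebra \<Rightarrow> bool" where
  "coalgebra_object C Q \<longleftrightarrow>
     (let K = coalg_obj Q; \<Delta> = coalg_comult Q; e = coalg_counit Q in
      K \<in> obj C \<and> \<Delta> \<in> hom C K (K \<otimes>\<^bsub>C\<^esub> K) \<and> e \<in> hom C K (tone C) \<and>
      tassoc C K K K \<cdot>\<^bsub>C\<^esub> (\<Delta> \<boxtimes>\<^bsub>C\<^esub> idt C K) \<cdot>\<^bsub>C\<^esub> \<Delta> = (idt C K \<boxtimes>\<^bsub>C\<^esub> \<Delta>) \<cdot>\<^bsub>C\<^esub> \<Delta> \<and>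
      tlunit C K \<cdot>\<^bsub>C\<^esub> (e \<boxtimes>\<^bsub>C\<^esub> idt C K) \<cdot>\<^bsub>C\<^esub> \<Delta> = idt C K \<and>
      trunit C K \<cdot>\<^bsub>C\<^esub> (idt C K \<boxtimes>\<^bsub>C\<^esub> e) \<cdot>\<^bsub>C\<^esub> \<Delta> = idt C K)"

definition right_comodule ::
  "('k, 'o, 'a, 'm) moncat_scheme \<Rightarrow> ('o, 'a) coalgebra \<Rightarrow> 'o \<times> 'a \<Rightarrow> bool" where
  "right_comodule C Q X \<longleftrightarrow>
     (let K = coalg_obj Q; \<Delta> = coalg_comult Q; e = coalg_counit Q; N = fst X; \<delta> = snd X in
      N \<in> obj C \<and> \<delta> \<in> hom C N (N \<otimes>\<^bsub>C\<^esub> K) \<and>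
      tassoc C N K K \<cdot>\<^bsub>C\<^esub> (\<delta> \<boxtimes>\<^bsub>C\<^esub> idt C K) \<cdot>\<^bsub>C\<^esub> \<delta> = (idt C N \<boxtimes>\<^bsub>C\<^esub> \<Delta>) \<cdot>\<^bsub>C\<^esub> \<delta> \<and>
      trunit C N \<cdot>\<^bsub>C\<^esub> (idt C N \<boxtimes>\<^bsub>C\<^esub> e) \<cdot>\<^bsub>C\<^esub> \<delta> = idt C N)"

text \<open>
  Categories of objects with extra structure: an arrow is a triple \<open>(X, f, Y)\<close> of source, underlying
  arrow of \<open>C\<close> and target, so that arrows remember the structures on their source and target.
  All linear structure and all constraints are those of \<open>C\<close>; the parameters are the structured
  objects \<open>S\<close>, the condition \<open>H X Y f\<close> for \<open>f\<close> to be a morphism, and the structure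
  \<open>act V X\<close> put on \<open>V \<otimes> fst X\<close>.
\<close>

type_synonym ('o, 'a) sarr = "('o \<times> 'a) \<times> 'a \<times> ('o \<times> 'a)"

definition structured_modcat ::
  "('k, 'o, 'a, 'm) moncat_scheme \<Rightarrow> ('o \<times> 'a) set \<Rightarrow>
   ('o \<times> 'a \<Rightarrow> 'o \<times> 'a \<Rightarrow> 'a \<Rightarrow> bool) \<Rightarrow> ('o \<Rightarrow> 'o \<times> 'a \<Rightarrow> 'a) \<Rightarrow>
   ('k, 'o, 'a, 'o \<times> 'a, ('o, 'a) sarr) modcat" where
  "structured_modcat C S H act =
     (let action = (\<lambda>V X. (V \<otimes>\<^bsub>C\<^esub> fst X, act V X)) in
     \<lparr>obj = S,
      arr = {(X, f, Y). X \<in> S \<and> Y \<in> S \<and> f \<in> hom C (fst X) (fst Y) \<and> H X Y f},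
      src = (\<lambda>(X, f, Y). X),
      trg = (\<lambda>(X, f, Y). Y),
      idt = (\<lambda>X. (X, idt C (fst X), X)),
      cmp = (\<lambda>(Y', g, Z) (X, f, Y). (X, g \<cdot>\<^bsub>C\<^esub> f, Z)),
      vadd = (\<lambda>(X, f, Y) (X', g, Y'). (X, f \<oplus>\<^bsub>C\<^esub> g, Y)),
      vzero = (\<lambda>X Y. (X, vzero C (fst X) (fst Y), Y)),
      vscale = (\<lambda>c (X, f, Y). (X, vscale C c f, Y)),
      aobj = action,
      aarr = (\<lambda>v (X, f, Y). (action (src C v) X, v \<boxtimes>\<^bsub>C\<^esub> f, action (trg C v) Y)),
      aassoc = (\<lambda>V W X. (action (V \<otimes>\<^bsub>C\<^esub> W) X, tassoc C V W (fst X), action V (action W X))),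
      aunit = (\<lambda>X. (action (tone C) X, tlunit C (fst X), X))\<rparr>)"

definition mod_cat ::
  "('k, 'o, 'a, 'm) moncat_scheme \<Rightarrow> ('o, 'a) algebra \<Rightarrow>
   ('k, 'o, 'a, 'o \<times> 'a, ('o, 'a) sarr) modcat" where
  "mod_cat C R =
     structured_modcat C
       {X. right_module C R X}
       (\<lambda>X Y f. f \<cdot>\<^bsub>C\<^esub> snd X = snd Y \<cdot>\<^bsub>C\<^esub> (f \<boxtimes>\<^bsub>C\<^esub> idt C (alg_obj R)))
       (\<lambda>V X. (idt C V \<boxtimes>\<^bsub>C\<^esub> snd X) \<cdot>\<^bsub>C\<^esub> tassoc C V (fst X) (alg_obj R))"

definition comod_cat ::
  "('k, 'o, 'a, 'm) moncat_scheme \<Rightarrow> ('o, 'a) coalgebra \<Rightarrow>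
   ('k, 'o, 'a, 'o \<times> 'a, ('o, 'a) sarr) modcat" where
  "comod_cat C Q =
     structured_modcat C
       {X. right_comodule C Q X}
       (\<lambda>X Y f. snd Y \<cdot>\<^bsub>C\<^esub> f = (f \<boxtimes>\<^bsub>C\<^esub> idt C (coalg_obj Q)) \<cdot>\<^bsub>C\<^esub> snd X)
       (\<lambda>V X. inv_arr C (tassoc C V (fst X) (coalg_obj Q)) \<cdot>\<^bsub>C\<^esub> (idt C V \<boxtimes>\<^bsub>C\<^esub> snd X))"


section \<open>The algebra and the coalgebra of an object of a module category\<close>

definition act_on ::
  "('k, 'o, 'a, 'p, 'b, 'n) modcat_scheme \<Rightarrow> 'p \<Rightarrow> ('o, 'a, 'p, 'b) functr" where
  "act_on M X = \<lparr>fobj = (\<lambda>V. V \<rhd>\<^bsub>M\<^esub> X), farr = (\<lambda>f. f \<unrhd>\<^bsub>M\<^esub> idt M X)\<rparr>"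

text \<open>
  Let \<open>R\<close> be right adjoint to \<^term>\<open>act_on M X\<close> with unit \<open>\<eta>\<close> and counit \<open>\<epsilon>\<close>. The lax module
  structure \<open>V \<otimes> R N \<rightarrow> R (V \<rhd> N)\<close> of \<open>R\<close> is the mate of the module structure \<^term>\<open>aassoc M\<close> of
  \<^term>\<open>act_on M X\<close>, that is, the transpose of
  \<open>(V \<otimes> R N) \<rhd> X \<rightarrow> V \<rhd> (R N \<rhd> X) \<rightarrow> V \<rhd> N\<close>.
\<close>

definition lax_structure ::
  "('k, 'o, 'a, 'm) moncat_scheme \<Rightarrow> ('k, 'o, 'a, 'p, 'b, 'n) modcat_scheme \<Rightarrow> 'p \<Rightarrow>
   ('p, 'b, 'o, 'a) functr \<Rightarrow> ('o \<Rightarrow> 'a) \<Rightarrow> ('p \<Rightarrow> 'b) \<Rightarrow> 'o \<Rightarrow> 'p \<Rightarrow> 'a" where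
  "lax_structure C M X R \<eta> \<epsilon> V N =
     farr R ((idt C V \<unrhd>\<^bsub>M\<^esub> \<epsilon> N) \<cdot>\<^bsub>M\<^esub> aassoc M V (fobj R N) X) \<cdot>\<^bsub>C\<^esub> \<eta> (V \<otimes>\<^bsub>C\<^esub> fobj R N)"

text \<open>
  Unit and multiplication of the monad \<open>R (- \<rhd> X)\<close>, transported to \<open>- \<otimes> R X\<close> along the lax
  structure \<open>\<phi> V : V \<otimes> R X \<rightarrow> R (V \<rhd> X)\<close>, which is invertible when \<open>C\<close> is rigid.
\<close>

definition monad_unit ::
  "('k, 'o, 'a, 'm) moncat_scheme \<Rightarrow> ('k, 'o, 'a, 'p, 'b, 'n) modcat_scheme \<Rightarrow> 'p \<Rightarrow>
   ('p, 'b, 'o, 'a) functr \<Rightarrow> ('o \<Rightarrow> 'a) \<Rightarrow> ('p \<Rightarrow> 'b) \<Rightarrow> 'o \<Rightarrow> 'a" where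
  "monad_unit C M X R \<eta> \<epsilon> V = inv_arr C (lax_structure C M X R \<eta> \<epsilon> V X) \<cdot>\<^bsub>C\<^esub> \<eta> V"

definition monad_mult ::
  "('k, 'o, 'a, 'm) moncat_scheme \<Rightarrow> ('k, 'o, 'a, 'p, 'b, 'n) modcat_scheme \<Rightarrow> 'p \<Rightarrow>
   ('p, 'b, 'o, 'a) functr \<Rightarrow> ('o \<Rightarrow> 'a) \<Rightarrow> ('p \<Rightarrow> 'b) \<Rightarrow> 'o \<Rightarrow> 'a" where
  "monad_mult C M X R \<eta> \<epsilon> V =
     (let \<phi> = (\<lambda>V. lax_structure C M X R \<eta> \<epsilon> V X) in
      inv_arr C (\<phi> V) \<cdot>\<^bsub>C\<^esub> farr R (\<epsilon> (V \<rhd>\<^bsub>M\<^esub> X))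
        \<cdot>\<^bsub>C\<^esub> farr R (\<phi> V \<unrhd>\<^bsub>M\<^esub> idt M X) \<cdot>\<^bsub>C\<^esub> \<phi> (V \<otimes>\<^bsub>C\<^esub> fobj R X))"

text \<open>
  The algebra \<open>R X\<close> is recovered from the monad \<open>- \<otimes> R X\<close> by evaluating at the unit object.
\<close>

definition end_algebra ::
  "('k, 'o, 'a, 'm) moncat_scheme \<Rightarrow> ('k, 'o, 'a, 'p, 'b, 'n) modcat_scheme \<Rightarrow> 'p \<Rightarrow>
   ('p, 'b, 'o, 'a) functr \<Rightarrow> ('o \<Rightarrow> 'a) \<Rightarrow> ('p \<Rightarrow> 'b) \<Rightarrow> ('o, 'a) algebra" where
  "end_algebra C M X R \<eta> \<epsilon> =
     (let A = fobj R X in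
      \<lparr>alg_obj = A,
       alg_mult = tlunit C A \<cdot>\<^bsub>C\<^esub> monad_mult C M X R \<eta> \<epsilon> (tone C)
                    \<cdot>\<^bsub>C\<^esub> (inv_arr C (tlunit C A) \<boxtimes>\<^bsub>C\<^esub> idt C A),
       alg_unit = tlunit C A \<cdot>\<^bsub>C\<^esub> monad_unit C M X R \<eta> \<epsilon> (tone C)\<rparr>)"

text \<open>
  Dually, let \<open>L\<close> be left adjoint to \<^term>\<open>act_on M X\<close> with unit \<open>\<eta> N : N \<rightarrow> L N \<rhd> X\<close> and counit
  \<open>\<epsilon> V : L (V \<rhd> X) \<rightarrow> V\<close>. The oplax structure \<open>L (V \<rhd> N) \<rightarrow> V \<otimes> L N\<close> is the transpose of
  \<open>V \<rhd> N \<rightarrow> V \<rhd> (L N \<rhd> X) \<rightarrow> (V \<otimes> L N) \<rhd> X\<close>.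
\<close>

definition oplax_structure ::
  "('k, 'o, 'a, 'm) moncat_scheme \<Rightarrow> ('k, 'o, 'a, 'p, 'b, 'n) modcat_scheme \<Rightarrow> 'p \<Rightarrow>
   ('p, 'b, 'o, 'a) functr \<Rightarrow> ('p \<Rightarrow> 'b) \<Rightarrow> ('o \<Rightarrow> 'a) \<Rightarrow> 'o \<Rightarrow> 'p \<Rightarrow> 'a" where
  "oplax_structure C M X L \<eta> \<epsilon> V N =
     \<epsilon> (V \<otimes>\<^bsub>C\<^esub> fobj L N)
       \<cdot>\<^bsub>C\<^esub> farr L (inv_arr M (aassoc M V (fobj L N) X) \<cdot>\<^bsub>M\<^esub> (idt C V \<unrhd>\<^bsub>M\<^esub> \<eta> N))"

definition comonad_counit ::
  "('k, 'o, 'a, 'm) moncat_scheme \<Rightarrow> ('k, 'o, 'a, 'p, 'b, 'n) modcat_scheme \<Rightarrow> 'p \<Rightarrow>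
   ('p, 'b, 'o, 'a) functr \<Rightarrow> ('p \<Rightarrow> 'b) \<Rightarrow> ('o \<Rightarrow> 'a) \<Rightarrow> 'o \<Rightarrow> 'a" where
  "comonad_counit C M X L \<eta> \<epsilon> V = \<epsilon> V \<cdot>\<^bsub>C\<^esub> inv_arr C (oplax_structure C M X L \<eta> \<epsilon> V X)"

definition comonad_comult ::
  "('k, 'o, 'a, 'm) moncat_scheme \<Rightarrow> ('k, 'o, 'a, 'p, 'b, 'n) modcat_scheme \<Rightarrow> 'p \<Rightarrow>
   ('p, 'b, 'o, 'a) functr \<Rightarrow> ('p \<Rightarrow> 'b) \<Rightarrow> ('o \<Rightarrow> 'a) \<Rightarrow> 'o \<Rightarrow> 'a" where
  "comonad_comult C M X L \<eta> \<epsilon> V =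
     (let \<psi> = (\<lambda>V. oplax_structure C M X L \<eta> \<epsilon> V X) in
      \<psi> (V \<otimes>\<^bsub>C\<^esub> fobj L X) \<cdot>\<^bsub>C\<^esub> farr L (\<psi> V \<unrhd>\<^bsub>M\<^esub> idt M X)
        \<cdot>\<^bsub>C\<^esub> farr L (\<eta> (V \<rhd>\<^bsub>M\<^esub> X)) \<cdot>\<^bsub>C\<^esub> inv_arr C (\<psi> V))"

definition coend_coalgebra ::
  "('k, 'o, 'a, 'm) moncat_scheme \<Rightarrow> ('k, 'o, 'a, 'p, 'b, 'n) modcat_scheme \<Rightarrow> 'p \<Rightarrow>
   ('p, 'b, 'o, 'a) functr \<Rightarrow> ('p \<Rightarrow> 'b) \<Rightarrow> ('o \<Rightarrow> 'a) \<Rightarrow> ('o, 'a) coalgebra" where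
  "coend_coalgebra C M X L \<eta> \<epsilon> =
     (let K = fobj L X in
      \<lparr>coalg_obj = K,
       coalg_comult = (tlunit C K \<boxtimes>\<^bsub>C\<^esub> idt C K) \<cdot>\<^bsub>C\<^esub> comonad_comult C M X L \<eta> \<epsilon> (tone C)
                        \<cdot>\<^bsub>C\<^esub> inv_arr C (tlunit C K),
       coalg_counit = comonad_counit C M X L \<eta> \<epsilon> (tone C) \<cdot>\<^bsub>C\<^esub> inv_arr C (tlunit C K)\<rparr>)"

end

theory Submission
  imports Defs
begin

text \<open>
  Write \<open>A\<close> for \<open>R X\<close>. Transposing along \<open>- \<rhd> X \<stileturn> R\<close> reduces every identity between arrows into
  some \<open>R N\<close> to coherence of the action. In this way \<open>N \<mapsto> R N\<close> becomes a functor to \<open>A\<close>-modules with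
  lax structure \<open>\<phi> V N : V \<otimes> R N \<rightarrow> R (V \<rhd> N)\<close>, which is invertible since a dual \<open>V'\<close> of \<open>V\<close> gives
  \<open>Hom(Y, V \<otimes> R N) \<cong> Hom(V' \<otimes> Y, R N) \<cong> Hom(V' \<rhd> (Y \<rhd> X), N) \<cong> Hom(Y \<rhd> X, V \<rhd> N)\<close>.

  The hypotheses on projectives say that \<open>R\<close> preserves epimorphisms (as \<open>- \<rhd> X\<close> preserves
  projectives) and is faithful (as the objects \<open>P \<rhd> X\<close> generate). So the counit is epi, hence the
  cokernel of its kernel, which makes the comparison functor full. A module \<open>(N, r)\<close> is hit by the
  cokernel of the difference of the two maps \<open>(N \<otimes> A) \<rhd> X \<rightarrow> N \<rhd> X\<close>.

  The injective version is the projective one for the opposite categories.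
\<close>

section \<open>Categories\<close>

text \<open>No monadicity theorem and no exactness statement for \<open>R\<close> is invoked; the
  isomorphism behind essential surjectivity is proved by testing on projectives. If
  \<open>y : P \<rightarrow> N\<close> with \<open>P\<close> projective is killed by
  \<open>h\<close>, its image \<open>y \<rhd> X\<close> is killed by \<open>q\<close>, hence lifts
  through \<open>d\<close> because \<open>P \<rhd> X\<close> is projective. The lift comes from an
  arrow \<open>P \<rightarrow> (N \<otimes> A) \<otimes> A\<close>, so \<open>y\<close>, followed by
  insertion of the unit of \<open>A\<close>, is a difference of two arrows that the module structure
  \<open>r\<close> identifies by associativity; applying \<open>r\<close> gives
  \<open>y = 0\<close>. Rigidity enters through the invertibility of \<phi>. It identifies arrows
  \<open>Y \<rhd> X \<rightarrow> V \<rhd> X\<close> with arrows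
  \<open>Y \<rightarrow> V \<otimes> A\<close>, which is what turns the lift into an arrow of
  \<open>C\<close>. For the injective version only composition is reversed, not the order of the
  tensor product. The constraints are therefore replaced by their inverses, right modules become
  right comodules over the same object, and the lax structure of a right adjoint becomes the oplax
  structure of a left adjoint.\<close>

lemma in_hom_iff: "f \<in> hom C A B \<longleftrightarrow> f \<in> arr C \<and> src C f = A \<and> trg C f = B"
  by (auto simp: hom_def)

lemma (in category) obj_src_trg [simp]:
  "f \<in> arr C \<Longrightarrow> src C f \<in> obj C" "f \<in> arr C \<Longrightarrow> trg C f \<in> obj C"
  using src_obj trg_obj by auto

lemma (in category) idt_simps [simp]:
  assumes "A \<in> obj C"
  shows "idt C A \<in> arr C" "src C (idt C A) = A" "trg C (idt C A) = A"
  using idt_hom[OF assms] by (auto simp: hom_def)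

lemma (in category) cmp_simps [simp]:
  assumes "f \<in> arr C" "g \<in> arr C" "src C g = trg C f"
  shows "g \<cdot> f \<in> arr C" "src C (g \<cdot> f) = src C f" "trg C (g \<cdot> f) = trg C g"
  using cmp_hom[of f "src C f" "trg C f" g "trg C g"] assms by (auto simp: hom_def)

lemma (in category) cmp_idt_simps [simp]:
  "\<lbrakk>f \<in> arr C; trg C f = B\<rbrakk> \<Longrightarrow> idt C B \<cdot> f = f"
  "\<lbrakk>f \<in> arr C; src C f = A\<rbrakk> \<Longrightarrow> f \<cdot> idt C A = f"
  using idt_cmp[of f] cmp_idt[of f] by (auto simp: hom_def)

lemma (in category) assoc [simp]:
  assumes "f \<in> arr C" "g \<in> arr C" "h \<in> arr C" "src C g = trg C f" "src C h = trg C g"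
  shows "(h \<cdot> g) \<cdot> f = h \<cdot> g \<cdot> f"
  using assms cmp_assoc[of f "src C f" "trg C f" g "trg C g" h] by (auto simp: hom_def)

text \<open>Composites are normalised to right-nested form, in which \<open>g \<cdot> f\<close> is
  no longer a subterm once a further factor \<open>x\<close> precedes. Restating an equation with
  that trailing factor lets it rewrite inside longer composites.\<close>

lemma (in category) cmp_ext:
  assumes "g \<cdot> f = h" "x \<in> arr C" "f \<in> arr C" "g \<in> arr C" "src C g = trg C f" "src C f = trg C x"
  shows "g \<cdot> f \<cdot> x = h \<cdot> x"
  using assms assoc[of x f g] by simp

lemma (in category) cmp_ext3:
  assumes "g \<cdot> f \<cdot> e = h" "x \<in> arr C" "e \<in> arr C" "f \<in> arr C" "g \<in> arr C"
    "src C g = trg C f" "src C f = trg C e" "src C e = trg C x"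
  shows "g \<cdot> f \<cdot> e \<cdot> x = h \<cdot> x"
  using assms assoc[of x "f \<cdot> e" g] by simp

lemma (in category) inverse_arrows_unique:
  assumes "inverse_arrows C f g" "inverse_arrows C f h"
  shows "g = h"
proof -
  have gh: "f \<in> arr C" "g \<in> arr C" "h \<in> arr C" "src C g = trg C f" "trg C h = src C f"
    "src C h = trg C f" "trg C g = src C f"
    using assms by (auto simp: inverse_arrows_def hom_def)
  have "(g \<cdot> f) \<cdot> h = g \<cdot> f \<cdot> h" using gh by simp
  moreover have "g \<cdot> f = idt C (src C f)" "f \<cdot> h = idt C (trg C f)"
    using assms by (auto simp: inverse_arrows_def)
  ultimately show ?thesis using gh by simp
qed

lemma (in category) inv_arr_eqI:
  assumes "inverse_arrows C f g" shows "inv_arr C f = g"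
  unfolding inv_arr_def using assms inverse_arrows_unique by blast

lemma (in category) inverse_inv_arr:
  assumes "iso C f" shows "inverse_arrows C f (inv_arr C f)"
  using assms inv_arr_eqI unfolding iso_def by metis

lemma inverse_arrows_sym: "inverse_arrows C f g \<Longrightarrow> inverse_arrows C g f"
  by (auto simp: inverse_arrows_def hom_def)

lemma inverse_arrows_iso: "inverse_arrows C f g \<Longrightarrow> iso C f"
  by (auto simp: iso_def)

lemma iso_arr: "iso C f \<Longrightarrow> f \<in> arr C"
  by (auto simp: iso_def inverse_arrows_def)

lemma (in category) inv_arr_simps [simp]:
  assumes "iso C f"
  shows "inv_arr C f \<in> arr C" "src C (inv_arr C f) = trg C f" "trg C (inv_arr C f) = src C f"
    "iso C (inv_arr C f)" "inv_arr C (inv_arr C f) = f"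
proof -
  note * = inverse_inv_arr[OF assms]
  show "inv_arr C f \<in> arr C" "src C (inv_arr C f) = trg C f" "trg C (inv_arr C f) = src C f"
    using * unfolding inverse_arrows_def in_hom_iff by blast+
  show "iso C (inv_arr C f)"
    by (rule inverse_arrows_iso[OF inverse_arrows_sym[OF *]])
  show "inv_arr C (inv_arr C f) = f"
    by (rule inv_arr_eqI[OF inverse_arrows_sym[OF *]])
qed

lemma (in category) inv_arr_cmp [simp]:
  assumes "iso C f"
  shows "inv_arr C f \<cdot> f = idt C (src C f)" "f \<cdot> inv_arr C f = idt C (trg C f)"
    "\<lbrakk>x \<in> arr C; src C f = trg C x\<rbrakk> \<Longrightarrow> inv_arr C f \<cdot> f \<cdot> x = x"
    "\<lbrakk>x \<in> arr C; trg C f = trg C x\<rbrakk> \<Longrightarrow> f \<cdot> inv_arr C f \<cdot> x = x"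
proof -
  note * = inverse_inv_arr[OF assms] iso_arr[OF assms]
  show 1: "inv_arr C f \<cdot> f = idt C (src C f)" and 2: "f \<cdot> inv_arr C f = idt C (trg C f)"
    using * unfolding inverse_arrows_def by blast+
  show "\<lbrakk>x \<in> arr C; src C f = trg C x\<rbrakk> \<Longrightarrow> inv_arr C f \<cdot> f \<cdot> x = x"
    by (subst cmp_ext[OF 1]) (use assms *(2) in simp_all)
  show "\<lbrakk>x \<in> arr C; trg C f = trg C x\<rbrakk> \<Longrightarrow> f \<cdot> inv_arr C f \<cdot> x = x"
    by (subst cmp_ext[OF 2]) (use assms *(2) in simp_all)
qed

lemma (in category) inverse_arrowsI:
  assumes "f \<in> arr C" "g \<in> arr C" "src C g = trg C f" "trg C g = src C f"
    "g \<cdot> f = idt C (src C f)" "f \<cdot> g = idt C (trg C f)"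
  shows "inverse_arrows C f g"
  using assms by (auto simp: inverse_arrows_def hom_def)

lemma (in category) iso_cancel_left:
  assumes "iso C f" "f \<cdot> g = f \<cdot> h" "g \<in> arr C" "h \<in> arr C" "trg C g = src C f" "trg C h = src C f"
  shows "g = h"
proof -
  have "inv_arr C f \<cdot> f \<cdot> g = inv_arr C f \<cdot> f \<cdot> h" by (simp only: assms(2))
  then show ?thesis using assms(1,3-) by simp
qed

lemma (in category) iso_cancel_right:
  assumes "iso C f" "g \<cdot> f = h \<cdot> f" "g \<in> arr C" "h \<in> arr C" "src C g = trg C f" "src C h = trg C f"
  shows "g = h"
proof -
  have "(g \<cdot> f) \<cdot> inv_arr C f = (h \<cdot> f) \<cdot> inv_arr C f" by (simp only: assms(2))
  then show ?thesis using assms(1,3-) iso_arr[OF assms(1)] by simp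
qed

lemma (in category) iso_idt: "A \<in> obj C \<Longrightarrow> iso C (idt C A)"
  by (rule inverse_arrows_iso[of _ _ "idt C A"]) (simp add: inverse_arrowsI)

lemma (in category) inv_arr_idt [simp]: "A \<in> obj C \<Longrightarrow> inv_arr C (idt C A) = idt C A"
  by (rule inv_arr_eqI) (simp add: inverse_arrowsI)

lemma (in category) iso_epi: assumes "iso C f" shows "epi C f"
  unfolding epi_def in_hom_iff 
  by (intro conjI allI ballI impI iso_arr[OF assms]) (rule iso_cancel_right[OF assms]; simp add: in_hom_iff)

lemma (in category) epi_cancel:
  assumes "epi C f" "g \<cdot> f = h \<cdot> f" "g \<in> arr C" "h \<in> arr C" "src C g = trg C f" "src C h = trg C f"
    "trg C g = trg C h"
  shows "g = h"
proof -
  have "g \<in> hom C (trg C f) (trg C h)" "h \<in> hom C (trg C f) (trg C h)"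
    using assms by (simp_all add: in_hom_iff)
  then show ?thesis using assms(1,2) unfolding epi_def by blast
qed

lemma (in category) mono_cancel:
  assumes "mono C f" "f \<cdot> g = f \<cdot> h" "g \<in> arr C" "h \<in> arr C" "trg C g = src C f" "trg C h = src C f"
    "src C g = src C h"
  shows "g = h"
proof -
  have "g \<in> hom C (src C h) (src C f)" "h \<in> hom C (src C h) (src C f)"
    using assms by (simp_all add: in_hom_iff)
  then show ?thesis using assms(1,2) unfolding mono_def by blast
qed

lemma epi_arr: "epi C f \<Longrightarrow> f \<in> arr C"
  by (simp add: epi_def)

lemma (in category) epi_cmp:
  assumes "epi C f" "epi C g" "src C g = trg C f" shows "epi C (g \<cdot> f)"
  unfolding epi_def in_hom_iff
proof (intro conjI allI ballI impI)
  note [simp] = epi_arr[OF assms(1)] epi_arr[OF assms(2)] assms(3)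
  show "g \<cdot> f \<in> arr C" by simp
  fix A x y
  assume "x \<in> hom C (trg C (g \<cdot> f)) A" "y \<in> hom C (trg C (g \<cdot> f)) A"
    and *: "x \<cdot> g \<cdot> f = y \<cdot> g \<cdot> f"
  then have [simp]: "x \<in> arr C" "y \<in> arr C" "src C x = trg C g" "src C y = trg C g"
    "trg C x = A" "trg C y = A"
    by (auto simp: hom_def)
  have "x \<cdot> g = y \<cdot> g" by (rule epi_cancel[OF assms(1)]) (use * in simp_all)
  then show "x = y" by (rule epi_cancel[OF assms(2)]) simp_all
qed

lemma (in category) epi_of_cmp:
  assumes "epi C (g \<cdot> f)" "f \<in> arr C" "g \<in> arr C" "src C g = trg C f"
  shows "epi C g"
  unfolding epi_def in_hom_iff
proof (intro conjI allI ballI impI)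
  show "g \<in> arr C" by fact
  fix A x y
  assume "x \<in> hom C (trg C g) A" "y \<in> hom C (trg C g) A" and *: "x \<cdot> g = y \<cdot> g"
  then have [simp]: "x \<in> arr C" "y \<in> arr C" "src C x = trg C g" "src C y = trg C g"
    "trg C x = A" "trg C y = A"
    by (simp_all add: in_hom_iff)
  note [simp] = assms(2-4)
  have "(x \<cdot> g) \<cdot> f = (y \<cdot> g) \<cdot> f" by (simp only: *)
  then have "x \<cdot> g \<cdot> f = y \<cdot> g \<cdot> f" by simp
  then show "x = y" by (rule epi_cancel[OF assms(1)]) simp_all
qed

lemma projectiveD:
  assumes "projective C P" "epi C e" "f \<in> hom C P (trg C e)"
  obtains g where "g \<in> hom C P (src C e)" "e \<cdot>\<^bsub>C\<^esub> g = f"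
  using assms unfolding projective_def by blast

lemma is_kernelD:
  assumes "is_kernel C k f" "h \<in> hom C A (src C f)" "f \<cdot>\<^bsub>C\<^esub> h = vzero C A (trg C f)"
  obtains h' where "h' \<in> hom C A (src C k)" "k \<cdot>\<^bsub>C\<^esub> h' = h"
  using assms unfolding is_kernel_def by blast

lemma is_cokernelD:
  assumes "is_cokernel C c f" "h \<in> hom C (trg C f) A" "h \<cdot>\<^bsub>C\<^esub> f = vzero C (src C f) A"
  obtains h' where "h' \<in> hom C (trg C c) A" "h' \<cdot>\<^bsub>C\<^esub> c = h"
  using assms unfolding is_cokernel_def by blast

section \<open>Linear and abelian categories\<close>

context linear_category begin

lemma vadd_simps [simp]:
  assumes "f \<in> arr C" "g \<in> arr C" "src C f = src C g" "trg C f = trg C g"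
  shows "f \<oplus> g \<in> arr C" "src C (f \<oplus> g) = src C g" "trg C (f \<oplus> g) = trg C g"
  using vadd_hom[of f "src C f" "trg C f" g] assms by (auto simp: hom_def)

lemma vzero_simps [simp]:
  assumes "A \<in> obj C" "B \<in> obj C"
  shows "vzero C A B \<in> arr C" "src C (vzero C A B) = A" "trg C (vzero C A B) = B"
  using vzero_hom[of A B] assms by (auto simp: hom_def)

lemma vscale_simps [simp]:
  assumes "f \<in> arr C"
  shows "vscale C c f \<in> arr C" "src C (vscale C c f) = src C f" "trg C (vscale C c f) = trg C f"
  using vscale_hom[of f "src C f" "trg C f"] assms by (auto simp: hom_def)

lemma cmp_vadd:
  assumes "f \<in> arr C" "g \<in> arr C" "src C f = src C g" "trg C f = trg C g" "h \<in> arr C"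
  shows "trg C h = src C g \<Longrightarrow> (f \<oplus> g) \<cdot> h = f \<cdot> h \<oplus> g \<cdot> h"
    "src C h = trg C g \<Longrightarrow> h \<cdot> (f \<oplus> g) = h \<cdot> f \<oplus> h \<cdot> g"
  using assms cmp_add_left[of h "src C h" "src C g" f "trg C g" g]
    cmp_add_right[of f "src C g" "trg C g" g h "trg C h"] by (auto simp: hom_def)

lemma cmp_vscale:
  assumes "f \<in> arr C" "g \<in> arr C" "src C g = trg C f"
  shows "vscale C c g \<cdot> f = vscale C c (g \<cdot> f)" "g \<cdot> vscale C c f = vscale C c (g \<cdot> f)"
  using assms cmp_scale_left[of f "src C f" "trg C f" g "trg C g"]
    cmp_scale_right[of f "src C f" "trg C f" g "trg C g"] by (auto simp: hom_def)

lemma vadd_idem_zero: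
  assumes "f \<in> hom C A B" "f \<oplus> f = f" shows "f = vzero C A B"
proof -
  obtain g where g: "g \<in> hom C A B" "f \<oplus> g = vzero C A B" using vadd_inverse[OF assms(1)] by blast
  have AB: "A \<in> obj C" "B \<in> obj C" using assms(1) by (auto simp: hom_def)
  have "vzero C A B = (f \<oplus> f) \<oplus> g" using assms g by simp
  also have "\<dots> = f \<oplus> vzero C A B" using vadd_assoc[OF assms(1,1) g(1)] g by simp
  also have "\<dots> = f" using vadd_commute[OF assms(1) vzero_hom[OF AB]] vzero_add[OF assms(1)] by simp
  finally show ?thesis by simp
qed

lemma vscale_0: assumes "f \<in> hom C A B" shows "vscale C 0 f = vzero C A B"
  using vscale_add_left[OF assms, of 0 0] vadd_idem_zero[OF vscale_hom[OF assms]] by simp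

lemma vscale_vzero: assumes "A \<in> obj C" "B \<in> obj C" shows "vscale C c (vzero C A B) = vzero C A B"
proof -
  note z = vzero_hom[OF assms]
  show ?thesis using vscale_vscale[OF z, of c 0] vscale_0[OF z] by simp
qed

lemma cmp_vzero [simp]:
  assumes "f \<in> arr C" "A \<in> obj C"
  shows "src C f = B \<Longrightarrow> f \<cdot> vzero C A B = vzero C A (trg C f)"
    "trg C f = B \<Longrightarrow> vzero C B A \<cdot> f = vzero C (src C f) A"
proof -
  show "f \<cdot> vzero C A B = vzero C A (trg C f)" if "src C f = B"
  proof (rule vadd_idem_zero)
    show "f \<cdot> vzero C A B \<in> hom C A (trg C f)" using assms that by (auto simp: hom_def)
    have "vzero C A B \<oplus> vzero C A B = vzero C A B"
      using assms that by (intro vzero_add) (auto simp: hom_def)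
    then show "f \<cdot> vzero C A B \<oplus> f \<cdot> vzero C A B = f \<cdot> vzero C A B"
      using assms that cmp_vadd(2)[of "vzero C A B" "vzero C A B" f] by auto
  qed
  show "vzero C B A \<cdot> f = vzero C (src C f) A" if "trg C f = B"
  proof (rule vadd_idem_zero)
    show "vzero C B A \<cdot> f \<in> hom C (src C f) A" using assms that by (auto simp: hom_def)
    have "vzero C B A \<oplus> vzero C B A = vzero C B A"
      using assms that by (intro vzero_add) (auto simp: hom_def)
    then show "vzero C B A \<cdot> f \<oplus> vzero C B A \<cdot> f = vzero C B A \<cdot> f"
      using assms that cmp_vadd(1)[of "vzero C B A" "vzero C B A" f] by auto
  qed
qed

text \<open>The axioms only assert that some additive inverse exists. Scaling by \<open>-1\<close>
  names one, and every difference of arrows below is written in this way.\<close>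

lemma vadd_neg: assumes "f \<in> hom C A B" shows "f \<oplus> vscale C (-1) f = vzero C A B"
  using vscale_add_left[OF assms, of 1 "-1"] vscale_one[OF assms] vscale_0[OF assms] by simp

lemma vadd_neg_eq_zero_iff:
  assumes f: "f \<in> hom C A B" and g: "g \<in> hom C A B"
  shows "f \<oplus> vscale C (-1) g = vzero C A B \<longleftrightarrow> f = g"
proof
  assume *: "f \<oplus> vscale C (-1) g = vzero C A B"
  note g' = vscale_hom[OF g, of "-1"]
  have AB: "A \<in> obj C" "B \<in> obj C" using f by (auto simp: hom_def)
  have z: "vscale C (-1) g \<oplus> g = vzero C A B"
    using vadd_neg[OF g] vadd_commute[OF g g'] by simp
  have "f = f \<oplus> vzero C A B"
    using vadd_commute[OF f vzero_hom[OF AB]] vzero_add[OF f] by simp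
  also have "\<dots> = (f \<oplus> vscale C (-1) g) \<oplus> g" using vadd_assoc[OF f g' g] z by simp
  also have "\<dots> = g" using * vzero_add[OF g] by simp
  finally show "f = g" .
qed (use vadd_neg[OF f] in simp)

end

section \<open>Exactness in abelian categories\<close>

context abelian_category begin

lemma is_kernel_mono: assumes "is_kernel C k f" shows "mono C k"
  unfolding mono_def
proof (intro conjI allI ballI impI)
  show k: "k \<in> arr C" using assms by (simp add: is_kernel_def)
  fix A g h
  assume gh: "g \<in> hom C A (src C k)" "h \<in> hom C A (src C k)" "k \<cdot> g = k \<cdot> h"
  have f: "f \<in> arr C" "src C f = trg C k" "f \<cdot> k = vzero C (src C k) (trg C f)"
    using assms by (auto simp: is_kernel_def)
  have "f \<cdot> k \<cdot> g = vzero C A (trg C f)"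
    using cmp_ext[OF f(3), of g] gh f k by (auto simp: hom_def)
  moreover have "k \<cdot> g \<in> hom C A (src C f)" using gh f k by (auto simp: hom_def)
  ultimately have "\<exists>!h'. h' \<in> hom C A (src C k) \<and> k \<cdot> h' = k \<cdot> g"
    using assms unfolding is_kernel_def by blast
  then show "g = h" using gh by metis
qed

lemma is_cokernel_epi: assumes "is_cokernel C c f" shows "epi C c"
  unfolding epi_def
proof (intro conjI allI ballI impI)
  show c: "c \<in> arr C" using assms by (simp add: is_cokernel_def)
  fix A g h
  assume gh: "g \<in> hom C (trg C c) A" "h \<in> hom C (trg C c) A" "g \<cdot> c = h \<cdot> c"
  have f: "f \<in> arr C" "src C c = trg C f" "c \<cdot> f = vzero C (src C f) (trg C c)"
    using assms by (auto simp: is_cokernel_def)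
  have "(g \<cdot> c) \<cdot> f = vzero C (src C f) A"
    using gh f c by (auto simp: hom_def)
  moreover have "g \<cdot> c \<in> hom C (trg C f) A" using gh f c by (auto simp: hom_def)
  ultimately have "\<exists>!h'. h' \<in> hom C (trg C c) A \<and> h' \<cdot> c = g \<cdot> c"
    using assms unfolding is_cokernel_def by blast
  then show "g = h" using gh by metis
qed

text \<open>Being mono, \<open>f\<close> is the kernel of some \<open>g\<close>; being epi, it
  forces \<open>g = 0\<close>. So the identity factors through \<open>f\<close>, and the right
  inverse obtained is two-sided because \<open>f\<close> is mono.\<close>

lemma mono_epi_iso: assumes "mono C f" "epi C f" shows "iso C f"
proof -
  obtain g where g: "is_kernel C f g" using mono_is_kernel[OF assms(1)] by blast
  have f: "f \<in> arr C" "g \<in> arr C" "src C g = trg C f" "g \<cdot> f = vzero C (src C f) (trg C g)"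
    using g by (auto simp: is_kernel_def)
  have "g = vzero C (trg C f) (trg C g)"
    by (rule epi_cancel[OF assms(2)]) (use f in simp_all)
  then have "g \<cdot> idt C (trg C f) = vzero C (trg C f) (trg C g)" using f by simp
  moreover have "idt C (trg C f) \<in> hom C (trg C f) (src C g)" using f by (auto simp: hom_def)
  ultimately obtain h where h: "h \<in> hom C (trg C f) (src C f)" "f \<cdot> h = idt C (trg C f)"
    using is_kernelD[OF g] by blast
  have "h \<cdot> f = idt C (src C f)"
    by (rule mono_cancel[OF assms(1)])
      (use h f in \<open>simp_all add: hom_def cmp_ext[OF h(2)]\<close>)
  then have "inverse_arrows C f h" using h f by (intro inverse_arrowsI) (auto simp: hom_def)
  then show ?thesis by (rule inverse_arrows_iso)
qed

text \<open>The epi \<open>e\<close> is the cokernel of some \<open>k\<close>, and \<open>k\<close>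
  itself is one of the arrows \<open>x\<close> on which \<open>g\<close> is assumed to
  vanish.\<close>

lemma factor_through_epi:
  assumes "epi C e" "g \<in> hom C (src C e) A"
    and *: "\<And>Z x. \<lbrakk>x \<in> hom C Z (src C e); e \<cdot> x = vzero C Z (trg C e)\<rbrakk> \<Longrightarrow> g \<cdot> x = vzero C Z A"
  shows "\<exists>h \<in> hom C (trg C e) A. h \<cdot> e = g"
proof -
  obtain k where k: "is_cokernel C e k" using epi_is_cokernel[OF assms(1)] by blast
  then have kr: "k \<in> hom C (src C k) (src C e)" "trg C k = src C e"
    "e \<cdot> k = vzero C (src C k) (trg C e)"
    by (simp_all add: is_cokernel_def hom_def)
  show ?thesis using is_cokernelD[OF k, of g A] *[OF kr(1,3)] assms(2) kr(2) by auto
qed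

text \<open>Exactness at the target of \<open>d\<close>: the kernel of its cokernel is its image. If
  \<open>g\<close> kills \<open>d'\<close>, then \<open>d'\<close> lies in the subobject
  \<open>j = ker g\<close>; the argument shows that this subobject is everything, so
  \<open>g = 0\<close>.\<close>

lemma kernel_of_cokernel_epi:
  assumes q: "is_cokernel C q d" and k: "is_kernel C k q"
    and d': "d' \<in> hom C (src C d) (src C k)" "k \<cdot> d' = d"
  shows "epi C d'"
proof -
  have [simp]: "d \<in> arr C" "q \<in> arr C" "src C q = trg C d" "q \<cdot> d = vzero C (src C d) (trg C q)"
    "k \<in> arr C" "trg C k = trg C d" "q \<cdot> k = vzero C (src C k) (trg C q)"
    "d' \<in> arr C" "src C d' = src C d" "trg C d' = src C k"
    using q k d' by (auto simp: is_cokernel_def is_kernel_def hom_def)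
  have zero: "g = vzero C (src C k) A"
    if g: "g \<in> hom C (src C k) A" and gd: "g \<cdot> d' = vzero C (src C d) A" for g A
  proof -
    have [simp]: "g \<in> arr C" "src C g = src C k" "trg C g = A" "A \<in> obj C"
      using g trg_obj by (auto simp: hom_def)
    obtain j where j: "is_kernel C j g" using ex_kernel[of g] by auto
    have [simp]: "j \<in> arr C" "trg C j = src C k" "g \<cdot> j = vzero C (src C j) A"
      using j by (auto simp: is_kernel_def)
    obtain d'' where d'': "d'' \<in> hom C (src C d) (src C j)" "j \<cdot> d'' = d'"
      using is_kernelD[OF j, of d' "src C d"] gd by (auto simp: hom_def)
    have [simp]: "d'' \<in> arr C" "src C d'' = src C d" "trg C d'' = src C j"
      using d'' by (auto simp: hom_def)
    have "mono C (k \<cdot> j)"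
      unfolding mono_def
    proof (intro conjI allI ballI impI)
      show "k \<cdot> j \<in> arr C" by simp
      fix Z x y
      assume "x \<in> hom C Z (src C (k \<cdot> j))" "y \<in> hom C Z (src C (k \<cdot> j))"
        and *: "(k \<cdot> j) \<cdot> x = (k \<cdot> j) \<cdot> y"
      then have [simp]: "x \<in> arr C" "y \<in> arr C" "trg C x = src C j" "trg C y = src C j"
        "src C x = src C y" by (auto simp: hom_def)
      have "j \<cdot> x = j \<cdot> y"
        by (rule mono_cancel[OF is_kernel_mono[OF k]]) (use * in simp_all)
      then show "x = y"
        by (rule mono_cancel[OF is_kernel_mono[OF j]]) simp_all
    qed
    \<comment> \<open>Since \<open>k \<cdot> j\<close> is a kernel, an arrow factors through it as
      soon as \<open>w\<close> kills it. As \<open>d\<close> factors through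
      \<open>k \<cdot> j\<close>, the arrow \<open>w\<close> kills \<open>d\<close> and so factors
      through \<open>q\<close>; hence \<open>w\<close> kills \<open>k\<close> too, and
      \<open>j\<close> gets a section.\<close>
    then obtain w where w: "is_kernel C (k \<cdot> j) w" using mono_is_kernel by blast
    have [simp]: "w \<in> arr C" "src C w = trg C d" "w \<cdot> k \<cdot> j = vzero C (src C j) (trg C w)"
      using w by (auto simp: is_kernel_def)
    have "w \<cdot> d = w \<cdot> k \<cdot> j \<cdot> d''" using d'' d' by simp
    also have "\<dots> = vzero C (src C d) (trg C w)"
      by (rule trans[OF cmp_ext3[of w k j "vzero C (src C j) (trg C w)"]]) simp_all
    finally obtain w' where w': "w' \<in> hom C (trg C q) (trg C w)" "w' \<cdot> q = w"
      using is_cokernelD[OF q, of w "trg C w"] by (auto simp: hom_def)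
    have "w \<cdot> k = w' \<cdot> q \<cdot> k" using w' by (auto simp: hom_def)
    also have "\<dots> = vzero C (src C k) (trg C w)" using w' by (auto simp: hom_def)
    finally obtain s where s: "s \<in> hom C (src C k) (src C j)" "(k \<cdot> j) \<cdot> s = k"
      using is_kernelD[OF w, of k "src C k"] by (auto simp: hom_def)
    have [simp]: "s \<in> arr C" "src C s = src C k" "trg C s = src C j" using s by (auto simp: hom_def)
    have js: "j \<cdot> s = idt C (src C k)"
      by (rule mono_cancel[OF is_kernel_mono[OF k]]) (use s in simp_all)
    have "g = g \<cdot> j \<cdot> s" by (simp add: js)
    also have "\<dots> = vzero C (src C k) A"
      by (rule trans[OF cmp_ext[of g j "vzero C (src C j) A"]]) simp_all
    finally show ?thesis .
  qed
  show ?thesis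
    unfolding epi_def
  proof (intro conjI allI ballI impI)
    fix A x y
    assume xy: "x \<in> hom C (trg C d') A" "y \<in> hom C (trg C d') A" "x \<cdot> d' = y \<cdot> d'"
    then have [simp]: "x \<in> arr C" "y \<in> arr C" "src C x = src C k" "src C y = src C k"
      "trg C x = A" "trg C y = A" by (auto simp: hom_def)
    \<comment> \<open>Passing to the difference reduces cancellation to the vanishing criterion
      \<open>zero\<close>.\<close>
    have "y \<cdot> d' \<in> hom C (src C d) A" by (auto simp: hom_def)
    from vadd_neg[OF this] have "(x \<oplus> vscale C (-1) y) \<cdot> d' = vzero C (src C d) A"
      using xy by (simp add: cmp_vadd cmp_vscale)
    then have "x \<oplus> vscale C (-1) y = vzero C (src C k) A"
      by (intro zero) (auto simp: hom_def)
    then show "x = y"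
      using vadd_neg_eq_zero_iff[of x "src C k" A y] xy by auto
  qed simp
qed

text \<open>By exactness \<open>x\<close> first factors through the kernel of \<open>q\<close>, and
  the arrow from the source of \<open>d\<close> onto that kernel is epi, so projectivity
  applies.\<close>

lemma projective_lift_exact:
  assumes q: "is_cokernel C q d" and P: "projective C P"
    and x: "x \<in> hom C P (trg C d)" "q \<cdot> x = vzero C P (trg C q)"
  shows "\<exists>z \<in> hom C P (src C d). d \<cdot> z = x"
proof -
  have [simp]: "d \<in> arr C" "q \<in> arr C" "src C q = trg C d" "q \<cdot> d = vzero C (src C d) (trg C q)"
    using q by (auto simp: is_cokernel_def)
  obtain k where k: "is_kernel C k q" using ex_kernel[of q] by auto
  then obtain d' where d': "d' \<in> hom C (src C d) (src C k)" "k \<cdot> d' = d"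
    using is_kernelD[OF k, of d "src C d"] by (auto simp: hom_def)
  obtain x' where x': "x' \<in> hom C P (src C k)" "k \<cdot> x' = x"
    using is_kernelD[OF k, of x P] x by auto
  obtain z where z: "z \<in> hom C P (src C d')" "d' \<cdot> z = x'"
    using projectiveD[OF P kernel_of_cokernel_epi[OF q k d'], of x'] x' d' by (auto simp: hom_def)
  have "d \<cdot> z = x"
    using d' x' z k assoc[of z d' k] by (auto simp: hom_def is_kernel_def)
  then show ?thesis using z d' by (auto simp: hom_def)
qed

end

section \<open>Monoidal categories and module categories\<close>

context category begin

lemma inverse_arrows_cmp:
  assumes "iso C f" "iso C g" "src C g = trg C f"
  shows "inverse_arrows C (g \<cdot> f) (inv_arr C f \<cdot> inv_arr C g)"
  by (rule inverse_arrowsI) (use assms iso_arr[OF assms(1)] iso_arr[OF assms(2)] in simp_all)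

lemma iso_cmp [simp]: "\<lbrakk>iso C f; iso C g; src C g = trg C f\<rbrakk> \<Longrightarrow> iso C (g \<cdot> f)"
  by (rule inverse_arrows_iso[OF inverse_arrows_cmp])

text \<open>Conjugation turns a square with two invertible sides around. This yields naturality of
  inverse constraints throughout.\<close>

lemma inv_arr_natural:
  assumes "iso C a" "iso C b" "b \<cdot> f = g \<cdot> a" "f \<in> arr C" "g \<in> arr C"
    "trg C f = src C b" "src C f = src C a" "src C g = trg C a" "trg C g = trg C b"
  shows "inv_arr C b \<cdot> g = f \<cdot> inv_arr C a"
proof -
  note [simp] = assms(1,2,4-9) iso_arr[OF assms(1)] iso_arr[OF assms(2)]
  have "inv_arr C b \<cdot> g = inv_arr C b \<cdot> (g \<cdot> a) \<cdot> inv_arr C a" by simp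
  also have "\<dots> = inv_arr C b \<cdot> (b \<cdot> f) \<cdot> inv_arr C a" by (simp only: assms(3))
  also have "\<dots> = f \<cdot> inv_arr C a" by simp
  finally show ?thesis .
qed

end

context monoidal_category begin

lemmas [simp] = tobj_obj tone_obj tarr_idt tassoc_iso tlunit_iso trunit_iso

lemma tarr_simps [simp]:
  assumes "f \<in> arr C" "g \<in> arr C"
  shows "f \<boxtimes> g \<in> arr C" "src C (f \<boxtimes> g) = src C f \<otimes> src C g" "trg C (f \<boxtimes> g) = trg C f \<otimes> trg C g"
  using tarr_hom[of f "src C f" "trg C f" g "src C g" "trg C g"] assms by (auto simp: hom_def)

lemma constraint_simps [simp]:
  "\<lbrakk>U \<in> obj C; V \<in> obj C; W \<in> obj C\<rbrakk> \<Longrightarrow> tassoc C U V W \<in> arr C"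
  "\<lbrakk>U \<in> obj C; V \<in> obj C; W \<in> obj C\<rbrakk> \<Longrightarrow> src C (tassoc C U V W) = U \<otimes> V \<otimes> W"
  "\<lbrakk>U \<in> obj C; V \<in> obj C; W \<in> obj C\<rbrakk> \<Longrightarrow> trg C (tassoc C U V W) = U \<otimes> (V \<otimes> W)"
  "V \<in> obj C \<Longrightarrow> tlunit C V \<in> arr C"
  "V \<in> obj C \<Longrightarrow> src C (tlunit C V) = tone C \<otimes> V"
  "V \<in> obj C \<Longrightarrow> trg C (tlunit C V) = V"
  "V \<in> obj C \<Longrightarrow> trunit C V \<in> arr C"
  "V \<in> obj C \<Longrightarrow> src C (trunit C V) = V \<otimes> tone C"
  "V \<in> obj C \<Longrightarrow> trg C (trunit C V) = V"
  using tassoc_hom tlunit_hom trunit_hom by (auto simp: hom_def)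

lemma tarr_cmp_merge:
  assumes "f \<in> arr C" "f' \<in> arr C" "g \<in> arr C" "g' \<in> arr C" "src C f' = trg C f" "src C g' = trg C g"
  shows "(f' \<boxtimes> g') \<cdot> (f \<boxtimes> g) = (f' \<cdot> f) \<boxtimes> (g' \<cdot> g)"
  using tarr_cmp[of f "src C f" "trg C f" f' "trg C f'" g "src C g" "trg C g" g' "trg C g'"] assms
  by (auto simp: hom_def)

lemma tarr_whisker [simp]:
  assumes "f \<in> arr C" "g \<in> arr C" "src C g = trg C f" "V \<in> obj C"
  shows "idt C V \<boxtimes> (g \<cdot> f) = (idt C V \<boxtimes> g) \<cdot> (idt C V \<boxtimes> f)"
    "(g \<cdot> f) \<boxtimes> idt C V = (g \<boxtimes> idt C V) \<cdot> (f \<boxtimes> idt C V)"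
  using assms by (simp_all add: tarr_cmp_merge)

lemma tassoc_nat:
  assumes "f \<in> arr C" "g \<in> arr C" "h \<in> arr C" "trg C f = U" "trg C g = V" "trg C h = W"
  shows "tassoc C U V W \<cdot> ((f \<boxtimes> g) \<boxtimes> h) = (f \<boxtimes> (g \<boxtimes> h)) \<cdot> tassoc C (src C f) (src C g) (src C h)"
  using tassoc_natural[of f "src C f" U g "src C g" V h "src C h" W] assms by (auto simp: hom_def)

lemma tlunit_nat:
  "\<lbrakk>f \<in> arr C; trg C f = V\<rbrakk> \<Longrightarrow> tlunit C V \<cdot> (idt C (tone C) \<boxtimes> f) = f \<cdot> tlunit C (src C f)"
  using tlunit_natural by (auto simp: hom_def)

lemma trunit_nat:
  "\<lbrakk>f \<in> arr C; trg C f = V\<rbrakk> \<Longrightarrow> trunit C V \<cdot> (f \<boxtimes> idt C (tone C)) = f \<cdot> trunit C (src C f)"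
  using trunit_natural by (auto simp: hom_def)

end

context module_category begin

lemmas [simp] = aobj_obj aarr_idt aassoc_iso aunit_iso

lemma aarr_simps [simp]:
  assumes "f \<in> arr C" "g \<in> arr M"
  shows "f \<unrhd>\<^bsub>M\<^esub> g \<in> arr M" "src M (f \<unrhd>\<^bsub>M\<^esub> g) = src C f \<rhd>\<^bsub>M\<^esub> src M g" "trg M (f \<unrhd>\<^bsub>M\<^esub> g) = trg C f \<rhd>\<^bsub>M\<^esub> trg M g"
  using aarr_hom[of f "src C f" "trg C f" g "src M g" "trg M g"] assms by (auto simp: hom_def)

lemma constraint_simps [simp]:
  "\<lbrakk>V \<in> obj C; W \<in> obj C; N \<in> obj M\<rbrakk> \<Longrightarrow> aassoc M V W N \<in> arr M"
  "\<lbrakk>V \<in> obj C; W \<in> obj C; N \<in> obj M\<rbrakk> \<Longrightarrow> src M (aassoc M V W N) = (V \<otimes>\<^bsub>C\<^esub> W) \<rhd>\<^bsub>M\<^esub> N"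
  "\<lbrakk>V \<in> obj C; W \<in> obj C; N \<in> obj M\<rbrakk> \<Longrightarrow> trg M (aassoc M V W N) = V \<rhd>\<^bsub>M\<^esub> W \<rhd>\<^bsub>M\<^esub> N"
  "N \<in> obj M \<Longrightarrow> aunit M N \<in> arr M"
  "N \<in> obj M \<Longrightarrow> src M (aunit M N) = tone C \<rhd>\<^bsub>M\<^esub> N"
  "N \<in> obj M \<Longrightarrow> trg M (aunit M N) = N"
  using aassoc_hom aunit_hom by (auto simp: hom_def)

lemma aarr_cmp_merge:
  assumes "f \<in> arr C" "f' \<in> arr C" "g \<in> arr M" "g' \<in> arr M" "src C f' = trg C f" "src M g' = trg M g"
  shows "(f' \<unrhd>\<^bsub>M\<^esub> g') \<cdot>\<^bsub>M\<^esub> (f \<unrhd>\<^bsub>M\<^esub> g) = (f' \<cdot>\<^bsub>C\<^esub> f) \<unrhd>\<^bsub>M\<^esub> (g' \<cdot>\<^bsub>M\<^esub> g)"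
  using aarr_cmp[of f "src C f" "trg C f" f' "trg C f'" g "src M g" "trg M g" g' "trg M g'"] assms
  by (auto simp: hom_def)

lemma aarr_whisker [simp]:
  "\<lbrakk>f \<in> arr M; g \<in> arr M; src M g = trg M f; V \<in> obj C\<rbrakk>
    \<Longrightarrow> idt C V \<unrhd>\<^bsub>M\<^esub> (g \<cdot>\<^bsub>M\<^esub> f) = (idt C V \<unrhd>\<^bsub>M\<^esub> g) \<cdot>\<^bsub>M\<^esub> (idt C V \<unrhd>\<^bsub>M\<^esub> f)"
  "\<lbrakk>f' \<in> arr C; g' \<in> arr C; src C g' = trg C f'; N \<in> obj M\<rbrakk>
    \<Longrightarrow> (g' \<cdot>\<^bsub>C\<^esub> f') \<unrhd>\<^bsub>M\<^esub> idt M N = (g' \<unrhd>\<^bsub>M\<^esub> idt M N) \<cdot>\<^bsub>M\<^esub> (f' \<unrhd>\<^bsub>M\<^esub> idt M N)"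
  by (simp_all add: aarr_cmp_merge)

lemma aarr_iso:
  assumes "iso C f" "iso M g"
  shows "inverse_arrows M (f \<unrhd>\<^bsub>M\<^esub> g) (inv_arr C f \<unrhd>\<^bsub>M\<^esub> inv_arr M g)"
  by (rule M.inverse_arrowsI)
    (use assms iso_arr[OF assms(1)] iso_arr[OF assms(2)] in \<open>simp_all add: aarr_cmp_merge\<close>)

lemma iso_aarr [simp]: "\<lbrakk>iso C f; iso M g\<rbrakk> \<Longrightarrow> iso M (f \<unrhd>\<^bsub>M\<^esub> g)"
  by (rule inverse_arrows_iso[OF aarr_iso])

lemma inv_aarr [simp]: "\<lbrakk>iso C f; iso M g\<rbrakk> \<Longrightarrow> inv_arr M (f \<unrhd>\<^bsub>M\<^esub> g) = inv_arr C f \<unrhd>\<^bsub>M\<^esub> inv_arr M g"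
  by (rule M.inv_arr_eqI[OF aarr_iso])

lemma interchange:
  assumes "f \<in> arr C" "g \<in> arr M" "src M g = N" "trg C f = V"
  shows "(idt C V \<unrhd>\<^bsub>M\<^esub> g) \<cdot>\<^bsub>M\<^esub> (f \<unrhd>\<^bsub>M\<^esub> idt M N) = (f \<unrhd>\<^bsub>M\<^esub> idt M (trg M g)) \<cdot>\<^bsub>M\<^esub> (idt C (src C f) \<unrhd>\<^bsub>M\<^esub> g)"
  using assms by (auto simp: aarr_cmp_merge)

lemma interchange':
  assumes "f \<in> arr C" "g \<in> arr M" "trg M g = N" "src C f = V"
  shows "(f \<unrhd>\<^bsub>M\<^esub> idt M N) \<cdot>\<^bsub>M\<^esub> (idt C V \<unrhd>\<^bsub>M\<^esub> g) = (idt C (trg C f) \<unrhd>\<^bsub>M\<^esub> g) \<cdot>\<^bsub>M\<^esub> (f \<unrhd>\<^bsub>M\<^esub> idt M (src M g))"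
  using assms by (auto simp: aarr_cmp_merge)

lemma aassoc_nat:
  assumes "f \<in> arr C" "f' \<in> arr C" "g \<in> arr M" "trg C f = V" "trg C f' = W" "trg M g = N"
  shows "aassoc M V W N \<cdot>\<^bsub>M\<^esub> ((f \<boxtimes>\<^bsub>C\<^esub> f') \<unrhd>\<^bsub>M\<^esub> g) = (f \<unrhd>\<^bsub>M\<^esub> f' \<unrhd>\<^bsub>M\<^esub> g) \<cdot>\<^bsub>M\<^esub> aassoc M (src C f) (src C f') (src M g)"
  using aassoc_natural[of f "src C f" V f' "src C f'" W g "src M g" N] assms by (auto simp: hom_def)

lemma aassoc_nat_idt:
  assumes "V \<in> obj C" "W \<in> obj C" "g \<in> arr M" "trg M g = N"
  shows "aassoc M V W N \<cdot>\<^bsub>M\<^esub> (idt C (V \<otimes>\<^bsub>C\<^esub> W) \<unrhd>\<^bsub>M\<^esub> g)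
    = (idt C V \<unrhd>\<^bsub>M\<^esub> idt C W \<unrhd>\<^bsub>M\<^esub> g) \<cdot>\<^bsub>M\<^esub> aassoc M V W (src M g)"
  using aassoc_nat[of "idt C V" "idt C W" g V W N] assms by simp

lemma aunit_nat:
  "\<lbrakk>g \<in> arr M; trg M g = N\<rbrakk> \<Longrightarrow> aunit M N \<cdot>\<^bsub>M\<^esub> (idt C (tone C) \<unrhd>\<^bsub>M\<^esub> g) = g \<cdot>\<^bsub>M\<^esub> aunit M (src M g)"
  using aunit_natural by (auto simp: hom_def)

text \<open>Acting by the unit object is naturally isomorphic to the identity functor, by
  \<open>aunit\<close>.\<close>

lemma aunit_faithful:
  assumes "idt C (tone C) \<unrhd>\<^bsub>M\<^esub> f = idt C (tone C) \<unrhd>\<^bsub>M\<^esub> g" "f \<in> arr M" "g \<in> arr M"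
    "src M f = src M g" "trg M f = trg M g"
  shows "f = g"
proof (rule M.iso_cancel_right)
  show "iso M (aunit M (src M g))" using assms by simp
  show "f \<cdot>\<^bsub>M\<^esub> aunit M (src M g) = g \<cdot>\<^bsub>M\<^esub> aunit M (src M g)"
    using aunit_nat[OF assms(2)] aunit_nat[OF assms(3)] assms by simp
qed (use assms in simp_all)

text \<open>The module version of Kelly's unit coherence, which the axioms omit. It suffices to
  compare after acting by the unit object; there the pentagon and the axiomatic triangle, each used
  with unit objects inserted, give the equality.\<close>

lemma aunit_aobj:
  assumes [simp]: "V \<in> obj C" "N \<in> obj M"
  shows "aunit M (V \<rhd>\<^bsub>M\<^esub> N) \<cdot>\<^bsub>M\<^esub> aassoc M (tone C) V N = tlunit C V \<unrhd>\<^bsub>M\<^esub> idt M N"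
proof -
  let ?I = "tone C" and ?i = "idt C (tone C)"
  have "(?i \<unrhd>\<^bsub>M\<^esub> (aunit M (V \<rhd>\<^bsub>M\<^esub> N) \<cdot>\<^bsub>M\<^esub> aassoc M ?I V N)) \<cdot>\<^bsub>M\<^esub> aassoc M ?I (?I \<otimes>\<^bsub>C\<^esub> V) N
      \<cdot>\<^bsub>M\<^esub> (tassoc C ?I ?I V \<unrhd>\<^bsub>M\<^esub> idt M N)
    = (?i \<unrhd>\<^bsub>M\<^esub> aunit M (V \<rhd>\<^bsub>M\<^esub> N)) \<cdot>\<^bsub>M\<^esub> aassoc M ?I ?I (V \<rhd>\<^bsub>M\<^esub> N) \<cdot>\<^bsub>M\<^esub> aassoc M (?I \<otimes>\<^bsub>C\<^esub> ?I) V N"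
    by (simp flip: action_pentagon)
  also have "\<dots> = (trunit C ?I \<unrhd>\<^bsub>M\<^esub> idt M (V \<rhd>\<^bsub>M\<^esub> N)) \<cdot>\<^bsub>M\<^esub> aassoc M (?I \<otimes>\<^bsub>C\<^esub> ?I) V N"
    by (subst M.cmp_ext[OF action_triangle]) simp_all
  also have "\<dots> = aassoc M ?I V N \<cdot>\<^bsub>M\<^esub> ((trunit C ?I \<boxtimes>\<^bsub>C\<^esub> idt C V) \<unrhd>\<^bsub>M\<^esub> idt M N)"
    by (simp add: aassoc_nat)
  also have "\<dots> = aassoc M ?I V N \<cdot>\<^bsub>M\<^esub> (((?i \<boxtimes>\<^bsub>C\<^esub> tlunit C V) \<cdot>\<^bsub>C\<^esub> tassoc C ?I ?I V) \<unrhd>\<^bsub>M\<^esub> idt M N)"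
    by (simp only: C.triangle assms C.tone_obj)
  also have "\<dots> = (?i \<unrhd>\<^bsub>M\<^esub> (tlunit C V \<unrhd>\<^bsub>M\<^esub> idt M N)) \<cdot>\<^bsub>M\<^esub> aassoc M ?I (?I \<otimes>\<^bsub>C\<^esub> V) N
      \<cdot>\<^bsub>M\<^esub> (tassoc C ?I ?I V \<unrhd>\<^bsub>M\<^esub> idt M N)"
    by (simp add: M.cmp_ext[OF aassoc_nat])
  finally have "?i \<unrhd>\<^bsub>M\<^esub> (aunit M (V \<rhd>\<^bsub>M\<^esub> N) \<cdot>\<^bsub>M\<^esub> aassoc M ?I V N) = ?i \<unrhd>\<^bsub>M\<^esub> (tlunit C V \<unrhd>\<^bsub>M\<^esub> idt M N)"
    by (rule M.iso_cancel_right[rotated]) (simp_all add: M.iso_idt)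
  then show ?thesis by (rule aunit_faithful) simp_all
qed

end

text \<open>Acting on itself by tensoring on the left, a monoidal category is a module category, so that
  statements about module categories specialise to it.\<close>

definition regular :: "('k, 'o, 'a, 'm) moncat_scheme \<Rightarrow> ('k, 'o, 'a, 'o, 'a) modcat" where
  "regular C = \<lparr>obj = obj C, arr = arr C, src = src C, trg = trg C, idt = idt C, cmp = cmp C,
     vadd = vadd C, vzero = vzero C, vscale = vscale C, aobj = tobj C, aarr = tarr C,
     aassoc = tassoc C, aunit = tlunit C\<rparr>"

lemma regular_simps [simp]:
  "obj (regular C) = obj C" "arr (regular C) = arr C" "src (regular C) = src C"
  "trg (regular C) = trg C" "idt (regular C) = idt C" "cmp (regular C) = cmp C"
  "vadd (regular C) = vadd C" "vzero (regular C) = vzero C" "vscale (regular C) = vscale C"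
  "aobj (regular C) = tobj C" "aarr (regular C) = tarr C" "aassoc (regular C) = tassoc C"
  "aunit (regular C) = tlunit C"
  by (simp_all add: regular_def)

lemma regular_derived [simp]:
  "hom (regular C) = hom C" "inverse_arrows (regular C) = inverse_arrows C"
  "iso (regular C) = iso C" "inv_arr (regular C) = inv_arr C"
proof -
  show 1: "hom (regular C) = hom C" by (intro ext) (simp add: hom_def)
  show 2: "inverse_arrows (regular C) = inverse_arrows C"
    by (intro ext) (simp add: inverse_arrows_def 1)
  show "iso (regular C) = iso C" "inv_arr (regular C) = inv_arr C"
    by (intro ext, simp add: iso_def inv_arr_def 2)+
qed

lemma (in monoidal_category) regular_module: "module_category C (regular C)"
proof -
  have "linear_category (regular C)"
    using linear_category_axioms
    by (simp add: linear_category_def category_def linear_category_axioms_def)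
  then show ?thesis
    using tarr_hom tarr_cmp tarr_add_left tarr_add_right tarr_scale_left tarr_scale_right
      tassoc_hom tassoc_natural tlunit_hom tlunit_natural pentagon triangle
    by (intro module_category.intro monoidal_category_axioms module_category_axioms.intro) simp_all
qed

context monoidal_category begin

lemmas tassoc_nat_idt = module_category.aassoc_nat_idt [OF regular_module, simplified]
lemmas tlunit_tobj = module_category.aunit_aobj [OF regular_module, simplified]
lemmas iso_tarr [simp] = module_category.iso_aarr [OF regular_module, simplified]
lemmas inv_tarr [simp] = module_category.inv_aarr [OF regular_module, simplified]

lemma trunit_faithful:
  assumes "f \<boxtimes> idt C (tone C) = g \<boxtimes> idt C (tone C)" "f \<in> arr C" "g \<in> arr C"
    "src C f = src C g" "trg C f = trg C g"
  shows "f = g"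
proof (rule iso_cancel_right)
  show "iso C (trunit C (src C g))" using assms by simp
  show "f \<cdot> trunit C (src C g) = g \<cdot> trunit C (src C g)"
    using trunit_nat[OF assms(2)] trunit_nat[OF assms(3)] assms by simp
qed (use assms in simp_all)

text \<open>The mirror image of Kelly's argument. The right unitor is not part of the structure of a
  left module category, so this is not an instance of \<open>aunit_aobj\<close> and is proved after
  tensoring with the unit on the right.\<close>

lemma trunit_tobj:
  assumes [simp]: "V \<in> obj C" "W \<in> obj C"
  shows "(idt C V \<boxtimes> trunit C W) \<cdot> tassoc C V W (tone C) = trunit C (V \<otimes> W)"
proof (rule trunit_faithful)
  let ?I = "tone C" and ?i = "idt C (tone C)" and ?v = "idt C V" and ?w = "idt C W"
  have "tassoc C V W ?I \<cdot> (((?v \<boxtimes> trunit C W) \<cdot> tassoc C V W ?I) \<boxtimes> ?i)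
    = (?v \<boxtimes> (trunit C W \<boxtimes> ?i)) \<cdot> tassoc C V (W \<otimes> ?I) ?I \<cdot> (tassoc C V W ?I \<boxtimes> ?i)"
    by (simp add: cmp_ext[OF tassoc_nat])
  also have "\<dots> = (?v \<boxtimes> ((?w \<boxtimes> tlunit C ?I) \<cdot> tassoc C W ?I ?I)) \<cdot> tassoc C V (W \<otimes> ?I) ?I
      \<cdot> (tassoc C V W ?I \<boxtimes> ?i)"
    by (simp only: triangle assms tone_obj)
  also have "\<dots> = (?v \<boxtimes> (?w \<boxtimes> tlunit C ?I)) \<cdot> tassoc C V W (?I \<otimes> ?I) \<cdot> tassoc C (V \<otimes> W) ?I ?I"
    by (simp flip: pentagon)
  also have "\<dots> = tassoc C V W ?I \<cdot> (idt C (V \<otimes> W) \<boxtimes> tlunit C ?I) \<cdot> tassoc C (V \<otimes> W) ?I ?I"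
    by (simp add: cmp_ext[OF tassoc_nat_idt])
  also have "\<dots> = tassoc C V W ?I \<cdot> (trunit C (V \<otimes> W) \<boxtimes> ?i)"
    by (simp only: triangle assms tone_obj tobj_obj)
  finally show "((?v \<boxtimes> trunit C W) \<cdot> tassoc C V W ?I) \<boxtimes> ?i = trunit C (V \<otimes> W) \<boxtimes> ?i"
    by (rule iso_cancel_left[rotated]) simp_all
qed simp_all

end

section \<open>Duals acting on module categories\<close>

text \<open>Stated for an arbitrary module category so that the same dual pair can be used both in
  \<open>M\<close> and in \<open>regular C\<close>. The invertibility of \<phi> compares these two
  instances.\<close>

locale module_dual = module_category C M
  for C :: "('k::field, 'o, 'a, 'm) moncat_scheme" (structure)
    and M :: "('k, 'o, 'a, 'p, 'b, 'n) modcat_scheme" +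
  fixes V' V ev coev
  assumes dual_pair: "dual_pair C V' V ev coev"
begin

lemma dual_simps [simp]:
  "V \<in> obj C" "V' \<in> obj C" "ev \<in> arr C" "src C ev = V' \<otimes> V" "trg C ev = tone C"
  "coev \<in> arr C" "src C coev = tone C" "trg C coev = V \<otimes> V'"
  using dual_pair by (auto simp: dual_pair_def hom_def)

text \<open>Unit and counit of the adjunction between acting by \<^term>\<open>V'\<close> and acting by \<^term>\<open>V\<close>.\<close>

definition dunit :: "'p \<Rightarrow> 'b" where
  "dunit N = aassoc M V V' N \<cdot>\<^bsub>M\<^esub> (coev \<unrhd>\<^bsub>M\<^esub> idt M N) \<cdot>\<^bsub>M\<^esub> inv_arr M (aunit M N)"

definition dcounit :: "'p \<Rightarrow> 'b" where
  "dcounit N = aunit M N \<cdot>\<^bsub>M\<^esub> (ev \<unrhd>\<^bsub>M\<^esub> idt M N) \<cdot>\<^bsub>M\<^esub> inv_arr M (aassoc M V' V N)"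

lemma dunit_simps [simp]:
  assumes "N \<in> obj M"
  shows "dunit N \<in> arr M" "src M (dunit N) = N" "trg M (dunit N) = V \<rhd>\<^bsub>M\<^esub> V' \<rhd>\<^bsub>M\<^esub> N"
  using assms by (simp_all add: dunit_def)

lemma dcounit_simps [simp]:
  assumes "N \<in> obj M"
  shows "dcounit N \<in> arr M" "src M (dcounit N) = V' \<rhd>\<^bsub>M\<^esub> V \<rhd>\<^bsub>M\<^esub> N" "trg M (dcounit N) = N"
  using assms by (simp_all add: dcounit_def)

lemma dunit_nat:
  assumes [simp]: "f \<in> arr M" 
  shows "dunit (trg M f) \<cdot>\<^bsub>M\<^esub> f = (idt C V \<unrhd>\<^bsub>M\<^esub> idt C V' \<unrhd>\<^bsub>M\<^esub> f) \<cdot>\<^bsub>M\<^esub> dunit (src M f)"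
proof -
  have u: "inv_arr M (aunit M (trg M f)) \<cdot>\<^bsub>M\<^esub> f
      = (idt C (tone C) \<unrhd>\<^bsub>M\<^esub> f) \<cdot>\<^bsub>M\<^esub> inv_arr M (aunit M (src M f))"
    by (rule M.inv_arr_natural) (simp_all add: aunit_nat)
  show ?thesis
    by (simp add: dunit_def u M.cmp_ext[OF interchange'] M.cmp_ext[OF aassoc_nat_idt])
qed

lemma dcounit_nat:
  assumes [simp]: "f \<in> arr M" 
  shows "dcounit (trg M f) \<cdot>\<^bsub>M\<^esub> (idt C V' \<unrhd>\<^bsub>M\<^esub> idt C V \<unrhd>\<^bsub>M\<^esub> f) = f \<cdot>\<^bsub>M\<^esub> dcounit (src M f)"
proof -
  have "inv_arr M (aassoc M V' V (trg M f)) \<cdot>\<^bsub>M\<^esub> (idt C V' \<unrhd>\<^bsub>M\<^esub> idt C V \<unrhd>\<^bsub>M\<^esub> f)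
      = (idt C (V' \<otimes> V) \<unrhd>\<^bsub>M\<^esub> f) \<cdot>\<^bsub>M\<^esub> inv_arr M (aassoc M V' V (src M f))"
    by (rule M.inv_arr_natural) (simp_all add: aassoc_nat_idt)
  then show ?thesis
    by (simp add: dcounit_def M.cmp_ext[OF interchange'] M.cmp_ext[OF aunit_nat])
qed


text \<open>The action pentagon at \<open>V'\<close>, \<open>V\<close>, \<open>W\<close>,
  \<open>N\<close>, solved for the two factors on the left.\<close>

lemma inv_aassoc_dual_right:
  assumes [simp]: "W \<in> obj C" "N \<in> obj M"
  shows "inv_arr M (aassoc M V' V (W \<rhd>\<^bsub>M\<^esub> N)) \<cdot>\<^bsub>M\<^esub> (idt C V' \<unrhd>\<^bsub>M\<^esub> aassoc M V W N)
    = aassoc M (V' \<otimes> V) W N \<cdot>\<^bsub>M\<^esub> (inv_arr C (tassoc C V' V W) \<unrhd>\<^bsub>M\<^esub> idt M N)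
      \<cdot>\<^bsub>M\<^esub> inv_arr M (aassoc M V' (V \<otimes> W) N)"
proof (rule M.iso_cancel_right)
  let ?f = "aassoc M V' (V \<otimes> W) N \<cdot>\<^bsub>M\<^esub> (tassoc C V' V W \<unrhd>\<^bsub>M\<^esub> idt M N)"
  show "iso M ?f" by (simp add: M.iso_idt)
  have "(inv_arr M (aassoc M V' V (W \<rhd>\<^bsub>M\<^esub> N)) \<cdot>\<^bsub>M\<^esub> (idt C V' \<unrhd>\<^bsub>M\<^esub> aassoc M V W N)) \<cdot>\<^bsub>M\<^esub> ?f
      = aassoc M (V' \<otimes> V) W N"
    by (simp add: action_pentagon)
  moreover have "(inv_arr C (tassoc C V' V W) \<unrhd>\<^bsub>M\<^esub> idt M N) \<cdot>\<^bsub>M\<^esub> (tassoc C V' V W \<unrhd>\<^bsub>M\<^esub> idt M N)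
      = idt M (((V' \<otimes> V) \<otimes> W) \<rhd>\<^bsub>M\<^esub> N)"
    by (simp add: aarr_cmp_merge del: aarr_whisker)
  ultimately show "(inv_arr M (aassoc M V' V (W \<rhd>\<^bsub>M\<^esub> N)) \<cdot>\<^bsub>M\<^esub> (idt C V' \<unrhd>\<^bsub>M\<^esub> aassoc M V W N)) \<cdot>\<^bsub>M\<^esub> ?f
    = (aassoc M (V' \<otimes> V) W N \<cdot>\<^bsub>M\<^esub> (inv_arr C (tassoc C V' V W) \<unrhd>\<^bsub>M\<^esub> idt M N)
      \<cdot>\<^bsub>M\<^esub> inv_arr M (aassoc M V' (V \<otimes> W) N)) \<cdot>\<^bsub>M\<^esub> ?f"
    by simp
qed simp_all

text \<open>The bracketed arrow of \<open>C\<close> is the counit at \<open>W\<close> of the regular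
  module category. So evaluation on \<open>W \<rhd> N\<close> can be carried out inside
  \<open>C\<close>, up to constraints.\<close>

lemma dcounit_aobj:
  assumes [simp]: "W \<in> obj C" "N \<in> obj M"
  shows "dcounit (W \<rhd>\<^bsub>M\<^esub> N) \<cdot>\<^bsub>M\<^esub> (idt C V' \<unrhd>\<^bsub>M\<^esub> aassoc M V W N)
    = ((tlunit C W \<cdot> (ev \<boxtimes> idt C W) \<cdot> inv_arr C (tassoc C V' V W)) \<unrhd>\<^bsub>M\<^esub> idt M N)
      \<cdot>\<^bsub>M\<^esub> inv_arr M (aassoc M V' (V \<otimes> W) N)"
proof -
  have ev: "(ev \<unrhd>\<^bsub>M\<^esub> idt M (W \<rhd>\<^bsub>M\<^esub> N)) \<cdot>\<^bsub>M\<^esub> aassoc M (V' \<otimes> V) W N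
      = aassoc M (tone C) W N \<cdot>\<^bsub>M\<^esub> ((ev \<boxtimes> idt C W) \<unrhd>\<^bsub>M\<^esub> idt M N)"
    by (simp add: aassoc_nat)
  show ?thesis
    by (simp add: dcounit_def inv_aassoc_dual_right M.cmp_ext[OF ev] M.cmp_ext[OF aunit_aobj])
qed

text \<open>The action constraints move out of the way until what remains is the first zigzag
  identity of \<open>dual_pair\<close>, the one at \<open>V\<close>, acting on
  \<open>N\<close>.\<close>

lemma triangle_dunit:
  assumes [simp]: "N \<in> obj M"
  shows "(idt C V \<unrhd>\<^bsub>M\<^esub> dcounit N) \<cdot>\<^bsub>M\<^esub> dunit (V \<rhd>\<^bsub>M\<^esub> N) = idt M (V \<rhd>\<^bsub>M\<^esub> N)"
proof -
  have u: "inv_arr M (aunit M (V \<rhd>\<^bsub>M\<^esub> N)) = aassoc M (tone C) V N \<cdot>\<^bsub>M\<^esub> (inv_arr C (tlunit C V) \<unrhd>\<^bsub>M\<^esub> idt M N)"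
  proof (rule M.iso_cancel_left[where f = "aunit M (V \<rhd>\<^bsub>M\<^esub> N)"])
    have "(tlunit C V \<unrhd>\<^bsub>M\<^esub> idt M N) \<cdot>\<^bsub>M\<^esub> (inv_arr C (tlunit C V) \<unrhd>\<^bsub>M\<^esub> idt M N) = idt M (V \<rhd>\<^bsub>M\<^esub> N)"
      by (simp add: aarr_cmp_merge del: aarr_whisker)
    then show "aunit M (V \<rhd>\<^bsub>M\<^esub> N) \<cdot>\<^bsub>M\<^esub> inv_arr M (aunit M (V \<rhd>\<^bsub>M\<^esub> N))
      = aunit M (V \<rhd>\<^bsub>M\<^esub> N) \<cdot>\<^bsub>M\<^esub> aassoc M (tone C) V N \<cdot>\<^bsub>M\<^esub> (inv_arr C (tlunit C V) \<unrhd>\<^bsub>M\<^esub> idt M N)"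
      by (simp add: M.cmp_ext[OF aunit_aobj])
  qed simp_all
  have coev: "(coev \<unrhd>\<^bsub>M\<^esub> idt M (V \<rhd>\<^bsub>M\<^esub> N)) \<cdot>\<^bsub>M\<^esub> aassoc M (tone C) V N
      = aassoc M (V \<otimes> V') V N \<cdot>\<^bsub>M\<^esub> ((coev \<boxtimes> idt C V) \<unrhd>\<^bsub>M\<^esub> idt M N)"
    by (simp add: aassoc_nat)
  have pent: "(idt C V \<unrhd>\<^bsub>M\<^esub> inv_arr M (aassoc M V' V N)) \<cdot>\<^bsub>M\<^esub> aassoc M V V' (V \<rhd>\<^bsub>M\<^esub> N) \<cdot>\<^bsub>M\<^esub> aassoc M (V \<otimes> V') V N
      = aassoc M V (V' \<otimes> V) N \<cdot>\<^bsub>M\<^esub> (tassoc C V V' V \<unrhd>\<^bsub>M\<^esub> idt M N)"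
  proof (rule M.iso_cancel_left[where f = "idt C V \<unrhd>\<^bsub>M\<^esub> aassoc M V' V N"])
    have "(idt C V \<unrhd>\<^bsub>M\<^esub> aassoc M V' V N) \<cdot>\<^bsub>M\<^esub> (idt C V \<unrhd>\<^bsub>M\<^esub> inv_arr M (aassoc M V' V N))
        = idt M (V \<rhd>\<^bsub>M\<^esub> V' \<rhd>\<^bsub>M\<^esub> V \<rhd>\<^bsub>M\<^esub> N)"
      by (simp add: aarr_cmp_merge del: aarr_whisker)
    from M.cmp_ext[OF this]
    show "(idt C V \<unrhd>\<^bsub>M\<^esub> aassoc M V' V N) \<cdot>\<^bsub>M\<^esub> (idt C V \<unrhd>\<^bsub>M\<^esub> inv_arr M (aassoc M V' V N))
        \<cdot>\<^bsub>M\<^esub> aassoc M V V' (V \<rhd>\<^bsub>M\<^esub> N) \<cdot>\<^bsub>M\<^esub> aassoc M (V \<otimes> V') V N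
      = (idt C V \<unrhd>\<^bsub>M\<^esub> aassoc M V' V N) \<cdot>\<^bsub>M\<^esub> aassoc M V (V' \<otimes> V) N \<cdot>\<^bsub>M\<^esub> (tassoc C V V' V \<unrhd>\<^bsub>M\<^esub> idt M N)"
      by (simp add: action_pentagon)
  qed (simp_all add: C.iso_idt)
  have ev: "(idt C V \<unrhd>\<^bsub>M\<^esub> ev \<unrhd>\<^bsub>M\<^esub> idt M N) \<cdot>\<^bsub>M\<^esub> aassoc M V (V' \<otimes> V) N
      = aassoc M V (tone C) N \<cdot>\<^bsub>M\<^esub> ((idt C V \<boxtimes> ev) \<unrhd>\<^bsub>M\<^esub> idt M N)"
    by (simp add: aassoc_nat)
  have "(idt C V \<unrhd>\<^bsub>M\<^esub> dcounit N) \<cdot>\<^bsub>M\<^esub> dunit (V \<rhd>\<^bsub>M\<^esub> N)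
    = (trunit C V \<unrhd>\<^bsub>M\<^esub> idt M N) \<cdot>\<^bsub>M\<^esub> ((idt C V \<boxtimes> ev) \<unrhd>\<^bsub>M\<^esub> idt M N) \<cdot>\<^bsub>M\<^esub> (tassoc C V V' V \<unrhd>\<^bsub>M\<^esub> idt M N)
      \<cdot>\<^bsub>M\<^esub> ((coev \<boxtimes> idt C V) \<unrhd>\<^bsub>M\<^esub> idt M N) \<cdot>\<^bsub>M\<^esub> (inv_arr C (tlunit C V) \<unrhd>\<^bsub>M\<^esub> idt M N)"
    by (simp add: dunit_def dcounit_def u M.cmp_ext[OF coev] M.cmp_ext3[OF pent] M.cmp_ext[OF ev]
      M.cmp_ext[OF action_triangle])
  also have "\<dots> = (trunit C V \<cdot> (idt C V \<boxtimes> ev) \<cdot> tassoc C V V' V \<cdot> (coev \<boxtimes> idt C V)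
      \<cdot> inv_arr C (tlunit C V)) \<unrhd>\<^bsub>M\<^esub> idt M N"
    by simp
  also have "\<dots> = idt M (V \<rhd>\<^bsub>M\<^esub> N)"
    using dual_pair unfolding dual_pair_def by (simp del: aarr_whisker)
  finally show ?thesis .
qed

text \<open>Here \<open>dcounit_aobj\<close> brings the composite into \<open>C\<close>, where it is
  the second zigzag identity, the one at \<open>V'\<close>.\<close>

lemma triangle_dcounit:
  assumes [simp]: "N \<in> obj M"
  shows "dcounit (V' \<rhd>\<^bsub>M\<^esub> N) \<cdot>\<^bsub>M\<^esub> (idt C V' \<unrhd>\<^bsub>M\<^esub> dunit N) = idt M (V' \<rhd>\<^bsub>M\<^esub> N)"
proof -
  have a: "inv_arr M (aassoc M V' (V \<otimes> V') N) \<cdot>\<^bsub>M\<^esub> (idt C V' \<unrhd>\<^bsub>M\<^esub> coev \<unrhd>\<^bsub>M\<^esub> idt M N)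
      = ((idt C V' \<boxtimes> coev) \<unrhd>\<^bsub>M\<^esub> idt M N) \<cdot>\<^bsub>M\<^esub> inv_arr M (aassoc M V' (tone C) N)"
    by (rule M.inv_arr_natural) (simp_all add: aassoc_nat)
  have r: "inv_arr M (aassoc M V' (tone C) N) \<cdot>\<^bsub>M\<^esub> (idt C V' \<unrhd>\<^bsub>M\<^esub> inv_arr M (aunit M N))
      = inv_arr C (trunit C V') \<unrhd>\<^bsub>M\<^esub> idt M N"
  proof -
    have "inverse_arrows M (trunit C V' \<unrhd>\<^bsub>M\<^esub> idt M N)
        (inv_arr M (aassoc M V' (tone C) N) \<cdot>\<^bsub>M\<^esub> inv_arr M (idt C V' \<unrhd>\<^bsub>M\<^esub> aunit M N))"
      unfolding action_triangle[OF dual_simps(2) assms, symmetric]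
      by (rule M.inverse_arrows_cmp) (simp_all add: C.iso_idt)
    from M.inv_arr_eqI[OF this] show ?thesis by (simp add: C.iso_idt M.iso_idt)
  qed
  have "dcounit (V' \<rhd>\<^bsub>M\<^esub> N) \<cdot>\<^bsub>M\<^esub> (idt C V' \<unrhd>\<^bsub>M\<^esub> dunit N)
    = (tlunit C V' \<unrhd>\<^bsub>M\<^esub> idt M N) \<cdot>\<^bsub>M\<^esub> ((ev \<boxtimes> idt C V') \<unrhd>\<^bsub>M\<^esub> idt M N)
      \<cdot>\<^bsub>M\<^esub> (inv_arr C (tassoc C V' V V') \<unrhd>\<^bsub>M\<^esub> idt M N) \<cdot>\<^bsub>M\<^esub> ((idt C V' \<boxtimes> coev) \<unrhd>\<^bsub>M\<^esub> idt M N)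
      \<cdot>\<^bsub>M\<^esub> (inv_arr C (trunit C V') \<unrhd>\<^bsub>M\<^esub> idt M N)"
    by (simp add: dunit_def M.cmp_ext[OF dcounit_aobj] M.cmp_ext[OF a] r)
  also have "\<dots> = (tlunit C V' \<cdot> (ev \<boxtimes> idt C V') \<cdot> inv_arr C (tassoc C V' V V')
      \<cdot> (idt C V' \<boxtimes> coev) \<cdot> inv_arr C (trunit C V')) \<unrhd>\<^bsub>M\<^esub> idt M N"
    by simp
  also have "\<dots> = idt M (V' \<rhd>\<^bsub>M\<^esub> N)"
    using dual_pair unfolding dual_pair_def by (simp del: aarr_whisker)
  finally show ?thesis .
qed

text \<open>Half of the bijection \<open>Hom(Z, V \<rhd> N) \<cong> Hom(V' \<rhd> Z, N)\<close>: an
  arrow is recovered from its transpose by acting with \<open>V\<close> and precomposing with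
  \<open>dunit\<close>.\<close>

lemma dcounit_inj:
  assumes eq: "dcounit N \<cdot>\<^bsub>M\<^esub> (idt C V' \<unrhd>\<^bsub>M\<^esub> f) = dcounit N \<cdot>\<^bsub>M\<^esub> (idt C V' \<unrhd>\<^bsub>M\<^esub> g)" and N [simp]: "N \<in> obj M"
    and [simp]: "f \<in> arr M" "g \<in> arr M" "src M f = src M g" "trg M f = V \<rhd>\<^bsub>M\<^esub> N" "trg M g = V \<rhd>\<^bsub>M\<^esub> N"
  shows "f = g"
proof -
  have *: "(idt C V \<unrhd>\<^bsub>M\<^esub> (dcounit N \<cdot>\<^bsub>M\<^esub> (idt C V' \<unrhd>\<^bsub>M\<^esub> h))) \<cdot>\<^bsub>M\<^esub> dunit (src M h) = h"
    if [simp]: "h \<in> arr M" "trg M h = V \<rhd>\<^bsub>M\<^esub> N" for h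
    using dunit_nat[of h] M.cmp_ext[OF triangle_dunit[OF N], of h] by simp
  have "f = (idt C V \<unrhd>\<^bsub>M\<^esub> (dcounit N \<cdot>\<^bsub>M\<^esub> (idt C V' \<unrhd>\<^bsub>M\<^esub> f))) \<cdot>\<^bsub>M\<^esub> dunit (src M f)"
    by (rule *[symmetric]) simp_all
  also have "\<dots> = g"
    unfolding eq by (simp only: \<open>src M f = src M g\<close>) (rule *; simp)
  finally show ?thesis .
qed

lemma dcounit_surj:
  assumes [simp]: "h \<in> arr M" "src M h = V' \<rhd>\<^bsub>M\<^esub> Z" "Z \<in> obj M"
  shows "dcounit (trg M h) \<cdot>\<^bsub>M\<^esub> (idt C V' \<unrhd>\<^bsub>M\<^esub> ((idt C V \<unrhd>\<^bsub>M\<^esub> h) \<cdot>\<^bsub>M\<^esub> dunit Z)) = h"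
  using M.cmp_ext[OF dcounit_nat[of h], of "idt C V' \<unrhd>\<^bsub>M\<^esub> dunit Z"] by (simp add: triangle_dcounit)

end

section \<open>The internal hom functor\<close>

locale action_adjunction = module_category C M + C: rigid_category C
  for C :: "('k::field, 'o, 'a, 'm) moncat_scheme" (structure)
    and M :: "('k, 'o, 'a, 'p, 'b, 'n) modcat_scheme" +
  fixes X :: 'p and R :: "('p, 'b, 'o, 'a) functr" and \<eta> :: "'o \<Rightarrow> 'a" and \<epsilon> :: "'p \<Rightarrow> 'b"
  assumes X_obj [simp]: "X \<in> obj M"
    and adj: "adjunction C M (act_on M X) R \<eta> \<epsilon>"
begin

lemma act_on_simps [simp]: "fobj (act_on M X) V = V \<rhd>\<^bsub>M\<^esub> X" "farr (act_on M X) f = f \<unrhd>\<^bsub>M\<^esub> idt M X"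
  by (simp_all add: act_on_def)

lemma R_linear: "linear_functor M C R"
  using adj by (simp add: adjunction_def)

lemmas R_obj [simp] = linear_functor.fobj_obj [OF R_linear]
lemmas R_idt [simp] = linear_functor.farr_idt [OF R_linear]

lemma R_simps [simp]:
  assumes "f \<in> arr M"
  shows "farr R f \<in> arr C" "src C (farr R f) = fobj R (src M f)" "trg C (farr R f) = fobj R (trg M f)"
  using linear_functor.farr_hom[OF R_linear, of f "src M f" "trg M f"] assms by (auto simp: hom_def)

lemma R_cmp [simp]:
  assumes "f \<in> arr M" "g \<in> arr M" "src M g = trg M f"
  shows "farr R (g \<cdot>\<^bsub>M\<^esub> f) = farr R g \<cdot> farr R f"
  using linear_functor.farr_cmp[OF R_linear, of f "src M f" "trg M f" g "trg M g"] assms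
  by (auto simp: hom_def)

text \<open>A linear functor is only required to respect sums and scalars, so the zero arrow is
  treated as its own multiple by the scalar 0.\<close>

lemma R_vzero:
  assumes "N \<in> obj M" "N' \<in> obj M"
  shows "farr R (vzero M N N') = vzero C (fobj R N) (fobj R N')"
  using linear_functor.farr_scale[OF R_linear, of "vzero M N N'" N N' 0] M.vzero_hom[OF assms]
    M.vscale_vzero[OF assms, of 0] C.vscale_0[of "farr R (vzero M N N')" "fobj R N" "fobj R N'"] assms
  by (auto simp: hom_def)

lemma R_iso [simp]: assumes "iso M f" shows "iso C (farr R f)"
    and R_inv [simp]: "inv_arr C (farr R f) = farr R (inv_arr M f)"
proof -
  note [simp] = assms iso_arr[OF assms]
  have *: "inverse_arrows C (farr R f) (farr R (inv_arr M f))"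
    by (rule C.inverse_arrowsI) (simp_all flip: R_cmp)
  show "iso C (farr R f)" "inv_arr C (farr R f) = farr R (inv_arr M f)"
    by (rule inverse_arrows_iso[OF *], rule C.inv_arr_eqI[OF *])
qed

lemma unit_simps [simp]:
  assumes "V \<in> obj C"
  shows "\<eta> V \<in> arr C" "src C (\<eta> V) = V" "trg C (\<eta> V) = fobj R (V \<rhd>\<^bsub>M\<^esub> X)"
  using adjunction.unit_natural[OF adj] assms
  by (auto simp: natural_transformation_def hom_def id_functr_def comp_functr_def)

lemma counit_simps [simp]:
  assumes "N \<in> obj M"
  shows "\<epsilon> N \<in> arr M" "src M (\<epsilon> N) = fobj R N \<rhd>\<^bsub>M\<^esub> X" "trg M (\<epsilon> N) = N"
  using adjunction.counit_natural[OF adj] assms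
  by (auto simp: natural_transformation_def hom_def id_functr_def comp_functr_def)

lemma unit_nat:
  "\<lbrakk>f \<in> arr C; trg C f = V\<rbrakk> \<Longrightarrow> \<eta> V \<cdot> f = farr R (f \<unrhd>\<^bsub>M\<^esub> idt M X) \<cdot> \<eta> (src C f)"
  using adjunction.unit_natural[OF adj]
  by (auto simp: natural_transformation_def id_functr_def comp_functr_def)

lemma counit_nat:
  "\<lbrakk>f \<in> arr M; trg M f = N\<rbrakk> \<Longrightarrow> \<epsilon> N \<cdot>\<^bsub>M\<^esub> (farr R f \<unrhd>\<^bsub>M\<^esub> idt M X) = f \<cdot>\<^bsub>M\<^esub> \<epsilon> (src M f)"
  using adjunction.counit_natural[OF adj]
  by (auto simp: natural_transformation_def id_functr_def comp_functr_def)

lemma triangle_left [simp]: "V \<in> obj C \<Longrightarrow> \<epsilon> (V \<rhd>\<^bsub>M\<^esub> X) \<cdot>\<^bsub>M\<^esub> (\<eta> V \<unrhd>\<^bsub>M\<^esub> idt M X) = idt M (V \<rhd>\<^bsub>M\<^esub> X)"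
  using adjunction.triangle_left[OF adj] by simp

lemma triangle_right [simp]: "N \<in> obj M \<Longrightarrow> farr R (\<epsilon> N) \<cdot> \<eta> (fobj R N) = idt C (fobj R N)"
  using adjunction.triangle_right[OF adj] by simp

text \<open>An arrow into \<open>R N\<close> is recovered from its transpose by applying
  \<open>R\<close> and precomposing with the unit, by the second triangle identity.\<close>

lemma transpose_inj:
  assumes eq: "\<epsilon> N \<cdot>\<^bsub>M\<^esub> (g \<unrhd>\<^bsub>M\<^esub> idt M X) = \<epsilon> N \<cdot>\<^bsub>M\<^esub> (h \<unrhd>\<^bsub>M\<^esub> idt M X)" and [simp]: "N \<in> obj M"
    "g \<in> arr C" "h \<in> arr C" "src C g = src C h" "trg C g = fobj R N" "trg C h = fobj R N"
  shows "g = h"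
proof -
  have *: "farr R (\<epsilon> N \<cdot>\<^bsub>M\<^esub> (f \<unrhd>\<^bsub>M\<^esub> idt M X)) \<cdot> \<eta> (src C f) = f"
    if [simp]: "f \<in> arr C" "trg C f = fobj R N" for f
  proof -
    have "farr R (\<epsilon> N \<cdot>\<^bsub>M\<^esub> (f \<unrhd>\<^bsub>M\<^esub> idt M X)) \<cdot> \<eta> (src C f) = farr R (\<epsilon> N) \<cdot> \<eta> (fobj R N) \<cdot> f"
      by (simp add: unit_nat)
    also have "\<dots> = f" by (simp add: C.cmp_ext[OF triangle_right])
    finally show ?thesis .
  qed
  have "g = farr R (\<epsilon> N \<cdot>\<^bsub>M\<^esub> (g \<unrhd>\<^bsub>M\<^esub> idt M X)) \<cdot> \<eta> (src C g)" by (rule *[symmetric]) simp_all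
  also have "\<dots> = h" unfolding eq by (simp only: \<open>src C g = src C h\<close>) (rule *; simp)
  finally show ?thesis .
qed

lemma counit_transpose:
  assumes "Y \<in> obj C" "f \<in> arr M" "src M f = Y \<rhd>\<^bsub>M\<^esub> X" "trg M f = N"
  shows "\<epsilon> N \<cdot>\<^bsub>M\<^esub> (farr R f \<unrhd>\<^bsub>M\<^esub> idt M X) \<cdot>\<^bsub>M\<^esub> (\<eta> Y \<unrhd>\<^bsub>M\<^esub> idt M X) = f"
  using assms M.obj_src_trg(2)[OF assms(2)] by (simp add: M.cmp_ext[OF counit_nat])

section \<open>The lax module structure of the internal hom\<close>

abbreviation \<phi> :: "'o \<Rightarrow> 'p \<Rightarrow> 'a" where "\<phi> \<equiv> lax_structure C M X R \<eta> \<epsilon>"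

lemma lax_simps [simp]:
  assumes "V \<in> obj C" "N \<in> obj M"
  shows "\<phi> V N \<in> arr C" "src C (\<phi> V N) = V \<otimes> fobj R N" "trg C (\<phi> V N) = fobj R (V \<rhd>\<^bsub>M\<^esub> N)"
  using assms by (simp_all add: lax_structure_def)

text \<open>The first triangle identity undoes the transposition in the definition of \<phi>. The
  calculations with \<phi> below go through this equation.\<close>

lemma counit_lax:
  assumes "V \<in> obj C" "N \<in> obj M"
  shows "\<epsilon> (V \<rhd>\<^bsub>M\<^esub> N) \<cdot>\<^bsub>M\<^esub> (\<phi> V N \<unrhd>\<^bsub>M\<^esub> idt M X) = (idt C V \<unrhd>\<^bsub>M\<^esub> \<epsilon> N) \<cdot>\<^bsub>M\<^esub> aassoc M V (fobj R N) X"
  using assms by (simp add: lax_structure_def M.cmp_ext[OF counit_nat])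

text \<open>Composition with \<phi> is injective because it corresponds to a chain of injective
  transpositions. A right inverse \<open>g\<close> is produced by running the chain backwards, and
  injectivity makes it two-sided.\<close>

lemma iso_lax [simp]:
  assumes [simp]: "V \<in> obj C" "N \<in> obj M"
  shows "iso C (\<phi> V N)"
proof -
  obtain V' ev coev where dual: "dual_pair C V' V ev coev"
    using C.ex_left_dual[of V] by auto
  interpret D: module_dual C M V' V ev coev
    by unfold_locales (rule dual)
  interpret E: module_dual C "regular C" V' V ev coev
    by (intro module_dual.intro module_dual_axioms.intro C.regular_module dual)
  note [simp] = D.dual_simps D.dcounit_simps D.dunit_simps E.dcounit_simps[simplified] E.dunit_simps[simplified]
  \<comment> \<open>For \<open>g\<close> into \<open>V \<otimes> R N\<close>, moving
    \<open>V\<close> across by duality in \<open>M\<close> after transposing along \<open>R\<close>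
    agrees with moving it by duality in \<open>C\<close> before transposing.\<close>
  have key: "D.dcounit N \<cdot>\<^bsub>M\<^esub> (idt C V' \<unrhd>\<^bsub>M\<^esub> ((idt C V \<unrhd>\<^bsub>M\<^esub> \<epsilon> N) \<cdot>\<^bsub>M\<^esub> aassoc M V (fobj R N) X \<cdot>\<^bsub>M\<^esub> (g \<unrhd>\<^bsub>M\<^esub> idt M X)))
    = \<epsilon> N \<cdot>\<^bsub>M\<^esub> ((E.dcounit (fobj R N) \<cdot> (idt C V' \<boxtimes> g)) \<unrhd>\<^bsub>M\<^esub> idt M X)
      \<cdot>\<^bsub>M\<^esub> inv_arr M (aassoc M V' (src C g) X)"
    if [simp]: "g \<in> arr C" "trg C g = V \<otimes> fobj R N" for g
  proof -
    have a: "D.dcounit N \<cdot>\<^bsub>M\<^esub> (idt C V' \<unrhd>\<^bsub>M\<^esub> idt C V \<unrhd>\<^bsub>M\<^esub> \<epsilon> N) = \<epsilon> N \<cdot>\<^bsub>M\<^esub> D.dcounit (fobj R N \<rhd>\<^bsub>M\<^esub> X)"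
      using D.dcounit_nat[of "\<epsilon> N"] by simp
    have b: "inv_arr M (aassoc M V' (V \<otimes> fobj R N) X) \<cdot>\<^bsub>M\<^esub> (idt C V' \<unrhd>\<^bsub>M\<^esub> g \<unrhd>\<^bsub>M\<^esub> idt M X)
      = ((idt C V' \<boxtimes> g) \<unrhd>\<^bsub>M\<^esub> idt M X) \<cdot>\<^bsub>M\<^esub> inv_arr M (aassoc M V' (src C g) X)"
      by (rule M.inv_arr_natural) (simp_all add: aassoc_nat)
    show ?thesis
      by (simp add: M.cmp_ext[OF a] M.cmp_ext[OF D.dcounit_aobj] b E.dcounit_def)
  qed
  have inj: "g = h"
    if eq: "\<phi> V N \<cdot> g = \<phi> V N \<cdot> h" and [simp]: "g \<in> arr C" "h \<in> arr C" "src C g = src C h"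
      "trg C g = V \<otimes> fobj R N" "trg C h = V \<otimes> fobj R N" for g h
  proof -
    have "\<epsilon> (V \<rhd>\<^bsub>M\<^esub> N) \<cdot>\<^bsub>M\<^esub> ((\<phi> V N \<cdot> g) \<unrhd>\<^bsub>M\<^esub> idt M X) = \<epsilon> (V \<rhd>\<^bsub>M\<^esub> N) \<cdot>\<^bsub>M\<^esub> ((\<phi> V N \<cdot> h) \<unrhd>\<^bsub>M\<^esub> idt M X)"
      by (simp only: eq)
    then have "(idt C V \<unrhd>\<^bsub>M\<^esub> \<epsilon> N) \<cdot>\<^bsub>M\<^esub> aassoc M V (fobj R N) X \<cdot>\<^bsub>M\<^esub> (g \<unrhd>\<^bsub>M\<^esub> idt M X)
      = (idt C V \<unrhd>\<^bsub>M\<^esub> \<epsilon> N) \<cdot>\<^bsub>M\<^esub> aassoc M V (fobj R N) X \<cdot>\<^bsub>M\<^esub> (h \<unrhd>\<^bsub>M\<^esub> idt M X)"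
      by (simp add: M.cmp_ext[OF counit_lax])
    then have "(\<epsilon> N \<cdot>\<^bsub>M\<^esub> ((E.dcounit (fobj R N) \<cdot> (idt C V' \<boxtimes> g)) \<unrhd>\<^bsub>M\<^esub> idt M X))
        \<cdot>\<^bsub>M\<^esub> inv_arr M (aassoc M V' (src C h) X)
      = (\<epsilon> N \<cdot>\<^bsub>M\<^esub> ((E.dcounit (fobj R N) \<cdot> (idt C V' \<boxtimes> h)) \<unrhd>\<^bsub>M\<^esub> idt M X))
        \<cdot>\<^bsub>M\<^esub> inv_arr M (aassoc M V' (src C h) X)"
      using key[of g] key[of h] by simp
    then have "\<epsilon> N \<cdot>\<^bsub>M\<^esub> ((E.dcounit (fobj R N) \<cdot> (idt C V' \<boxtimes> g)) \<unrhd>\<^bsub>M\<^esub> idt M X)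
      = \<epsilon> N \<cdot>\<^bsub>M\<^esub> ((E.dcounit (fobj R N) \<cdot> (idt C V' \<boxtimes> h)) \<unrhd>\<^bsub>M\<^esub> idt M X)"
      by (rule M.iso_cancel_right[rotated]) simp_all
    then have "E.dcounit (fobj R N) \<cdot> (idt C V' \<boxtimes> g) = E.dcounit (fobj R N) \<cdot> (idt C V' \<boxtimes> h)"
      by (rule transpose_inj) simp_all
    then show ?thesis by (rule E.dcounit_inj[simplified]) simp_all
  qed
  \<comment> \<open>The chain read backwards from \<open>\<epsilon> (V \<rhd> N)\<close>, the
    transpose of the identity: \<open>k\<close> moves \<open>V\<close> across in \<open>M\<close>,
    \<open>k'\<close> is the adjunct of \<open>k\<close> under \<open>R\<close>, and
    \<open>g\<close> moves \<open>V\<close> back in \<open>C\<close>.\<close>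
  define k where "k = D.dcounit N \<cdot>\<^bsub>M\<^esub> (idt C V' \<unrhd>\<^bsub>M\<^esub> \<epsilon> (V \<rhd>\<^bsub>M\<^esub> N)) \<cdot>\<^bsub>M\<^esub> aassoc M V' (fobj R (V \<rhd>\<^bsub>M\<^esub> N)) X"
  define k' where "k' = farr R k \<cdot> \<eta> (V' \<otimes> fobj R (V \<rhd>\<^bsub>M\<^esub> N))"
  define g where "g = (idt C V \<boxtimes> k') \<cdot> E.dunit (fobj R (V \<rhd>\<^bsub>M\<^esub> N))"
  have k [simp]: "k \<in> arr M" "src M k = (V' \<otimes> fobj R (V \<rhd>\<^bsub>M\<^esub> N)) \<rhd>\<^bsub>M\<^esub> X" "trg M k = N"
    by (simp_all add: k_def)
  have k' [simp]: "k' \<in> arr C" "src C k' = V' \<otimes> fobj R (V \<rhd>\<^bsub>M\<^esub> N)" "trg C k' = fobj R N"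
    by (simp_all add: k'_def)
  have g [simp]: "g \<in> arr C" "src C g = fobj R (V \<rhd>\<^bsub>M\<^esub> N)" "trg C g = V \<otimes> fobj R N"
    by (simp_all add: g_def)
  have "E.dcounit (fobj R N) \<cdot> (idt C V' \<boxtimes> g) = k'"
    using E.dcounit_surj[of k' "fobj R (V \<rhd>\<^bsub>M\<^esub> N)"] by (simp add: g_def)
  then have "D.dcounit N \<cdot>\<^bsub>M\<^esub> (idt C V' \<unrhd>\<^bsub>M\<^esub> ((idt C V \<unrhd>\<^bsub>M\<^esub> \<epsilon> N) \<cdot>\<^bsub>M\<^esub> aassoc M V (fobj R N) X \<cdot>\<^bsub>M\<^esub> (g \<unrhd>\<^bsub>M\<^esub> idt M X)))
    = \<epsilon> N \<cdot>\<^bsub>M\<^esub> (k' \<unrhd>\<^bsub>M\<^esub> idt M X) \<cdot>\<^bsub>M\<^esub> inv_arr M (aassoc M V' (fobj R (V \<rhd>\<^bsub>M\<^esub> N)) X)"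
    using key[of g] by simp
  also have "\<dots> = k \<cdot>\<^bsub>M\<^esub> inv_arr M (aassoc M V' (fobj R (V \<rhd>\<^bsub>M\<^esub> N)) X)"
    by (simp add: k'_def M.cmp_ext3[OF counit_transpose])
  also have "\<dots> = D.dcounit N \<cdot>\<^bsub>M\<^esub> (idt C V' \<unrhd>\<^bsub>M\<^esub> \<epsilon> (V \<rhd>\<^bsub>M\<^esub> N))"
    by (simp add: k_def)
  finally have J: "(idt C V \<unrhd>\<^bsub>M\<^esub> \<epsilon> N) \<cdot>\<^bsub>M\<^esub> aassoc M V (fobj R N) X \<cdot>\<^bsub>M\<^esub> (g \<unrhd>\<^bsub>M\<^esub> idt M X) = \<epsilon> (V \<rhd>\<^bsub>M\<^esub> N)"
    by (rule D.dcounit_inj) simp_all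
  have 1: "\<phi> V N \<cdot> g = idt C (fobj R (V \<rhd>\<^bsub>M\<^esub> N))"
    by (rule transpose_inj[of "V \<rhd>\<^bsub>M\<^esub> N"]) (simp_all add: M.cmp_ext[OF counit_lax] J)
  \<comment> \<open>Composed with \<phi>, both sides give \<phi> by the preceding equation.\<close>
  have 2: "g \<cdot> \<phi> V N = idt C (V \<otimes> fobj R N)"
    by (rule inj) (simp_all add: C.cmp_ext[OF 1])
  show ?thesis
    by (rule inverse_arrows_iso[of _ _ g], rule C.inverse_arrowsI) (simp_all add: 1 2)
qed

text \<open>The assignment on \<open>g\<close> is composition with the isomorphism
  \<open>\<phi> V N\<close> followed by transposition, hence a bijection
  \<open>Hom(Y, V \<otimes> R N) \<cong> Hom(Y \<rhd> X, V \<rhd> N)\<close>. At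
  \<open>N = X\<close> it describes arrows between objects of the form \<open>V \<rhd> X\<close>
  inside \<open>C\<close>.\<close>

lemma counit_mono_on_free:
  assumes eq: "(idt C V \<unrhd>\<^bsub>M\<^esub> \<epsilon> N) \<cdot>\<^bsub>M\<^esub> aassoc M V (fobj R N) X \<cdot>\<^bsub>M\<^esub> (g \<unrhd>\<^bsub>M\<^esub> idt M X)
      = (idt C V \<unrhd>\<^bsub>M\<^esub> \<epsilon> N) \<cdot>\<^bsub>M\<^esub> aassoc M V (fobj R N) X \<cdot>\<^bsub>M\<^esub> (h \<unrhd>\<^bsub>M\<^esub> idt M X)"
    and [simp]: "V \<in> obj C" "N \<in> obj M" "g \<in> arr C" "h \<in> arr C" "src C g = src C h"
      "trg C g = V \<otimes> fobj R N" "trg C h = V \<otimes> fobj R N"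
  shows "g = h"
proof (rule C.iso_cancel_left)
  show "iso C (\<phi> V N)" by simp
  show "\<phi> V N \<cdot> g = \<phi> V N \<cdot> h"
    by (rule transpose_inj[of "V \<rhd>\<^bsub>M\<^esub> N"]) (simp_all add: M.cmp_ext[OF counit_lax] eq)
qed simp_all

lemma counit_surj_on_free:
  assumes [simp]: "V \<in> obj C" "N \<in> obj M" "Y \<in> obj C" "f \<in> arr M" "src M f = Y \<rhd>\<^bsub>M\<^esub> X" "trg M f = V \<rhd>\<^bsub>M\<^esub> N"
  obtains g where "g \<in> hom C Y (V \<otimes> fobj R N)"
    "(idt C V \<unrhd>\<^bsub>M\<^esub> \<epsilon> N) \<cdot>\<^bsub>M\<^esub> aassoc M V (fobj R N) X \<cdot>\<^bsub>M\<^esub> (g \<unrhd>\<^bsub>M\<^esub> idt M X) = f"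
proof
  let ?g = "inv_arr C (\<phi> V N) \<cdot> farr R f \<cdot> \<eta> Y"
  show "?g \<in> hom C Y (V \<otimes> fobj R N)" by (simp add: hom_def)
  have "(idt C V \<unrhd>\<^bsub>M\<^esub> \<epsilon> N) \<cdot>\<^bsub>M\<^esub> aassoc M V (fobj R N) X \<cdot>\<^bsub>M\<^esub> (?g \<unrhd>\<^bsub>M\<^esub> idt M X)
    = \<epsilon> (V \<rhd>\<^bsub>M\<^esub> N) \<cdot>\<^bsub>M\<^esub> ((\<phi> V N \<cdot> ?g) \<unrhd>\<^bsub>M\<^esub> idt M X)"
    by (simp add: M.cmp_ext[OF counit_lax] del: C.inv_arr_cmp)
  also have "\<dots> = f" by (simp add: counit_transpose)
  finally show "(idt C V \<unrhd>\<^bsub>M\<^esub> \<epsilon> N) \<cdot>\<^bsub>M\<^esub> aassoc M V (fobj R N) X \<cdot>\<^bsub>M\<^esub> (?g \<unrhd>\<^bsub>M\<^esub> idt M X) = f" .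
qed

lemma lax_nat:
  assumes [simp]: "f \<in> arr C" "g \<in> arr M"
  shows "\<phi> (trg C f) (trg M g) \<cdot> (f \<boxtimes> farr R g) = farr R (f \<unrhd>\<^bsub>M\<^esub> g) \<cdot> \<phi> (src C f) (src M g)"
proof (rule transpose_inj[of "trg C f \<rhd>\<^bsub>M\<^esub> trg M g"])
  have "\<epsilon> (trg C f \<rhd>\<^bsub>M\<^esub> trg M g) \<cdot>\<^bsub>M\<^esub> ((\<phi> (trg C f) (trg M g) \<cdot> (f \<boxtimes> farr R g)) \<unrhd>\<^bsub>M\<^esub> idt M X)
    = (idt C (trg C f) \<unrhd>\<^bsub>M\<^esub> \<epsilon> (trg M g)) \<cdot>\<^bsub>M\<^esub> (f \<unrhd>\<^bsub>M\<^esub> farr R g \<unrhd>\<^bsub>M\<^esub> idt M X) \<cdot>\<^bsub>M\<^esub> aassoc M (src C f) (fobj R (src M g)) X"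
    by (simp add: M.cmp_ext[OF counit_lax] aassoc_nat)
  also have "\<dots> = (f \<unrhd>\<^bsub>M\<^esub> g) \<cdot>\<^bsub>M\<^esub> (idt C (src C f) \<unrhd>\<^bsub>M\<^esub> \<epsilon> (src M g)) \<cdot>\<^bsub>M\<^esub> aassoc M (src C f) (fobj R (src M g)) X"
    by (simp add: aarr_cmp_merge counit_nat M.cmp_ext[OF aarr_cmp_merge] del: aarr_whisker)
  also have "\<dots> = \<epsilon> (trg C f \<rhd>\<^bsub>M\<^esub> trg M g) \<cdot>\<^bsub>M\<^esub> ((farr R (f \<unrhd>\<^bsub>M\<^esub> g) \<cdot> \<phi> (src C f) (src M g)) \<unrhd>\<^bsub>M\<^esub> idt M X)"
    by (simp add: M.cmp_ext[OF counit_nat] counit_lax)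
  finally show "\<epsilon> (trg C f \<rhd>\<^bsub>M\<^esub> trg M g) \<cdot>\<^bsub>M\<^esub> ((\<phi> (trg C f) (trg M g) \<cdot> (f \<boxtimes> farr R g)) \<unrhd>\<^bsub>M\<^esub> idt M X)
    = \<epsilon> (trg C f \<rhd>\<^bsub>M\<^esub> trg M g) \<cdot>\<^bsub>M\<^esub> ((farr R (f \<unrhd>\<^bsub>M\<^esub> g) \<cdot> \<phi> (src C f) (src M g)) \<unrhd>\<^bsub>M\<^esub> idt M X)" .
qed simp_all

lemma whisker_counit_lax:
  assumes [simp]: "V \<in> obj C" "W \<in> obj C" "N \<in> obj M"
  shows "(idt C V \<unrhd>\<^bsub>M\<^esub> \<epsilon> (W \<rhd>\<^bsub>M\<^esub> N)) \<cdot>\<^bsub>M\<^esub> (idt C V \<unrhd>\<^bsub>M\<^esub> \<phi> W N \<unrhd>\<^bsub>M\<^esub> idt M X)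
    = (idt C V \<unrhd>\<^bsub>M\<^esub> idt C W \<unrhd>\<^bsub>M\<^esub> \<epsilon> N) \<cdot>\<^bsub>M\<^esub> (idt C V \<unrhd>\<^bsub>M\<^esub> aassoc M W (fobj R N) X)"
  using arg_cong[OF counit_lax[OF assms(2,3)], of "\<lambda>f. idt C V \<unrhd>\<^bsub>M\<^esub> f"] by simp

text \<open>Transposed, both sides evaluate \<open>R N \<rhd> X\<close> under \<open>V\<close> and
  \<open>W\<close>; the rebracketings before the evaluation agree by the action pentagon.\<close>

lemma lax_assoc:
  assumes [simp]: "V \<in> obj C" "W \<in> obj C" "N \<in> obj M"
  shows "\<phi> V (W \<rhd>\<^bsub>M\<^esub> N) \<cdot> (idt C V \<boxtimes> \<phi> W N) \<cdot> tassoc C V W (fobj R N)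
    = farr R (aassoc M V W N) \<cdot> \<phi> (V \<otimes> W) N"
proof (rule transpose_inj[of "V \<rhd>\<^bsub>M\<^esub> W \<rhd>\<^bsub>M\<^esub> N"])
  have "\<epsilon> (V \<rhd>\<^bsub>M\<^esub> W \<rhd>\<^bsub>M\<^esub> N) \<cdot>\<^bsub>M\<^esub> ((\<phi> V (W \<rhd>\<^bsub>M\<^esub> N) \<cdot> (idt C V \<boxtimes> \<phi> W N) \<cdot> tassoc C V W (fobj R N)) \<unrhd>\<^bsub>M\<^esub> idt M X)
    = (idt C V \<unrhd>\<^bsub>M\<^esub> \<epsilon> (W \<rhd>\<^bsub>M\<^esub> N)) \<cdot>\<^bsub>M\<^esub> (idt C V \<unrhd>\<^bsub>M\<^esub> \<phi> W N \<unrhd>\<^bsub>M\<^esub> idt M X) \<cdot>\<^bsub>M\<^esub> aassoc M V (W \<otimes> fobj R N) X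
      \<cdot>\<^bsub>M\<^esub> (tassoc C V W (fobj R N) \<unrhd>\<^bsub>M\<^esub> idt M X)"
    by (simp add: M.cmp_ext[OF counit_lax] M.cmp_ext[OF aassoc_nat])
  also have "\<dots> = (idt C V \<unrhd>\<^bsub>M\<^esub> idt C W \<unrhd>\<^bsub>M\<^esub> \<epsilon> N) \<cdot>\<^bsub>M\<^esub> aassoc M V W (fobj R N \<rhd>\<^bsub>M\<^esub> X) \<cdot>\<^bsub>M\<^esub> aassoc M (V \<otimes> W) (fobj R N) X"
    by (simp add: M.cmp_ext[OF whisker_counit_lax] action_pentagon)
  also have "\<dots> = \<epsilon> (V \<rhd>\<^bsub>M\<^esub> W \<rhd>\<^bsub>M\<^esub> N) \<cdot>\<^bsub>M\<^esub> ((farr R (aassoc M V W N) \<cdot> \<phi> (V \<otimes> W) N) \<unrhd>\<^bsub>M\<^esub> idt M X)"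
    by (simp add: M.cmp_ext[OF counit_nat] counit_lax M.cmp_ext[OF aassoc_nat_idt])
  finally show "\<epsilon> (V \<rhd>\<^bsub>M\<^esub> W \<rhd>\<^bsub>M\<^esub> N) \<cdot>\<^bsub>M\<^esub> ((\<phi> V (W \<rhd>\<^bsub>M\<^esub> N) \<cdot> (idt C V \<boxtimes> \<phi> W N) \<cdot> tassoc C V W (fobj R N)) \<unrhd>\<^bsub>M\<^esub> idt M X)
    = \<epsilon> (V \<rhd>\<^bsub>M\<^esub> W \<rhd>\<^bsub>M\<^esub> N) \<cdot>\<^bsub>M\<^esub> ((farr R (aassoc M V W N) \<cdot> \<phi> (V \<otimes> W) N) \<unrhd>\<^bsub>M\<^esub> idt M X)" .
qed simp_all

lemma lax_unit:
  assumes [simp]: "N \<in> obj M"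
  shows "farr R (aunit M N) \<cdot> \<phi> (tone C) N = tlunit C (fobj R N)"
  by (rule transpose_inj[of N])
    (simp_all add: M.cmp_ext[OF counit_nat] counit_lax M.cmp_ext[OF aunit_nat] aunit_aobj)

section \<open>The algebra of an object and its modules\<close>

abbreviation A :: 'o where "A \<equiv> fobj R X"

text \<open>Composition of internal homs, from the hom out of \<open>X\<close> into \<open>N\<close>
  tensored with the endomorphisms of \<open>X\<close>. Its transpose evaluates twice, see
  \<open>counit_rho\<close>.\<close>

definition \<rho> :: "'p \<Rightarrow> 'a" where "\<rho> N = farr R (\<epsilon> N) \<cdot> \<phi> (fobj R N) X"

lemma rho_simps [simp]:
  assumes "N \<in> obj M"
  shows "\<rho> N \<in> arr C" "src C (\<rho> N) = fobj R N \<otimes> A" "trg C (\<rho> N) = fobj R N"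
  using assms by (simp_all add: \<rho>_def)

lemma counit_rho:
  assumes [simp]: "N \<in> obj M"
  shows "\<epsilon> N \<cdot>\<^bsub>M\<^esub> (\<rho> N \<unrhd>\<^bsub>M\<^esub> idt M X) = \<epsilon> N \<cdot>\<^bsub>M\<^esub> (idt C (fobj R N) \<unrhd>\<^bsub>M\<^esub> \<epsilon> X) \<cdot>\<^bsub>M\<^esub> aassoc M (fobj R N) A X"
  by (simp add: \<rho>_def M.cmp_ext[OF counit_nat] counit_lax)

definition Alg :: "('o, 'a) algebra" where "Alg = end_algebra C M X R \<eta> \<epsilon>"

lemma alg_obj [simp]: "alg_obj Alg = A"
  by (simp add: Alg_def end_algebra_def Let_def)

text \<open>The inverse of \<phi> hidden in \<open>monad_unit\<close> cancels against the left
  unitor by \<open>lax_unit\<close>. What is left is the adjunct of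
  \<open>aunit M X\<close>.\<close>

lemma alg_unit: "alg_unit Alg = farr R (aunit M X) \<cdot> \<eta> (tone C)"
proof -
  have "tlunit C A \<cdot> inv_arr C (\<phi> (tone C) X) = farr R (aunit M X)"
    by (simp flip: lax_unit)
  then show ?thesis
    by (simp add: Alg_def end_algebra_def monad_unit_def Let_def C.cmp_ext)
qed

lemma alg_unit_simps [simp]:
  "alg_unit Alg \<in> arr C" "src C (alg_unit Alg) = tone C" "trg C (alg_unit Alg) = A"
  by (simp_all add: alg_unit)

lemma counit_alg_unit: "\<epsilon> X \<cdot>\<^bsub>M\<^esub> (alg_unit Alg \<unrhd>\<^bsub>M\<^esub> idt M X) = aunit M X"
  by (simp add: alg_unit counit_transpose)

text \<open>The unitors that surround \<open>monad_mult\<close> absorb the two copies of \<phi> at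
  the unit object. The multiplication turns out to be the action of \<open>A\<close> on itself, so
  the algebra laws can be read off from module laws at \<open>N = X\<close>.\<close>

lemma alg_mult: "alg_mult Alg = \<rho> X"
proof -
  let ?I = "tone C" and ?l = "tlunit C A"
  have l: "?l \<cdot> inv_arr C (\<phi> ?I X) = farr R (aunit M X)"
    by (simp flip: lax_unit)
  have nat: "\<phi> (?I \<otimes> A) X \<cdot> (inv_arr C ?l \<boxtimes> idt C A) = farr R (inv_arr C ?l \<unrhd>\<^bsub>M\<^esub> idt M X) \<cdot> \<phi> A X"
    using lax_nat[of "inv_arr C ?l" "idt M X"] by simp
  have il: "\<phi> ?I X \<cdot> inv_arr C ?l = farr R (inv_arr M (aunit M X))"
  proof (rule C.iso_cancel_left[where f = "farr R (aunit M X)"])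
    show "farr R (aunit M X) \<cdot> \<phi> ?I X \<cdot> inv_arr C ?l = farr R (aunit M X) \<cdot> farr R (inv_arr M (aunit M X))"
      by (simp add: C.cmp_ext[OF lax_unit] flip: R_cmp)
  qed simp_all
  have "alg_mult Alg = ?l \<cdot> inv_arr C (\<phi> ?I X) \<cdot> farr R (\<epsilon> (?I \<rhd>\<^bsub>M\<^esub> X)) \<cdot> farr R (\<phi> ?I X \<unrhd>\<^bsub>M\<^esub> idt M X)
      \<cdot> \<phi> (?I \<otimes> A) X \<cdot> (inv_arr C ?l \<boxtimes> idt C A)"
    by (simp add: Alg_def end_algebra_def monad_mult_def Let_def)
  also have "\<dots> = farr R (aunit M X) \<cdot> farr R (\<epsilon> (?I \<rhd>\<^bsub>M\<^esub> X))
      \<cdot> farr R ((\<phi> ?I X \<cdot> inv_arr C ?l) \<unrhd>\<^bsub>M\<^esub> idt M X) \<cdot> \<phi> A X"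
    by (simp add: C.cmp_ext[OF l] nat)
  also have "\<dots> = farr R (aunit M X \<cdot>\<^bsub>M\<^esub> \<epsilon> (?I \<rhd>\<^bsub>M\<^esub> X) \<cdot>\<^bsub>M\<^esub> ((\<phi> ?I X \<cdot> inv_arr C ?l) \<unrhd>\<^bsub>M\<^esub> idt M X)) \<cdot> \<phi> A X"
    by simp
  also have "\<dots> = \<rho> X"
    by (simp only: il) (simp add: counit_nat \<rho>_def)
  finally show ?thesis .
qed

text \<open>Both transposes evaluate three times. On the left \<open>\<rho> N\<close> slides past
  the inner evaluation by interchange, and the two bracketings then differ by the action
  pentagon.\<close>

lemma rho_assoc:
  assumes [simp]: "N \<in> obj M"
  shows "\<rho> N \<cdot> (\<rho> N \<boxtimes> idt C A) = \<rho> N \<cdot> (idt C (fobj R N) \<boxtimes> \<rho> X) \<cdot> tassoc C (fobj R N) A A"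
proof (rule transpose_inj[of N])
  let ?N = "fobj R N"
  have "\<epsilon> N \<cdot>\<^bsub>M\<^esub> ((\<rho> N \<cdot> (\<rho> N \<boxtimes> idt C A)) \<unrhd>\<^bsub>M\<^esub> idt M X)
    = \<epsilon> N \<cdot>\<^bsub>M\<^esub> (idt C ?N \<unrhd>\<^bsub>M\<^esub> \<epsilon> X) \<cdot>\<^bsub>M\<^esub> (\<rho> N \<unrhd>\<^bsub>M\<^esub> idt M (A \<rhd>\<^bsub>M\<^esub> X)) \<cdot>\<^bsub>M\<^esub> aassoc M (?N \<otimes> A) A X"
    by (simp add: M.cmp_ext[OF counit_rho] aassoc_nat)
  also have "\<dots> = \<epsilon> N \<cdot>\<^bsub>M\<^esub> (idt C ?N \<unrhd>\<^bsub>M\<^esub> \<epsilon> X) \<cdot>\<^bsub>M\<^esub> aassoc M ?N A X \<cdot>\<^bsub>M\<^esub> (idt C (?N \<otimes> A) \<unrhd>\<^bsub>M\<^esub> \<epsilon> X) \<cdot>\<^bsub>M\<^esub> aassoc M (?N \<otimes> A) A X"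
    by (simp add: M.cmp_ext[OF interchange] M.cmp_ext[OF counit_rho])
  also have "\<dots> = \<epsilon> N \<cdot>\<^bsub>M\<^esub> (idt C ?N \<unrhd>\<^bsub>M\<^esub> \<epsilon> X) \<cdot>\<^bsub>M\<^esub> (idt C ?N \<unrhd>\<^bsub>M\<^esub> idt C A \<unrhd>\<^bsub>M\<^esub> \<epsilon> X) \<cdot>\<^bsub>M\<^esub> (idt C ?N \<unrhd>\<^bsub>M\<^esub> aassoc M A A X)
      \<cdot>\<^bsub>M\<^esub> aassoc M ?N (A \<otimes> A) X \<cdot>\<^bsub>M\<^esub> (tassoc C ?N A A \<unrhd>\<^bsub>M\<^esub> idt M X)"
    by (simp add: action_pentagon M.cmp_ext[OF aassoc_nat_idt])
  also have "\<dots> = \<epsilon> N \<cdot>\<^bsub>M\<^esub> (idt C ?N \<unrhd>\<^bsub>M\<^esub> (\<epsilon> X \<cdot>\<^bsub>M\<^esub> (\<rho> X \<unrhd>\<^bsub>M\<^esub> idt M X)))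
      \<cdot>\<^bsub>M\<^esub> aassoc M ?N (A \<otimes> A) X \<cdot>\<^bsub>M\<^esub> (tassoc C ?N A A \<unrhd>\<^bsub>M\<^esub> idt M X)"
    by (simp add: counit_rho)
  also have "\<dots> = \<epsilon> N \<cdot>\<^bsub>M\<^esub> ((\<rho> N \<cdot> (idt C ?N \<boxtimes> \<rho> X) \<cdot> tassoc C ?N A A) \<unrhd>\<^bsub>M\<^esub> idt M X)"
    by (simp add: M.cmp_ext[OF counit_rho] M.cmp_ext[OF aassoc_nat])
  finally show "\<epsilon> N \<cdot>\<^bsub>M\<^esub> ((\<rho> N \<cdot> (\<rho> N \<boxtimes> idt C A)) \<unrhd>\<^bsub>M\<^esub> idt M X)
    = \<epsilon> N \<cdot>\<^bsub>M\<^esub> ((\<rho> N \<cdot> (idt C ?N \<boxtimes> \<rho> X) \<cdot> tassoc C ?N A A) \<unrhd>\<^bsub>M\<^esub> idt M X)" .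
qed simp_all

lemma rho_unit:
  assumes [simp]: "N \<in> obj M"
  shows "\<rho> N \<cdot> (idt C (fobj R N) \<boxtimes> alg_unit Alg) = trunit C (fobj R N)"
proof (rule transpose_inj[of N])
  let ?N = "fobj R N"
  have "\<epsilon> N \<cdot>\<^bsub>M\<^esub> ((\<rho> N \<cdot> (idt C ?N \<boxtimes> alg_unit Alg)) \<unrhd>\<^bsub>M\<^esub> idt M X)
    = \<epsilon> N \<cdot>\<^bsub>M\<^esub> (idt C ?N \<unrhd>\<^bsub>M\<^esub> (\<epsilon> X \<cdot>\<^bsub>M\<^esub> (alg_unit Alg \<unrhd>\<^bsub>M\<^esub> idt M X))) \<cdot>\<^bsub>M\<^esub> aassoc M ?N (tone C) X"
    by (simp add: M.cmp_ext[OF counit_rho] aassoc_nat)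
  also have "\<dots> = \<epsilon> N \<cdot>\<^bsub>M\<^esub> (trunit C ?N \<unrhd>\<^bsub>M\<^esub> idt M X)"
    by (simp only: counit_alg_unit) (simp add: action_triangle)
  finally show "\<epsilon> N \<cdot>\<^bsub>M\<^esub> ((\<rho> N \<cdot> (idt C ?N \<boxtimes> alg_unit Alg)) \<unrhd>\<^bsub>M\<^esub> idt M X)
    = \<epsilon> N \<cdot>\<^bsub>M\<^esub> (trunit C ?N \<unrhd>\<^bsub>M\<^esub> idt M X)" .
qed simp_all

text \<open>Associativity and the right unit law are the module laws at \<open>N = X\<close>; only
  the left unit law needs an argument, which rests on \<open>aunit_aobj\<close>.\<close>

lemma Alg_algebra: "algebra_object C Alg"
proof -
  have "\<rho> X \<cdot> (alg_unit Alg \<boxtimes> idt C A) = tlunit C A"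
  proof (rule transpose_inj[of X])
    have "\<epsilon> X \<cdot>\<^bsub>M\<^esub> ((\<rho> X \<cdot> (alg_unit Alg \<boxtimes> idt C A)) \<unrhd>\<^bsub>M\<^esub> idt M X)
      = \<epsilon> X \<cdot>\<^bsub>M\<^esub> (idt C A \<unrhd>\<^bsub>M\<^esub> \<epsilon> X) \<cdot>\<^bsub>M\<^esub> (alg_unit Alg \<unrhd>\<^bsub>M\<^esub> idt M (A \<rhd>\<^bsub>M\<^esub> X)) \<cdot>\<^bsub>M\<^esub> aassoc M (tone C) A X"
      by (simp add: M.cmp_ext[OF counit_rho] aassoc_nat)
    also have "\<dots> = aunit M X \<cdot>\<^bsub>M\<^esub> (idt C (tone C) \<unrhd>\<^bsub>M\<^esub> \<epsilon> X) \<cdot>\<^bsub>M\<^esub> aassoc M (tone C) A X"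
      by (simp add: M.cmp_ext[OF interchange] M.cmp_ext[OF counit_alg_unit])
    also have "\<dots> = \<epsilon> X \<cdot>\<^bsub>M\<^esub> (tlunit C A \<unrhd>\<^bsub>M\<^esub> idt M X)"
      by (simp add: M.cmp_ext[OF aunit_nat] aunit_aobj)
    finally show "\<epsilon> X \<cdot>\<^bsub>M\<^esub> ((\<rho> X \<cdot> (alg_unit Alg \<boxtimes> idt C A)) \<unrhd>\<^bsub>M\<^esub> idt M X)
      = \<epsilon> X \<cdot>\<^bsub>M\<^esub> (tlunit C A \<unrhd>\<^bsub>M\<^esub> idt M X)" .
  qed simp_all
  then show ?thesis
    using rho_assoc[of X] rho_unit[of X] by (simp add: algebra_object_def alg_mult hom_def)
qed

lemma rho_module: "N \<in> obj M \<Longrightarrow> right_module C Alg (fobj R N, \<rho> N)"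
  using rho_assoc[of N] rho_unit[of N] by (simp add: right_module_def alg_mult hom_def)

lemma R_module_map:
  assumes [simp]: "f \<in> arr M"
  shows "farr R f \<cdot> \<rho> (src M f) = \<rho> (trg M f) \<cdot> (farr R f \<boxtimes> idt C A)"
proof (rule transpose_inj[of "trg M f"])
  have "\<epsilon> (trg M f) \<cdot>\<^bsub>M\<^esub> ((\<rho> (trg M f) \<cdot> (farr R f \<boxtimes> idt C A)) \<unrhd>\<^bsub>M\<^esub> idt M X)
    = \<epsilon> (trg M f) \<cdot>\<^bsub>M\<^esub> (idt C (fobj R (trg M f)) \<unrhd>\<^bsub>M\<^esub> \<epsilon> X) \<cdot>\<^bsub>M\<^esub> (farr R f \<unrhd>\<^bsub>M\<^esub> idt M (A \<rhd>\<^bsub>M\<^esub> X))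
      \<cdot>\<^bsub>M\<^esub> aassoc M (fobj R (src M f)) A X"
    by (simp add: M.cmp_ext[OF counit_rho] aassoc_nat)
  also have "\<dots> = f \<cdot>\<^bsub>M\<^esub> \<epsilon> (src M f) \<cdot>\<^bsub>M\<^esub> (idt C (fobj R (src M f)) \<unrhd>\<^bsub>M\<^esub> \<epsilon> X) \<cdot>\<^bsub>M\<^esub> aassoc M (fobj R (src M f)) A X"
    by (simp add: M.cmp_ext[OF interchange] M.cmp_ext[OF counit_nat])
  also have "\<dots> = \<epsilon> (trg M f) \<cdot>\<^bsub>M\<^esub> ((farr R f \<cdot> \<rho> (src M f)) \<unrhd>\<^bsub>M\<^esub> idt M X)"
    by (simp add: M.cmp_ext[OF counit_nat] counit_rho)
  finally show "\<epsilon> (trg M f) \<cdot>\<^bsub>M\<^esub> ((farr R f \<cdot> \<rho> (src M f)) \<unrhd>\<^bsub>M\<^esub> idt M X)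
    = \<epsilon> (trg M f) \<cdot>\<^bsub>M\<^esub> ((\<rho> (trg M f) \<cdot> (farr R f \<boxtimes> idt C A)) \<unrhd>\<^bsub>M\<^esub> idt M X)" by simp
qed simp_all

text \<open>Makes \<phi> linear over \<open>A\<close>, so that its inverse can serve as the module
  functor structure of the comparison functor.\<close>

lemma lax_module_map:
  assumes [simp]: "V \<in> obj C" "N \<in> obj M"
  shows "\<phi> V N \<cdot> (idt C V \<boxtimes> \<rho> N) \<cdot> tassoc C V (fobj R N) A = \<rho> (V \<rhd>\<^bsub>M\<^esub> N) \<cdot> (\<phi> V N \<boxtimes> idt C A)"
proof (rule transpose_inj[of "V \<rhd>\<^bsub>M\<^esub> N"])
  let ?N = "fobj R N"
  have "\<epsilon> (V \<rhd>\<^bsub>M\<^esub> N) \<cdot>\<^bsub>M\<^esub> ((\<phi> V N \<cdot> (idt C V \<boxtimes> \<rho> N) \<cdot> tassoc C V ?N A) \<unrhd>\<^bsub>M\<^esub> idt M X)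
    = (idt C V \<unrhd>\<^bsub>M\<^esub> (\<epsilon> N \<cdot>\<^bsub>M\<^esub> (\<rho> N \<unrhd>\<^bsub>M\<^esub> idt M X))) \<cdot>\<^bsub>M\<^esub> aassoc M V (?N \<otimes> A) X \<cdot>\<^bsub>M\<^esub> (tassoc C V ?N A \<unrhd>\<^bsub>M\<^esub> idt M X)"
    by (simp add: M.cmp_ext[OF counit_lax] M.cmp_ext[OF aassoc_nat])
  also have "\<dots> = (idt C V \<unrhd>\<^bsub>M\<^esub> \<epsilon> N) \<cdot>\<^bsub>M\<^esub> (idt C V \<unrhd>\<^bsub>M\<^esub> idt C ?N \<unrhd>\<^bsub>M\<^esub> \<epsilon> X) \<cdot>\<^bsub>M\<^esub> aassoc M V ?N (A \<rhd>\<^bsub>M\<^esub> X) \<cdot>\<^bsub>M\<^esub> aassoc M (V \<otimes> ?N) A X"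
    by (simp add: counit_rho action_pentagon)
  also have "\<dots> = (idt C V \<unrhd>\<^bsub>M\<^esub> \<epsilon> N) \<cdot>\<^bsub>M\<^esub> aassoc M V ?N X \<cdot>\<^bsub>M\<^esub> (idt C (V \<otimes> ?N) \<unrhd>\<^bsub>M\<^esub> \<epsilon> X) \<cdot>\<^bsub>M\<^esub> aassoc M (V \<otimes> ?N) A X"
    by (simp add: M.cmp_ext[OF aassoc_nat_idt])
  also have "\<dots> = \<epsilon> (V \<rhd>\<^bsub>M\<^esub> N) \<cdot>\<^bsub>M\<^esub> (\<phi> V N \<unrhd>\<^bsub>M\<^esub> idt M X) \<cdot>\<^bsub>M\<^esub> (idt C (V \<otimes> ?N) \<unrhd>\<^bsub>M\<^esub> \<epsilon> X) \<cdot>\<^bsub>M\<^esub> aassoc M (V \<otimes> ?N) A X"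
    by (simp add: M.cmp_ext[OF counit_lax])
  also have "\<dots> = \<epsilon> (V \<rhd>\<^bsub>M\<^esub> N) \<cdot>\<^bsub>M\<^esub> ((\<rho> (V \<rhd>\<^bsub>M\<^esub> N) \<cdot> (\<phi> V N \<boxtimes> idt C A)) \<unrhd>\<^bsub>M\<^esub> idt M X)"
    by (simp add: M.cmp_ext[OF counit_rho] aassoc_nat M.cmp_ext[OF interchange])
  finally show "\<epsilon> (V \<rhd>\<^bsub>M\<^esub> N) \<cdot>\<^bsub>M\<^esub> ((\<phi> V N \<cdot> (idt C V \<boxtimes> \<rho> N) \<cdot> tassoc C V ?N A) \<unrhd>\<^bsub>M\<^esub> idt M X)
    = \<epsilon> (V \<rhd>\<^bsub>M\<^esub> N) \<cdot>\<^bsub>M\<^esub> ((\<rho> (V \<rhd>\<^bsub>M\<^esub> N) \<cdot> (\<phi> V N \<boxtimes> idt C A)) \<unrhd>\<^bsub>M\<^esub> idt M X)" .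
qed simp_all

end

section \<open>Categories of structured objects\<close>

text \<open>Operations and constraints are computed on underlying arrows, so all equations are
  inherited from \<open>C\<close>. What has to be supplied is that every operation preserves the
  structure; \<open>H_inv\<close> is included because the constraints must be invertible among
  structured arrows.\<close>

locale module_structure = monoidal_category C
  for C :: "('k::field, 'o, 'a, 'm) moncat_scheme" (structure)
    and S :: "('o \<times> 'a) set"
    and H :: "'o \<times> 'a \<Rightarrow> 'o \<times> 'a \<Rightarrow> 'a \<Rightarrow> bool"
    and act :: "'o \<Rightarrow> 'o \<times> 'a \<Rightarrow> 'a" +
  assumes S_obj: "X \<in> S \<Longrightarrow> fst X \<in> obj C"
    and H_idt: "X \<in> S \<Longrightarrow> H X X (idt C (fst X))"
    and H_cmp: "\<lbrakk>X \<in> S; Y \<in> S; Z \<in> S; f \<in> hom C (fst X) (fst Y); g \<in> hom C (fst Y) (fst Z);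
      H X Y f; H Y Z g\<rbrakk> \<Longrightarrow> H X Z (g \<cdot> f)"
    and H_vadd: "\<lbrakk>X \<in> S; Y \<in> S; f \<in> hom C (fst X) (fst Y); g \<in> hom C (fst X) (fst Y);
      H X Y f; H X Y g\<rbrakk> \<Longrightarrow> H X Y (f \<oplus> g)"
    and H_vzero: "\<lbrakk>X \<in> S; Y \<in> S\<rbrakk> \<Longrightarrow> H X Y (vzero C (fst X) (fst Y))"
    and H_vscale: "\<lbrakk>X \<in> S; Y \<in> S; f \<in> hom C (fst X) (fst Y); H X Y f\<rbrakk> \<Longrightarrow> H X Y (vscale C c f)"
    and H_inv: "\<lbrakk>X \<in> S; Y \<in> S; f \<in> hom C (fst X) (fst Y); iso C f; H X Y f\<rbrakk>
      \<Longrightarrow> H Y X (inv_arr C f)"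
    and act_S: "\<lbrakk>V \<in> obj C; X \<in> S\<rbrakk> \<Longrightarrow> (V \<otimes> fst X, act V X) \<in> S"
    and H_act: "\<lbrakk>v \<in> hom C V V'; X \<in> S; Y \<in> S; f \<in> hom C (fst X) (fst Y); H X Y f\<rbrakk>
      \<Longrightarrow> H (V \<otimes> fst X, act V X) (V' \<otimes> fst Y, act V' Y) (v \<boxtimes> f)"
    and H_assoc: "\<lbrakk>V \<in> obj C; W \<in> obj C; X \<in> S\<rbrakk>
      \<Longrightarrow> H (V \<otimes> W \<otimes> fst X, act (V \<otimes> W) X)
          (V \<otimes> (W \<otimes> fst X), act V (W \<otimes> fst X, act W X)) (tassoc C V W (fst X))"
    and H_unit: "X \<in> S \<Longrightarrow> H (tone C \<otimes> fst X, act (tone C) X) X (tlunit C (fst X))"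
begin

abbreviation "D \<equiv> structured_modcat C S H act"

lemma D_simps:
  "obj D = S"
  "(X, f, Y) \<in> arr D \<longleftrightarrow> X \<in> S \<and> Y \<in> S \<and> f \<in> hom C (fst X) (fst Y) \<and> H X Y f"
  "src D (X, f, Y) = X" "trg D (X, f, Y) = Y" "idt D X = (X, idt C (fst X), X)"
  "cmp D (Y', g, Z) (X, f, Y) = (X, g \<cdot> f, Z)"
  "vadd D (X, f, Y) (X', g, Y') = (X, f \<oplus> g, Y)"
  "vzero D X Y = (X, vzero C (fst X) (fst Y), Y)"
  "vscale D c (X, f, Y) = (X, vscale C c f, Y)"
  "aobj D V X = (V \<otimes> fst X, act V X)"
  "aarr D v (X, f, Y) = ((src C v \<otimes> fst X, act (src C v) X), v \<boxtimes> f, (trg C v \<otimes> fst Y, act (trg C v) Y))"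
  "aassoc D V W X = ((V \<otimes> W \<otimes> fst X, act (V \<otimes> W) X), tassoc C V W (fst X),
     (V \<otimes> (W \<otimes> fst X), act V (W \<otimes> fst X, act W X)))"
  "aunit D X = ((tone C \<otimes> fst X, act (tone C) X), tlunit C (fst X), X)"
  by (simp_all add: structured_modcat_def Let_def)

lemma D_hom_iff:
  "t \<in> hom D X Y \<longleftrightarrow> (\<exists>f. t = (X, f, Y) \<and> X \<in> S \<and> Y \<in> S \<and> f \<in> hom C (fst X) (fst Y) \<and> H X Y f)"
  by (cases t) (auto simp: in_hom_iff[of _ D] D_simps)

lemma D_linear: "linear_category D"
proof
  show "src D f \<in> obj D" "trg D f \<in> obj D" if "f \<in> arr D" for f
    using that by (cases f; simp add: D_simps)+
  show "idt D X \<in> hom D X X" if "X \<in> obj D" for X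
    using that S_obj idt_hom H_idt by (auto simp: D_simps D_hom_iff)
  show "cmp D g f \<in> hom D X Z" if "f \<in> hom D X Y" "g \<in> hom D Y Z" for f g X Y Z
    using that cmp_hom by (auto simp: D_simps D_hom_iff intro: H_cmp[of X Y Z])
  show "cmp D (idt D Y) f = f" "cmp D f (idt D X) = f" if "f \<in> hom D X Y" for f X Y
    using that idt_cmp cmp_idt by (auto simp: D_simps D_hom_iff)
  show "cmp D (cmp D h g) f = cmp D h (cmp D g f)"
    if "f \<in> hom D X Y" "g \<in> hom D Y Z" "h \<in> hom D Z W" for f g h X Y Z W
    using that cmp_assoc by (auto simp: D_simps D_hom_iff)
  show "vadd D f g \<in> hom D X Y" if "f \<in> hom D X Y" "g \<in> hom D X Y" for f g X Y
    using that vadd_hom by (auto simp: D_simps D_hom_iff intro: H_vadd)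
  show "vzero D X Y \<in> hom D X Y" if "X \<in> obj D" "Y \<in> obj D" for X Y
    using that S_obj vzero_hom H_vzero by (auto simp: D_simps D_hom_iff)
  show "vscale D c f \<in> hom D X Y" if "f \<in> hom D X Y" for f X Y c
    using that vscale_hom by (auto simp: D_simps D_hom_iff intro: H_vscale)
  show "\<exists>g \<in> hom D X Y. vadd D f g = vzero D X Y" if "f \<in> hom D X Y" for f X Y
  proof
    show "vscale D (-1) f \<in> hom D X Y"
      using that vscale_hom by (auto simp: D_simps D_hom_iff intro: H_vscale)
    show "vadd D f (vscale D (-1) f) = vzero D X Y"
      using that vadd_neg by (auto simp: D_simps D_hom_iff)
  qed
  show "vadd D (vadd D f g) h = vadd D f (vadd D g h)"
    if "f \<in> hom D X Y" "g \<in> hom D X Y" "h \<in> hom D X Y" for f g h X Y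
    using that vadd_assoc by (auto simp: D_simps D_hom_iff)
  show "vadd D f g = vadd D g f" "vscale D c (vadd D f g) = vadd D (vscale D c f) (vscale D c g)"
    if "f \<in> hom D X Y" "g \<in> hom D X Y" for f g X Y c
    using that vadd_commute vscale_add_right by (auto simp: D_simps D_hom_iff)
  show "vadd D (vzero D X Y) f = f" "vscale D (c + d) f = vadd D (vscale D c f) (vscale D d f)"
    "vscale D c (vscale D d f) = vscale D (c * d) f" "vscale D 1 f = f"
    if "f \<in> hom D X Y" for f X Y c d
    using that vzero_add vscale_add_left vscale_vscale vscale_one by (auto simp: D_simps D_hom_iff)
  show "cmp D (vadd D g h) f = vadd D (cmp D g f) (cmp D h f)"
    if "f \<in> hom D X Y" "g \<in> hom D Y Z" "h \<in> hom D Y Z" for f g h X Y Z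
    using that cmp_add_left by (auto simp: D_simps D_hom_iff)
  show "cmp D h (vadd D f g) = vadd D (cmp D h f) (cmp D h g)"
    if "f \<in> hom D X Y" "g \<in> hom D X Y" "h \<in> hom D Y Z" for f g h X Y Z
    using that cmp_add_right by (auto simp: D_simps D_hom_iff)
  show "cmp D (vscale D c g) f = vscale D c (cmp D g f)"
    "cmp D g (vscale D c f) = vscale D c (cmp D g f)"
    if "f \<in> hom D X Y" "g \<in> hom D Y Z" for f g X Y Z c
    using that cmp_scale_left cmp_scale_right by (auto simp: D_simps D_hom_iff)
qed

lemma D_inverse:
  assumes "X \<in> S" "Y \<in> S" "f \<in> hom C (fst X) (fst Y)" "iso C f" "H X Y f"
  shows "inverse_arrows D (X, f, Y) (Y, inv_arr C f, X)"
  using assms H_inv[OF assms] by (auto simp: inverse_arrows_def D_simps D_hom_iff hom_def)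

lemma D_iso:
  assumes "X \<in> S" "Y \<in> S" "f \<in> hom C (fst X) (fst Y)" "iso C f" "H X Y f"
  shows "iso D (X, f, Y)"
  by (rule inverse_arrows_iso[OF D_inverse[OF assms]])

lemma D_module: "module_category C D"
proof (intro module_category.intro monoidal_category_axioms D_linear module_category_axioms.intro)
  have src_trg: "src C f = V" "trg C f = W" if "f \<in> hom C V W" for f V W
    using that by (auto simp: hom_def)
  show "aobj D V X \<in> obj D" if "V \<in> obj C" "X \<in> obj D" for V X
    using that act_S by (simp add: D_simps)
  show "aarr D f g \<in> hom D (aobj D V X) (aobj D V' X')"
    if "f \<in> hom C V V'" "g \<in> hom D X X'" for f g V V' X X'
  proof -
    have "V \<in> obj C" "V' \<in> obj C" using that(1) by (auto simp: hom_def)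
    then show ?thesis
      using that tarr_hom src_trg[OF that(1)] by (auto simp: D_simps D_hom_iff intro: act_S H_act)
  qed
  show "aarr D (idt C V) (idt D X) = idt D (aobj D V X)" if "V \<in> obj C" "X \<in> obj D" for V X
    using that S_obj by (simp add: D_simps)
  show "aarr D (f' \<cdot> f) (cmp D g' g) = cmp D (aarr D f' g') (aarr D f g)"
    if "f \<in> hom C V V'" "f' \<in> hom C V' V''" "g \<in> hom D X X'" "g' \<in> hom D X' X''"
    for f f' g g' V V' V'' X X' X''
    using that tarr_cmp src_trg[OF that(1)] src_trg[OF that(2)] src_trg[OF cmp_hom[OF that(1,2)]]
    by (auto simp: D_simps D_hom_iff)
  show "aarr D (f \<oplus> f') g = vadd D (aarr D f g) (aarr D f' g)"
    if "f \<in> hom C V V'" "f' \<in> hom C V V'" "g \<in> hom D X X'" for f f' g V V' X X'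
    using that tarr_add_left src_trg[OF that(1)] src_trg[OF that(2)] src_trg[OF vadd_hom[OF that(1,2)]]
    by (auto simp: D_simps D_hom_iff)
  show "aarr D f (vadd D g g') = vadd D (aarr D f g) (aarr D f g')"
    if "f \<in> hom C V V'" "g \<in> hom D X X'" "g' \<in> hom D X X'" for f g g' V V' X X'
    using that tarr_add_right by (auto simp: D_simps D_hom_iff)
  show "aarr D (vscale C c f) g = vscale D c (aarr D f g)"
    "aarr D f (vscale D c g) = vscale D c (aarr D f g)"
    if "f \<in> hom C V V'" "g \<in> hom D X X'" for c f g V V' X X'
    using that tarr_scale_left tarr_scale_right src_trg[OF that(1)] src_trg[OF vscale_hom[OF that(1)]]
    by (auto simp: D_simps D_hom_iff)
  show "aassoc D V W X \<in> hom D (aobj D (V \<otimes> W) X) (aobj D V (aobj D W X))"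
    "iso D (aassoc D V W X)"
    if "V \<in> obj C" "W \<in> obj C" "X \<in> obj D" for V W X
  proof -
    have X: "X \<in> S" using that by (simp add: D_simps)
    note 1 = act_S[OF tobj_obj[OF that(1,2)] X] act_S[OF that(1) act_S[OF that(2) X]]
    show "aassoc D V W X \<in> hom D (aobj D (V \<otimes> W) X) (aobj D V (aobj D W X))"
      using 1 tassoc_hom[OF that(1,2) S_obj[OF X]] H_assoc[OF that(1,2) X]
      by (simp add: D_simps D_hom_iff)
    show "iso D (aassoc D V W X)"
      unfolding D_simps
      by (rule D_iso) (use 1 tassoc_hom[OF that(1,2) S_obj[OF X]] H_assoc[OF that(1,2) X]
        tassoc_iso[OF that(1,2) S_obj[OF X]] in simp_all)
  qed
  show "aunit D X \<in> hom D (aobj D (tone C) X) X" "iso D (aunit D X)" if "X \<in> obj D" for X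
  proof -
    have X: "X \<in> S" using that by (simp add: D_simps)
    show "aunit D X \<in> hom D (aobj D (tone C) X) X"
      using act_S[OF tone_obj X] X tlunit_hom[OF S_obj[OF X]] H_unit[OF X]
      by (simp add: D_simps D_hom_iff)
    show "iso D (aunit D X)"
      unfolding D_simps
      by (rule D_iso) (use act_S[OF tone_obj X] X tlunit_hom[OF S_obj[OF X]] H_unit[OF X]
        tlunit_iso[OF S_obj[OF X]] in simp_all)
  qed
  show "cmp D (aassoc D V' W' X') (aarr D (f \<boxtimes> f') g)
      = cmp D (aarr D f (aarr D f' g)) (aassoc D V W X)"
    if "f \<in> hom C V V'" "f' \<in> hom C W W'" "g \<in> hom D X X'" for f f' g V V' W W' X X'
    using that tassoc_natural[OF that(1,2)] src_trg[OF that(1)] src_trg[OF that(2)]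
      src_trg[OF tarr_hom[OF that(1,2)]]
    by (auto simp: D_simps D_hom_iff)
  show "cmp D (aunit D X') (aarr D (idt C (tone C)) g) = cmp D g (aunit D X)"
    if "g \<in> hom D X X'" for g X X'
    using that tlunit_natural by (auto simp: D_simps D_hom_iff)
  show "cmp D (aarr D (idt C U) (aassoc D V W X))
      (cmp D (aassoc D U (V \<otimes> W) X) (aarr D (tassoc C U V W) (idt D X)))
    = cmp D (aassoc D U V (aobj D W X)) (aassoc D (U \<otimes> V) W X)"
    if "U \<in> obj C" "V \<in> obj C" "W \<in> obj C" "X \<in> obj D" for U V W X
    using that S_obj pentagon[of U V W "fst X"] by (simp add: D_simps)
  show "cmp D (aarr D (idt C V) (aunit D X)) (aassoc D V (tone C) X)
      = aarr D (trunit C V) (idt D X)"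
    if "V \<in> obj C" "X \<in> obj D" for V X
    using that S_obj triangle[of V "fst X"] by (simp add: D_simps)
qed

end

section \<open>Modules over an algebra form a module category\<close>

locale algebra_in = monoidal_category C
  for C :: "('k::field, 'o, 'a, 'm) moncat_scheme" (structure) +
  fixes Q :: "('o, 'a) algebra"
  assumes algebra: "algebra_object C Q"
begin

abbreviation "B \<equiv> alg_obj Q"
abbreviation "\<mu> \<equiv> alg_mult Q"
abbreviation "\<iota> \<equiv> alg_unit Q"
abbreviation "is_map \<equiv> (\<lambda>X Y f. f \<cdot> snd X = snd Y \<cdot> (f \<boxtimes> idt C B))"
abbreviation "free_act \<equiv> (\<lambda>V X. (idt C V \<boxtimes> snd X) \<cdot> tassoc C V (fst X) B)"

lemma algebra_obj_simps [simp]: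
  "B \<in> obj C" "\<mu> \<in> arr C" "src C \<mu> = B \<otimes> B" "trg C \<mu> = B" "\<iota> \<in> arr C" "src C \<iota> = tone C" "trg C \<iota> = B"
  using algebra by (auto simp: algebra_object_def Let_def hom_def)

lemma right_module_simps [simp]:
  assumes "right_module C Q X"
  shows "fst X \<in> obj C" "snd X \<in> arr C" "src C (snd X) = fst X \<otimes> B" "trg C (snd X) = fst X"
  using assms by (auto simp: right_module_def Let_def hom_def)

lemma right_module_assoc:
  assumes "right_module C Q X"
  shows "snd X \<cdot> (snd X \<boxtimes> idt C B) = snd X \<cdot> (idt C (fst X) \<boxtimes> \<mu>) \<cdot> tassoc C (fst X) B B"
  using assms unfolding right_module_def Let_def by blast

lemma right_module_unit:
  assumes "right_module C Q X"
  shows "snd X \<cdot> (idt C (fst X) \<boxtimes> \<iota>) = trunit C (fst X)"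
  using assms unfolding right_module_def Let_def by blast

text \<open>Associativity follows from that of \<open>X\<close> under the pentagon, and the unit law
  from \<open>trunit_tobj\<close>.\<close>

lemma right_module_act:
  assumes [simp]: "V \<in> obj C" and X [simp]: "right_module C Q X"
  shows "right_module C Q (V \<otimes> fst X, free_act V X)"
proof -
  let ?N = "fst X" and ?v = "idt C V"
  have "free_act V X \<cdot> (free_act V X \<boxtimes> idt C B)
    = (?v \<boxtimes> (snd X \<cdot> (snd X \<boxtimes> idt C B))) \<cdot> tassoc C V (?N \<otimes> B) B \<cdot> (tassoc C V ?N B \<boxtimes> idt C B)"
    by (simp add: cmp_ext[OF tassoc_nat])
  also have "\<dots> = (?v \<boxtimes> snd X) \<cdot> (?v \<boxtimes> (idt C ?N \<boxtimes> \<mu>)) \<cdot> (?v \<boxtimes> tassoc C ?N B B)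
      \<cdot> tassoc C V (?N \<otimes> B) B \<cdot> (tassoc C V ?N B \<boxtimes> idt C B)"
    by (simp only: right_module_assoc[OF X]) simp
  also have "\<dots> = (?v \<boxtimes> snd X) \<cdot> (?v \<boxtimes> (idt C ?N \<boxtimes> \<mu>)) \<cdot> tassoc C V ?N (B \<otimes> B) \<cdot> tassoc C (V \<otimes> ?N) B B"
    by (simp add: pentagon)
  also have "\<dots> = free_act V X \<cdot> (idt C (V \<otimes> ?N) \<boxtimes> \<mu>) \<cdot> tassoc C (V \<otimes> ?N) B B"
    by (simp add: cmp_ext[OF tassoc_nat_idt])
  finally have 1: "free_act V X \<cdot> (free_act V X \<boxtimes> idt C B)
    = free_act V X \<cdot> (idt C (V \<otimes> ?N) \<boxtimes> \<mu>) \<cdot> tassoc C (V \<otimes> ?N) B B" .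
  have "free_act V X \<cdot> (idt C (V \<otimes> ?N) \<boxtimes> \<iota>)
    = (?v \<boxtimes> (snd X \<cdot> (idt C ?N \<boxtimes> \<iota>))) \<cdot> tassoc C V ?N (tone C)"
    by (simp add: tassoc_nat_idt)
  also have "\<dots> = trunit C (V \<otimes> ?N)"
    by (simp only: right_module_unit[OF X]) (simp add: trunit_tobj)
  finally have 2: "free_act V X \<cdot> (idt C (V \<otimes> ?N) \<boxtimes> \<iota>) = trunit C (V \<otimes> ?N)" .
  show ?thesis
    unfolding right_module_def Let_def fst_conv snd_conv
    by (intro conjI 1 2) (simp_all add: hom_def)
qed

lemma modules: "module_structure C {X. right_module C Q X} is_map free_act"
proof
  fix X Y Z f g and c :: 'k and V V' W v
  assume "X \<in> {X. right_module C Q X}"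
  then have X: "right_module C Q X" by simp
  note [simp] = right_module_simps[OF X]
  show "fst X \<in> obj C" "is_map X X (idt C (fst X))" by simp_all
  show "is_map (tone C \<otimes> fst X, free_act (tone C) X) X (tlunit C (fst X))"
    by (simp add: cmp_ext[OF tlunit_nat] tlunit_tobj)
  show "(V \<otimes> fst X, free_act V X) \<in> {X. right_module C Q X}" if "V \<in> obj C"
    using right_module_act[OF that X] by simp
  show "is_map (V \<otimes> W \<otimes> fst X, free_act (V \<otimes> W) X)
      (V \<otimes> (W \<otimes> fst X), free_act V (W \<otimes> fst X, free_act W X)) (tassoc C V W (fst X))"
    if "V \<in> obj C" "W \<in> obj C"
    using that by (simp add: cmp_ext[OF tassoc_nat_idt] pentagon)
  assume "Y \<in> {X. right_module C Q X}"
  then have Y: "right_module C Q Y" by simp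
  note [simp] = right_module_simps[OF Y]
  \<comment> \<open>Bilinearity speaks of sums and scalars only; tensoring a zero arrow is handled
    through the scalar 0.\<close>
  have z: "vzero C (fst X) (fst Y) \<boxtimes> idt C B = vzero C (fst X \<otimes> B) (fst Y \<otimes> B)"
    using tarr_scale_left[of "vzero C (fst X) (fst Y)" "fst X" "fst Y" "idt C B" B B 0]
      vscale_0[of "vzero C (fst X) (fst Y) \<boxtimes> idt C B" "fst X \<otimes> B" "fst Y \<otimes> B"]
    by (simp add: hom_def vscale_vzero)
  show "is_map X Y (vzero C (fst X) (fst Y))" by (simp add: z)
  assume "f \<in> hom C (fst X) (fst Y)"
  then have f [simp]: "f \<in> arr C" "src C f = fst X" "trg C f = fst Y" by (simp_all add: hom_def)
  assume fm: "is_map X Y f"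
  show "is_map X Y (vscale C c f)"
    using fm tarr_scale_left[of f "fst X" "fst Y" "idt C B" B B c] by (simp add: cmp_vscale hom_def)
  show "is_map (V \<otimes> fst X, free_act V X) (V' \<otimes> fst Y, free_act V' Y) (v \<boxtimes> f)"
    if "v \<in> hom C V V'"
  proof -
    from that have [simp]: "v \<in> arr C" "src C v = V" "trg C v = V'" "V \<in> obj C" "V' \<in> obj C"
      by (auto simp: hom_def)
    show ?thesis
      using fm by (simp add: tassoc_nat cmp_ext[OF tarr_cmp_merge] del: tarr_whisker)
  qed
  show "is_map Y X (inv_arr C f)" if [simp]: "iso C f"
  \<comment> \<open>Linearity of the inverse is tested after precomposition with the invertible
    arrow \<open>f \<boxtimes> idt C B\<close>, where it becomes linearity of
    \<open>f\<close>.\<close>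
  proof (rule iso_cancel_right[where f = "f \<boxtimes> idt C B"])
    have "(inv_arr C f \<boxtimes> idt C B) \<cdot> (f \<boxtimes> idt C B) = idt C (fst X \<otimes> B)"
      by (simp add: tarr_cmp_merge del: tarr_whisker)
    then show "(inv_arr C f \<cdot> snd Y) \<cdot> (f \<boxtimes> idt C B)
        = (snd X \<cdot> (inv_arr C f \<boxtimes> idt C B)) \<cdot> (f \<boxtimes> idt C B)"
      by (simp flip: fm)
  qed (simp_all add: iso_idt)
  show "is_map X Y (f \<oplus> g)" if g: "g \<in> hom C (fst X) (fst Y)" "is_map X Y g"
    using fm that tarr_add_left[of f "fst X" "fst Y" g "idt C B" B B] by (simp add: cmp_vadd hom_def)
  assume "Z \<in> {X. right_module C Q X}"
  then have Z: "right_module C Q Z" by simp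
  note [simp] = right_module_simps[OF Z]
  show "is_map X Z (g \<cdot> f)" if "g \<in> hom C (fst Y) (fst Z)" "is_map Y Z g"
  proof -
    have [simp]: "g \<in> arr C" "src C g = fst Y" "trg C g = fst Z" using that by (auto simp: hom_def)
    show ?thesis by (simp add: fm cmp_ext[OF that(2)])
  qed
qed

end

section \<open>Fully faithful and essentially surjective functors\<close>

definition fully_faithful ::
  "('o, 'a, 'm) cat_scheme \<Rightarrow> ('p, 'b, 'n) cat_scheme \<Rightarrow> ('o, 'a, 'p, 'b) functr \<Rightarrow> bool" where
  "fully_faithful A B F \<longleftrightarrow>
     (\<forall>X \<in> obj A. \<forall>Y \<in> obj A. bij_betw (farr F) (hom A X Y) (hom B (fobj F X) (fobj F Y)))"

definition essentially_surjective ::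
  "('o, 'a, 'm) cat_scheme \<Rightarrow> ('p, 'b, 'n) cat_scheme \<Rightarrow> ('o, 'a, 'p, 'b) functr \<Rightarrow> bool" where
  "essentially_surjective A B F \<longleftrightarrow> (\<forall>Y \<in> obj B. \<exists>X \<in> obj A. \<exists>e \<in> hom B (fobj F X) Y. iso B e)"

context linear_functor begin

lemmas [simp] = fobj_obj

lemma farr_simps [simp]:
  assumes "f \<in> arr A"
  shows "farr F f \<in> arr B" "src B (farr F f) = fobj F (src A f)" "trg B (farr F f) = fobj F (trg A f)"
  using farr_hom[of f "src A f" "trg A f"] assms by (auto simp: hom_def)

text \<open>A choice of preimages \<open>g Y\<close> with isomorphisms \<open>e Y\<close> determines
  the inverse functor. Each of its laws holds after applying \<open>F\<close>, hence holds by
  faithfulness, and linearity is inherited from that of \<open>F\<close>.\<close>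

lemma equivalence:
  assumes ff: "fully_faithful A B F" and es: "essentially_surjective A B F"
  shows "equivalence_of_categories A B F"
proof -
  obtain g where "\<forall>Y \<in> obj B. g Y \<in> obj A \<and> (\<exists>e \<in> hom B (fobj F (g Y)) Y. iso B e)"
    using bchoice[of "obj B" "\<lambda>Y X. X \<in> obj A \<and> (\<exists>e \<in> hom B (fobj F X) Y. iso B e)"] es
    unfolding essentially_surjective_def by blast
  moreover from this obtain e where "\<forall>Y \<in> obj B. e Y \<in> hom B (fobj F (g Y)) Y \<and> iso B (e Y)"
    using bchoice[of "obj B" "\<lambda>Y e. e \<in> hom B (fobj F (g Y)) Y \<and> iso B e"] by blast
  ultimately have g [simp]: "g Y \<in> obj A" and e [simp]: "e Y \<in> arr B" "src B (e Y) = fobj F (g Y)"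
    "trg B (e Y) = Y" "iso B (e Y)" if "Y \<in> obj B" for Y
    using that by (auto simp: hom_def)
  define lift where "lift X Y = inv_into (hom A X Y) (farr F)" for X Y
  have bij: "bij_betw (farr F) (hom A X Y) (hom B (fobj F X) (fobj F Y))"
    if "X \<in> obj A" "Y \<in> obj A" for X Y
    using ff that by (auto simp: fully_faithful_def)
  have lift [simp]: "lift X Y h \<in> arr A" "src A (lift X Y h) = X" "trg A (lift X Y h) = Y"
      "farr F (lift X Y h) = h"
    if "X \<in> obj A" "Y \<in> obj A" "h \<in> arr B" "src B h = fobj F X" "trg B h = fobj F Y" for X Y h
  proof -
    have h: "h \<in> farr F ` hom A X Y"
      using bij[OF that(1,2)] that(3-5) by (simp add: bij_betw_def in_hom_iff[of h])
    from inv_into_into[OF h] f_inv_into_f[OF h]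
    show "lift X Y h \<in> arr A" "src A (lift X Y h) = X" "trg A (lift X Y h) = Y"
      "farr F (lift X Y h) = h"
      by (auto simp: lift_def hom_def)
  qed
  have faithful: "h = k"
    if "farr F h = farr F k" "h \<in> arr A" "k \<in> arr A" "src A h = src A k" "trg A h = trg A k" for h k
    using inj_onD[OF bij_betw_imp_inj_on[OF bij[of "src A k" "trg A k"]] that(1)] that
    by (simp add: in_hom_iff)
  \<comment> \<open>On arrows: conjugate with the chosen isomorphisms, then take the unique
    preimage. This choice is what makes \<open>e\<close> natural.\<close>
  define G where
    "G = \<lparr>fobj = g, farr = (\<lambda>h. lift (g (src B h)) (g (trg B h))
       (inv_arr B (e (trg B h)) \<cdot>\<^bsub>B\<^esub> h \<cdot>\<^bsub>B\<^esub> e (src B h)))\<rparr>"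
  have G [simp]: "fobj G = g" "\<And>h. farr G h = lift (g (src B h)) (g (trg B h))
       (inv_arr B (e (trg B h)) \<cdot>\<^bsub>B\<^esub> h \<cdot>\<^bsub>B\<^esub> e (src B h))"
    by (simp_all add: G_def)
  have FG [simp]: "farr F (farr G h) = inv_arr B (e (trg B h)) \<cdot>\<^bsub>B\<^esub> h \<cdot>\<^bsub>B\<^esub> e (src B h)"
    if "h \<in> arr B" for h
    using that by simp
  have "linear_functor B A G"
  proof
    show "fobj G X \<in> obj A" if "X \<in> obj B" for X using that by simp
    show "farr G h \<in> hom A (fobj G X) (fobj G Y)" if "h \<in> hom B X Y" for h X Y
      using that by (auto simp: hom_def)
    show "farr G (idt B X) = idt A (fobj G X)" if "X \<in> obj B" for X
      by (rule faithful) (use that in \<open>simp_all add: farr_idt\<close>)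
    show "farr G (k \<cdot>\<^bsub>B\<^esub> h) = farr G k \<cdot>\<^bsub>A\<^esub> farr G h"
      if hk: "h \<in> hom B X Y" "k \<in> hom B Y Z" for h k X Y Z
    proof (rule faithful)
      have [simp]: "h \<in> arr B" "k \<in> arr B" "src B h = X" "trg B h = Y" "src B k = Y" "trg B k = Z"
        "X \<in> obj B" "Y \<in> obj B" "Z \<in> obj B"
        using hk by (auto simp: hom_def)
      have "farr F (farr G k \<cdot>\<^bsub>A\<^esub> farr G h) = farr F (farr G k) \<cdot>\<^bsub>B\<^esub> farr F (farr G h)"
        by (rule farr_cmp[of _ "g X" "g Y" _ "g Z"]) (simp_all add: in_hom_iff)
      then show "farr F (farr G (k \<cdot>\<^bsub>B\<^esub> h)) = farr F (farr G k \<cdot>\<^bsub>A\<^esub> farr G h)" by simp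
    qed (use hk in \<open>auto simp: hom_def\<close>)
    show "farr G (h \<oplus>\<^bsub>B\<^esub> k) = farr G h \<oplus>\<^bsub>A\<^esub> farr G k"
      if hk: "h \<in> hom B X Y" "k \<in> hom B X Y" for h k X Y
    proof (rule faithful)
      have [simp]: "h \<in> arr B" "k \<in> arr B" "src B h = X" "trg B h = Y" "src B k = X" "trg B k = Y"
        "X \<in> obj B" "Y \<in> obj B"
        using hk by (auto simp: hom_def)
      have "farr F (farr G h \<oplus>\<^bsub>A\<^esub> farr G k) = farr F (farr G h) \<oplus>\<^bsub>B\<^esub> farr F (farr G k)"
        by (rule farr_add[of _ "g X" "g Y"]) (simp_all add: in_hom_iff)
      then show "farr F (farr G (h \<oplus>\<^bsub>B\<^esub> k)) = farr F (farr G h \<oplus>\<^bsub>A\<^esub> farr G k)"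
        by (simp add: B.cmp_vadd)
    qed (use hk in \<open>auto simp: hom_def\<close>)
    show "farr G (vscale B c h) = vscale A c (farr G h)" if h: "h \<in> hom B X Y" for h X Y c
    proof (rule faithful)
      have [simp]: "h \<in> arr B" "src B h = X" "trg B h = Y" "X \<in> obj B" "Y \<in> obj B"
        using h by (auto simp: hom_def)
      have "farr F (vscale A c (farr G h)) = vscale B c (farr F (farr G h))"
        by (rule farr_scale[of _ "g X" "g Y"]) (simp_all add: in_hom_iff)
      then show "farr F (farr G (vscale B c h)) = farr F (vscale A c (farr G h))"
        by (simp add: B.cmp_vscale)
    qed (use h in \<open>auto simp: hom_def\<close>)
  qed
  moreover have "natural_isomorphism B B (comp_functr F G) id_functr e"
    by (auto simp: natural_isomorphism_def natural_transformation_def comp_functr_def id_functr_def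
      in_hom_iff simp del: G(2))
  \<comment> \<open>The unit at \<open>X\<close> is the preimage of the inverse of \<open>e\<close>
    at \<open>F X\<close>; the preimage of \<open>e\<close> itself is its inverse.\<close>
  moreover have "natural_isomorphism A A id_functr (comp_functr G F)
      (\<lambda>X. lift X (g (fobj F X)) (inv_arr B (e (fobj F X))))"
    unfolding natural_isomorphism_def natural_transformation_def comp_functr_def id_functr_def
      functr.simps
  proof (intro conjI ballI)
    fix X assume [simp]: "X \<in> obj A"
    show "lift X (g (fobj F X)) (inv_arr B (e (fobj F X))) \<in> hom A X (fobj G (fobj F X))"
      by (simp add: in_hom_iff)
    have "inverse_arrows A (lift X (g (fobj F X)) (inv_arr B (e (fobj F X))))
        (lift (g (fobj F X)) X (e (fobj F X)))"
    proof (rule A.inverse_arrowsI)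
      let ?s = "lift X (g (fobj F X)) (inv_arr B (e (fobj F X)))" and ?t = "lift (g (fobj F X)) X (e (fobj F X))"
      have "farr F (?t \<cdot>\<^bsub>A\<^esub> ?s) = farr F ?t \<cdot>\<^bsub>B\<^esub> farr F ?s"
        by (rule farr_cmp[of _ X "g (fobj F X)" _ X]) (simp_all add: in_hom_iff)
      moreover have "farr F (?s \<cdot>\<^bsub>A\<^esub> ?t) = farr F ?s \<cdot>\<^bsub>B\<^esub> farr F ?t"
        by (rule farr_cmp[of _ "g (fobj F X)" X _ "g (fobj F X)"]) (simp_all add: in_hom_iff)
      ultimately show "?t \<cdot>\<^bsub>A\<^esub> ?s = idt A (src A ?s)" "?s \<cdot>\<^bsub>A\<^esub> ?t = idt A (trg A ?s)"
        by - (rule faithful; simp add: farr_idt)+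
    qed simp_all
    then show "iso A (lift X (g (fobj F X)) (inv_arr B (e (fobj F X))))"
      by (rule inverse_arrows_iso)
  next
    fix f assume [simp]: "f \<in> arr A"
    let ?X = "src A f" and ?Y = "trg A f"
    let ?s = "\<lambda>X. lift X (g (fobj F X)) (inv_arr B (e (fobj F X)))"
    have "farr F (?s ?Y \<cdot>\<^bsub>A\<^esub> f) = farr F (?s ?Y) \<cdot>\<^bsub>B\<^esub> farr F f"
      by (rule farr_cmp[of _ ?X ?Y _ "g (fobj F ?Y)"]) (simp_all add: in_hom_iff)
    moreover have "farr F (farr G (farr F f) \<cdot>\<^bsub>A\<^esub> ?s ?X) = farr F (farr G (farr F f)) \<cdot>\<^bsub>B\<^esub> farr F (?s ?X)"
      by (rule farr_cmp[of _ ?X "g (fobj F ?X)" _ "g (fobj F ?Y)"]) (simp_all add: in_hom_iff)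
    ultimately show "?s ?Y \<cdot>\<^bsub>A\<^esub> f = farr G (farr F f) \<cdot>\<^bsub>A\<^esub> ?s ?X"
      by (intro faithful) simp_all
  qed
  ultimately show ?thesis
    unfolding equivalence_of_categories_def using linear_functor_axioms by blast
qed

end

section \<open>The comparison functor\<close>

context action_adjunction begin

definition Mods :: "('k, 'o, 'a, 'o \<times> 'a, ('o, 'a) sarr) modcat" where "Mods = mod_cat C Alg"

definition K :: "('p, 'b, 'o \<times> 'a, ('o, 'a) sarr) functr" where
  "K = \<lparr>fobj = (\<lambda>N. (fobj R N, \<rho> N)),
     farr = (\<lambda>f. ((fobj R (src M f), \<rho> (src M f)), farr R f, (fobj R (trg M f), \<rho> (trg M f))))\<rparr>"

text \<open>A module functor carries arrows
  \<open>F (V \<rhd> N) \<rightarrow> V \<rhd> F N\<close>, against the direction of a lax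
  structure; hence the inverse of \<phi>.\<close>

definition Kstr :: "'o \<Rightarrow> 'p \<Rightarrow> ('o, 'a) sarr" where
  "Kstr V N = ((fobj R (V \<rhd>\<^bsub>M\<^esub> N), \<rho> (V \<rhd>\<^bsub>M\<^esub> N)), inv_arr C (\<phi> V N), aobj Mods V (fobj R N, \<rho> N))"

lemma K_simps [simp]:
  "fobj K N = (fobj R N, \<rho> N)"
  "farr K f = ((fobj R (src M f), \<rho> (src M f)), farr R f, (fobj R (trg M f), \<rho> (trg M f)))"
  by (simp_all add: K_def)

lemma Alg_in: "algebra_in C Alg"
  by (intro algebra_in.intro algebra_in_axioms.intro C.monoidal_category_axioms Alg_algebra)

lemma Mods_eq: "Mods = structured_modcat C {X. right_module C Alg X}
   (\<lambda>X Y f. f \<cdot> snd X = snd Y \<cdot> (f \<boxtimes> idt C A))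
   (\<lambda>V X. (idt C V \<boxtimes> snd X) \<cdot> tassoc C V (fst X) A)"
  by (simp add: Mods_def mod_cat_def)

lemma Mods_structure: "module_structure C {X. right_module C Alg X}
   (\<lambda>X Y f. f \<cdot> snd X = snd Y \<cdot> (f \<boxtimes> idt C A))
   (\<lambda>V X. (idt C V \<boxtimes> snd X) \<cdot> tassoc C V (fst X) A)"
  using algebra_in.modules[OF Alg_in] by simp

lemmas Mods_simps = module_structure.D_simps [OF Mods_structure, folded Mods_eq]
lemmas Mods_hom_iff = module_structure.D_hom_iff [OF Mods_structure, folded Mods_eq]
lemmas Mods_iso = module_structure.D_iso [OF Mods_structure, folded Mods_eq]
lemmas Mods_module = module_structure.D_module [OF Mods_structure, folded Mods_eq]

lemma K_linear: "linear_functor M Mods K"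
proof -
  interpret R: linear_functor M C R by (rule R_linear)
  interpret N: module_category C Mods by (rule Mods_module)
  show ?thesis
  proof
    show "fobj K X \<in> obj Mods" if "X \<in> obj M" for X
      using that rho_module by (simp add: Mods_simps)
    show "farr K f \<in> hom Mods (fobj K X) (fobj K Y)" if "f \<in> hom M X Y" for f X Y
      using that rho_module R_module_map
      by (auto simp: Mods_hom_iff in_hom_iff[where C = C] in_hom_iff[where C = M])
    show "farr K (idt M X) = idt Mods (fobj K X)" if "X \<in> obj M" for X
      using that by (simp add: Mods_simps)
    show "farr K (cmp M g f) = cmp Mods (farr K g) (farr K f)" if "f \<in> hom M X Y" "g \<in> hom M Y Z" for f g X Y Z
      using that by (auto simp: Mods_simps hom_def)
    show "farr K (vadd M f g) = vadd Mods (farr K f) (farr K g)" if "f \<in> hom M X Y" "g \<in> hom M X Y" for f g X Y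
      using that R.farr_add[OF that] by (auto simp: Mods_simps hom_def)
    show "farr K (vscale M c f) = vscale Mods c (farr K f)" if "f \<in> hom M X Y" for f c X Y
      using that R.farr_scale[OF that] by (auto simp: Mods_simps hom_def)
  qed
qed

lemma inv_lax_nat:
  assumes [simp]: "f \<in> arr C" "g \<in> arr M"
  shows "inv_arr C (\<phi> (trg C f) (trg M g)) \<cdot> farr R (f \<unrhd>\<^bsub>M\<^esub> g)
    = (f \<boxtimes> farr R g) \<cdot> inv_arr C (\<phi> (src C f) (src M g))"
  by (rule C.inv_arr_natural) (simp_all add: lax_nat)

lemma Kstr_hom:
  assumes [simp]: "V \<in> obj C" "N \<in> obj M"
  shows "Kstr V N \<in> hom Mods (fobj K (V \<rhd>\<^bsub>M\<^esub> N)) (aobj Mods V (fobj K N))" "iso Mods (Kstr V N)"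
proof -
  interpret S: module_structure C "{X. right_module C Alg X}"
   "\<lambda>X Y f. f \<cdot> snd X = snd Y \<cdot> (f \<boxtimes> idt C A)"
   "\<lambda>V X. (idt C V \<boxtimes> snd X) \<cdot> tassoc C V (fst X) A"
    by (rule Mods_structure)
  have 1: "right_module C Alg (fobj R (V \<rhd>\<^bsub>M\<^esub> N), \<rho> (V \<rhd>\<^bsub>M\<^esub> N))"
    "right_module C Alg (V \<otimes> fobj R N, (idt C V \<boxtimes> \<rho> N) \<cdot> tassoc C V (fobj R N) A)"
    using rho_module[of "V \<rhd>\<^bsub>M\<^esub> N"] S.act_S[of V "(fobj R N, \<rho> N)"] rho_module[of N] by simp_all
  have 2: "inv_arr C (\<phi> V N) \<cdot> \<rho> (V \<rhd>\<^bsub>M\<^esub> N)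
    = ((idt C V \<boxtimes> \<rho> N) \<cdot> tassoc C V (fobj R N) A) \<cdot> (inv_arr C (\<phi> V N) \<boxtimes> idt C A)"
    using S.H_inv[of "(V \<otimes> fobj R N, (idt C V \<boxtimes> \<rho> N) \<cdot> tassoc C V (fobj R N) A)"
      "(fobj R (V \<rhd>\<^bsub>M\<^esub> N), \<rho> (V \<rhd>\<^bsub>M\<^esub> N))" "\<phi> V N"] 1 lax_module_map[of V N]
    by (simp add: in_hom_iff)
  show "Kstr V N \<in> hom Mods (fobj K (V \<rhd>\<^bsub>M\<^esub> N)) (aobj Mods V (fobj K N))"
    unfolding Mods_hom_iff Kstr_def using 1 2 by (simp add: Mods_simps in_hom_iff)
  show "iso Mods (Kstr V N)"
    unfolding Kstr_def Mods_simps
    by (rule Mods_iso) (use 1 2 in \<open>simp_all add: in_hom_iff\<close>)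
qed

lemma K_module_functor: "module_functor C M Mods K Kstr"
proof (intro module_functor.intro module_functor_axioms.intro module_category_axioms Mods_module K_linear)
  show "Kstr V N \<in> hom Mods (fobj K (V \<rhd>\<^bsub>M\<^esub> N)) (aobj Mods V (fobj K N))" "iso Mods (Kstr V N)"
    if "V \<in> obj C" "N \<in> obj M" for V N
    using Kstr_hom[OF that] by auto
  show "cmp Mods (Kstr V' N') (farr K (f \<unrhd>\<^bsub>M\<^esub> g)) = cmp Mods (aarr Mods f (farr K g)) (Kstr V N)"
    if "f \<in> hom C V V'" "g \<in> hom M N N'" for f V V' g N N'
    using that inv_lax_nat[of f g] by (auto simp: Kstr_def Mods_simps hom_def)
  show "cmp Mods (aassoc Mods V W (fobj K N)) (Kstr (V \<otimes> W) N)
    = cmp Mods (aarr Mods (idt C V) (Kstr W N)) (cmp Mods (Kstr V (W \<rhd>\<^bsub>M\<^esub> N)) (farr K (aassoc M V W N)))"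
    if [simp]: "V \<in> obj C" "W \<in> obj C" "N \<in> obj M" for V W N
  proof -
    have i: "inv_arr C (\<phi> V (W \<rhd>\<^bsub>M\<^esub> N) \<cdot> (idt C V \<boxtimes> \<phi> W N))
        = (idt C V \<boxtimes> inv_arr C (\<phi> W N)) \<cdot> inv_arr C (\<phi> V (W \<rhd>\<^bsub>M\<^esub> N))"
      by (subst C.inv_arr_eqI[OF C.inverse_arrows_cmp]) (simp_all add: C.iso_idt)
    \<comment> \<open>This is \<open>lax_assoc\<close> with its two invertible sides turned
      around.\<close>
    have "inv_arr C (\<phi> V (W \<rhd>\<^bsub>M\<^esub> N) \<cdot> (idt C V \<boxtimes> \<phi> W N)) \<cdot> farr R (aassoc M V W N)
        = tassoc C V W (fobj R N) \<cdot> inv_arr C (\<phi> (V \<otimes> W) N)"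
      by (rule C.inv_arr_natural) (simp_all add: lax_assoc C.iso_idt)
    then show ?thesis unfolding i by (simp add: Kstr_def Mods_simps)
  qed
  show "cmp Mods (aunit Mods (fobj K N)) (Kstr (tone C) N) = farr K (aunit M N)"
    if [simp]: "N \<in> obj M" for N
    by (simp add: Kstr_def Mods_simps flip: lax_unit)
qed

end

section \<open>Reconstruction from projective objects\<close>

lemma enough_projectivesD:
  assumes "enough_projectives C" "Z \<in> obj C"
  obtains P p where "projective C P" "p \<in> hom C P Z" "epi C p"
  using assms unfolding enough_projectives_def by blast

locale projective_generator = action_adjunction C M X R \<eta> \<epsilon> + C: abelian_category C + M: abelian_category M
  for C :: "('k::field, 'o, 'a, 'm) moncat_scheme" (structure)
    and M :: "('k, 'o, 'a, 'p, 'b, 'n) modcat_scheme" and X R \<eta> \<epsilon> +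
  assumes enough_C: "enough_projectives C" and enough_M: "enough_projectives M"
    and act_projective: "projective C P \<Longrightarrow> projective M (P \<rhd>\<^bsub>M\<^esub> X)"
    and projective_summand: "projective M Q \<Longrightarrow> \<exists>P. projective C P \<and> direct_summand M Q (P \<rhd>\<^bsub>M\<^esub> X)"
begin

text \<open>If \<open>R f = R g\<close>, then \<open>f\<close> and \<open>g\<close> agree on the
  counit, through which every arrow out of an object \<open>P \<rhd> X\<close> factors. Such objects
  cover everything, since projectives are their summands.\<close>

lemma R_faithful:
  assumes eq: "farr R f = farr R g" and [simp]: "f \<in> arr M" "g \<in> arr M" "src M f = src M g" "trg M f = trg M g"
  shows "f = g"
proof -
  have free: "f \<cdot>\<^bsub>M\<^esub> t = g \<cdot>\<^bsub>M\<^esub> t" if t [simp]: "t \<in> arr M" "trg M t = src M g" "src M t = P \<rhd>\<^bsub>M\<^esub> X" "P \<in> obj C" for t P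
  proof -
    \<comment> \<open>The factorisation of \<open>t\<close> through the counit.\<close>
    have t': "\<epsilon> (src M g) \<cdot>\<^bsub>M\<^esub> (farr R t \<unrhd>\<^bsub>M\<^esub> idt M X) \<cdot>\<^bsub>M\<^esub> (\<eta> P \<unrhd>\<^bsub>M\<^esub> idt M X) = t"
      by (rule counit_transpose) simp_all
    have "f \<cdot>\<^bsub>M\<^esub> \<epsilon> (src M g) = g \<cdot>\<^bsub>M\<^esub> \<epsilon> (src M g)"
      using counit_nat[of f "trg M g"] counit_nat[of g "trg M g"] eq by simp
    from M.cmp_ext[OF this, of "(farr R t \<unrhd>\<^bsub>M\<^esub> idt M X) \<cdot>\<^bsub>M\<^esub> (\<eta> P \<unrhd>\<^bsub>M\<^esub> idt M X)"] show ?thesis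
      by (simp add: t')
  qed
  obtain Q p where Q: "projective M Q" "p \<in> hom M Q (src M g)" "epi M p"
    by (rule enough_projectivesD[OF enough_M, of "src M g"]) auto
  obtain P i q where P: "projective C P" "i \<in> hom M Q (P \<rhd>\<^bsub>M\<^esub> X)" "q \<in> hom M (P \<rhd>\<^bsub>M\<^esub> X) Q" "q \<cdot>\<^bsub>M\<^esub> i = idt M Q"
    using projective_summand[OF Q(1)] by (auto simp: direct_summand_def biproduct_def)
  have [simp]: "P \<in> obj C" using P by (simp add: projective_def)
  have [simp]: "p \<in> arr M" "src M p = Q" "trg M p = src M g" "Q \<in> obj M"
    "i \<in> arr M" "src M i = Q" "trg M i = P \<rhd>\<^bsub>M\<^esub> X" "q \<in> arr M" "src M q = P \<rhd>\<^bsub>M\<^esub> X" "trg M q = Q"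
    using Q P M.obj_src_trg[of p] by (auto simp: hom_def)
  \<comment> \<open>Here \<open>q\<close> is the projection of \<open>P \<rhd> X\<close> onto its
    summand \<open>Q\<close>, with section \<open>i\<close>. Composing with \<open>i\<close>
    afterwards removes \<open>q\<close> and leaves the projective cover \<open>p\<close>.\<close>
  have "f \<cdot>\<^bsub>M\<^esub> p \<cdot>\<^bsub>M\<^esub> q = g \<cdot>\<^bsub>M\<^esub> p \<cdot>\<^bsub>M\<^esub> q" by (rule free[of _ P]) simp_all
  then have "(f \<cdot>\<^bsub>M\<^esub> p \<cdot>\<^bsub>M\<^esub> q) \<cdot>\<^bsub>M\<^esub> i = (g \<cdot>\<^bsub>M\<^esub> p \<cdot>\<^bsub>M\<^esub> q) \<cdot>\<^bsub>M\<^esub> i" by (simp only:)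
  then have "f \<cdot>\<^bsub>M\<^esub> p = g \<cdot>\<^bsub>M\<^esub> p" by (simp add: P)
  then show ?thesis by (rule M.epi_cancel[OF Q(3)]) simp_all
qed

text \<open>Composites \<open>g \<cdot> \<epsilon> N\<close> are transposes of \<open>R g\<close>,
  so cancelling the counit amounts to faithfulness of \<open>R\<close>.\<close>

lemma counit_epi:
  assumes [simp]: "N \<in> obj M" shows "epi M (\<epsilon> N)"
  unfolding epi_def
proof (intro conjI allI ballI impI)
  fix Z g h
  assume "g \<in> hom M (trg M (\<epsilon> N)) Z" "h \<in> hom M (trg M (\<epsilon> N)) Z" and eq: "g \<cdot>\<^bsub>M\<^esub> \<epsilon> N = h \<cdot>\<^bsub>M\<^esub> \<epsilon> N"
  then have [simp]: "g \<in> arr M" "h \<in> arr M" "src M g = N" "src M h = N" "trg M g = Z" "trg M h = Z" "Z \<in> obj M"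
    by (auto simp: hom_def)
  have "farr R g = farr R h"
    by (rule transpose_inj[of Z]) (simp_all add: counit_nat eq)
  then show "g = h" by (rule R_faithful) simp_all
qed simp

text \<open>Cover the target of \<open>R f\<close> by a projective \<open>P\<close>. The transpose
  of the cover starts at the projective \<open>P \<rhd> X\<close> and lifts through
  \<open>f\<close>; transposing the lift back factors the cover through \<open>R f\<close>.\<close>

lemma R_epi:
  assumes e: "epi M f" shows "epi C (farr R f)"
proof -
  have [simp]: "f \<in> arr M" by (rule epi_arr[OF e])
  obtain P p where P: "projective C P" "p \<in> hom C P (fobj R (trg M f))" "epi C p"
    by (rule enough_projectivesD[OF enough_C, of "fobj R (trg M f)"]) auto
  have [simp]: "P \<in> obj C" using P by (simp add: projective_def)
  have [simp]: "p \<in> arr C" "src C p = P" "trg C p = fobj R (trg M f)"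
    using P by (auto simp: hom_def)
  obtain t where t: "t \<in> hom M (P \<rhd>\<^bsub>M\<^esub> X) (src M f)" "f \<cdot>\<^bsub>M\<^esub> t = \<epsilon> (trg M f) \<cdot>\<^bsub>M\<^esub> (p \<unrhd>\<^bsub>M\<^esub> idt M X)"
    using projectiveD[OF act_projective[OF P(1)] e, of "\<epsilon> (trg M f) \<cdot>\<^bsub>M\<^esub> (p \<unrhd>\<^bsub>M\<^esub> idt M X)"]
    by (auto simp: hom_def)
  have [simp]: "t \<in> arr M" "src M t = P \<rhd>\<^bsub>M\<^esub> X" "trg M t = src M f" using t by (auto simp: hom_def)
  have "farr R f \<cdot> farr R t \<cdot> \<eta> P = p"
    by (rule transpose_inj[of "trg M f"])
      (simp_all add: M.cmp_ext[OF counit_nat] counit_transpose t(2))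
  then have "epi C (farr R f \<cdot> farr R t \<cdot> \<eta> P)" using P by simp
  then show ?thesis by (rule C.epi_of_cmp) simp_all
qed

text \<open>A preimage \<open>f\<close> must satisfy
  \<open>f \<cdot> \<epsilon> N = \<epsilon> N' \<cdot> (h \<rhd> X)\<close>. Such an
  \<open>f\<close> exists once the right side vanishes on whatever the counit at \<open>N\<close>
  kills, and this can be checked after applying the faithful functor \<open>R\<close>.\<close>

lemma K_full:
  assumes N [simp]: "N \<in> obj M" "N' \<in> obj M"
    and [simp]: "h \<in> arr C" "src C h = fobj R N" "trg C h = fobj R N'"
    and map: "h \<cdot> \<rho> N = \<rho> N' \<cdot> (h \<boxtimes> idt C A)"
  shows "\<exists>f \<in> hom M N N'. farr R f = h"
proof -
  \<comment> \<open>Linearity of \<open>h\<close> over \<open>A\<close>, with the invertible \<phi>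
    contained in \<rho> cancelled.\<close>
  have *: "farr R (\<epsilon> N') \<cdot> farr R (h \<unrhd>\<^bsub>M\<^esub> idt M X) = h \<cdot> farr R (\<epsilon> N)"
  proof (rule C.iso_cancel_right[where f = "\<phi> (fobj R N) X"])
    have "\<phi> (fobj R N') X \<cdot> (h \<boxtimes> idt C A) = farr R (h \<unrhd>\<^bsub>M\<^esub> idt M X) \<cdot> \<phi> (fobj R N) X"
      using lax_nat[of h "idt M X"] by simp
    then show "(farr R (\<epsilon> N') \<cdot> farr R (h \<unrhd>\<^bsub>M\<^esub> idt M X)) \<cdot> \<phi> (fobj R N) X
        = (h \<cdot> farr R (\<epsilon> N)) \<cdot> \<phi> (fobj R N) X"
      using map by (simp add: \<rho>_def)
  qed simp_all
  have "\<exists>f \<in> hom M (trg M (\<epsilon> N)) N'. f \<cdot>\<^bsub>M\<^esub> \<epsilon> N = \<epsilon> N' \<cdot>\<^bsub>M\<^esub> (h \<unrhd>\<^bsub>M\<^esub> idt M X)"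
  proof (rule M.factor_through_epi[OF counit_epi])
    show "\<epsilon> N' \<cdot>\<^bsub>M\<^esub> (h \<unrhd>\<^bsub>M\<^esub> idt M X) \<in> hom M (src M (\<epsilon> N)) N'" by (simp add: in_hom_iff)
    fix Z x assume x: "x \<in> hom M Z (src M (\<epsilon> N))" "\<epsilon> N \<cdot>\<^bsub>M\<^esub> x = vzero M Z (trg M (\<epsilon> N))"
    then have [simp]: "x \<in> arr M" "src M x = Z" "trg M x = fobj R N \<rhd>\<^bsub>M\<^esub> X" "Z \<in> obj M"
      by (auto simp: hom_def)
    have "farr R ((\<epsilon> N' \<cdot>\<^bsub>M\<^esub> (h \<unrhd>\<^bsub>M\<^esub> idt M X)) \<cdot>\<^bsub>M\<^esub> x) = h \<cdot> farr R (\<epsilon> N \<cdot>\<^bsub>M\<^esub> x)"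
      by (simp add: C.cmp_ext[OF *])
    also have "\<dots> = farr R (vzero M Z N')"
      unfolding x(2) by (simp add: R_vzero)
    finally show "(\<epsilon> N' \<cdot>\<^bsub>M\<^esub> (h \<unrhd>\<^bsub>M\<^esub> idt M X)) \<cdot>\<^bsub>M\<^esub> x = vzero M Z N'"
      by (rule R_faithful) simp_all
  qed simp
  then obtain f where f: "f \<in> hom M N N'" "f \<cdot>\<^bsub>M\<^esub> \<epsilon> N = \<epsilon> N' \<cdot>\<^bsub>M\<^esub> (h \<unrhd>\<^bsub>M\<^esub> idt M X)" by auto
  have [simp]: "f \<in> arr M" "src M f = N" "trg M f = N'" using f by (auto simp: hom_def)
  have "farr R f = h"
    by (rule transpose_inj[of N']) (simp_all add: counit_nat f(2))
  then show ?thesis using f by blast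
qed

lemma K_fully_faithful: "fully_faithful M Mods K"
  unfolding fully_faithful_def
proof (intro ballI)
  fix N N' assume [simp]: "N \<in> obj M" "N' \<in> obj M"
  show "bij_betw (farr K) (hom M N N') (hom Mods (fobj K N) (fobj K N'))"
    unfolding bij_betw_def
  proof (intro conjI subset_antisym subsetI)
    show "inj_on (farr K) (hom M N N')"
      by (rule inj_onI) (auto simp: in_hom_iff intro: R_faithful)
    show "t \<in> hom Mods (fobj K N) (fobj K N')" if "t \<in> farr K ` hom M N N'" for t
      using that linear_functor.farr_hom[OF K_linear] by blast
    show "t \<in> farr K ` hom M N N'" if t: "t \<in> hom Mods (fobj K N) (fobj K N')" for t
    proof -
      obtain h where h: "t = (fobj K N, h, fobj K N')" "h \<in> hom C (fobj R N) (fobj R N')"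
        "h \<cdot> \<rho> N = \<rho> N' \<cdot> (h \<boxtimes> idt C A)"
        using t by (auto simp: Mods_hom_iff)
      obtain f where "f \<in> hom M N N'" "farr R f = h"
        using K_full[of N N' h] h by (auto simp: in_hom_iff)
      then have "f \<in> hom M N N'" "farr K f = t" using h by (auto simp: in_hom_iff)
      then show ?thesis by blast
    qed
  qed
qed

text \<open>A module \<open>(N, r)\<close> is isomorphic to the image of the object \<open>N \<otimes>\<^sub>A X\<close>, the cokernel \<open>q\<close> of
  \<open>d : (N \<otimes> A) \<rhd> X \<rightarrow> N \<rhd> X\<close>, and the isomorphism is the transpose \<open>h\<close> of \<open>q\<close>.\<close>

lemma K_essentially_surjective: "essentially_surjective M Mods K"
  unfolding essentially_surjective_def
proof
  fix Y assume "Y \<in> obj Mods"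
  then obtain N r where Y: "Y = (N, r)" and mod: "right_module C Alg (N, r)"
    by (cases Y) (auto simp: Mods_simps)
  interpret Q: algebra_in C Alg by (rule Alg_in)
  have [simp]: "N \<in> obj C" "r \<in> arr C" "src C r = N \<otimes> A" "trg C r = N"
    using Q.right_module_simps[OF mod] by auto
  have r_assoc: "r \<cdot> (r \<boxtimes> idt C A) = r \<cdot> (idt C N \<boxtimes> \<rho> X) \<cdot> tassoc C N A A"
    using Q.right_module_assoc[OF mod] by (simp add: alg_mult)
  have r_unit: "r \<cdot> (idt C N \<boxtimes> alg_unit Alg) = trunit C N"
    using Q.right_module_unit[OF mod] by simp
  \<comment> \<open>The second of the two parallel arrows
    \<open>(N \<otimes> A) \<rhd> X \<rightarrow> N \<rhd> X\<close>, letting \<open>A\<close> act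
    on \<open>X\<close> by evaluation; the first is \<open>r\<close> acting on \<open>X\<close>.
    Precomposition of \<open>m\<close> with \<open>g \<rhd> X\<close> is the bijection of
    \<open>counit_mono_on_free\<close> at \<open>V = N\<close>.\<close>
  define m where "m = (idt C N \<unrhd>\<^bsub>M\<^esub> \<epsilon> X) \<cdot>\<^bsub>M\<^esub> aassoc M N A X"
  have m [simp]: "m \<in> arr M" "src M m = (N \<otimes> A) \<rhd>\<^bsub>M\<^esub> X" "trg M m = N \<rhd>\<^bsub>M\<^esub> X" by (simp_all add: m_def)
  define d where "d = (r \<unrhd>\<^bsub>M\<^esub> idt M X) \<oplus>\<^bsub>M\<^esub> vscale M (-1) m"
  have d [simp]: "d \<in> arr M" "src M d = (N \<otimes> A) \<rhd>\<^bsub>M\<^esub> X" "trg M d = N \<rhd>\<^bsub>M\<^esub> X" by (simp_all add: d_def)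
  have d_zero_iff: "d \<cdot>\<^bsub>M\<^esub> z = vzero M (src M z) (N \<rhd>\<^bsub>M\<^esub> X) \<longleftrightarrow> (r \<unrhd>\<^bsub>M\<^esub> idt M X) \<cdot>\<^bsub>M\<^esub> z = m \<cdot>\<^bsub>M\<^esub> z"
    if [simp]: "z \<in> arr M" "trg M z = (N \<otimes> A) \<rhd>\<^bsub>M\<^esub> X" for z
    using M.vadd_neg_eq_zero_iff[of "(r \<unrhd>\<^bsub>M\<^esub> idt M X) \<cdot>\<^bsub>M\<^esub> z" "src M z" "N \<rhd>\<^bsub>M\<^esub> X" "m \<cdot>\<^bsub>M\<^esub> z"]
    by (simp add: d_def M.cmp_vadd M.cmp_vscale in_hom_iff)
  obtain q where q: "is_cokernel M q d" using M.ex_cokernel[of d] by auto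
  define L where "L = trg M q"
  have [simp]: "q \<in> arr M" "src M q = N \<rhd>\<^bsub>M\<^esub> X" "trg M q = L" "L \<in> obj M"
    using q by (auto simp: is_cokernel_def L_def)
  have qd: "q \<cdot>\<^bsub>M\<^esub> d = vzero M ((N \<otimes> A) \<rhd>\<^bsub>M\<^esub> X) L"
    using q by (auto simp: is_cokernel_def)
  have qr: "q \<cdot>\<^bsub>M\<^esub> (r \<unrhd>\<^bsub>M\<^esub> idt M X) = q \<cdot>\<^bsub>M\<^esub> m"
    using qd M.vadd_neg_eq_zero_iff[of "q \<cdot>\<^bsub>M\<^esub> (r \<unrhd>\<^bsub>M\<^esub> idt M X)" "(N \<otimes> A) \<rhd>\<^bsub>M\<^esub> X" L "q \<cdot>\<^bsub>M\<^esub> m"]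
    by (simp add: d_def M.cmp_vadd M.cmp_vscale in_hom_iff)
  define h where "h = farr R q \<cdot> \<eta> N"
  have h [simp]: "h \<in> arr C" "src C h = N" "trg C h = fobj R L" by (simp_all add: h_def)
  have hq: "\<epsilon> L \<cdot>\<^bsub>M\<^esub> (h \<unrhd>\<^bsub>M\<^esub> idt M X) = q" by (simp add: h_def counit_transpose)
  have h_map: "h \<cdot> r = \<rho> L \<cdot> (h \<boxtimes> idt C A)"
  proof (rule transpose_inj[of L])
    have "\<epsilon> L \<cdot>\<^bsub>M\<^esub> ((h \<cdot> r) \<unrhd>\<^bsub>M\<^esub> idt M X) = q \<cdot>\<^bsub>M\<^esub> (r \<unrhd>\<^bsub>M\<^esub> idt M X)"
      by (simp add: M.cmp_ext[OF hq])
    also have "\<dots> = q \<cdot>\<^bsub>M\<^esub> (idt C N \<unrhd>\<^bsub>M\<^esub> \<epsilon> X) \<cdot>\<^bsub>M\<^esub> aassoc M N A X"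
      by (simp add: qr m_def)
    also have "\<dots> = \<epsilon> L \<cdot>\<^bsub>M\<^esub> ((\<rho> L \<cdot> (h \<boxtimes> idt C A)) \<unrhd>\<^bsub>M\<^esub> idt M X)"
      by (simp add: M.cmp_ext[OF counit_rho] aassoc_nat M.cmp_ext[OF interchange] M.cmp_ext[OF hq])
    finally show "\<epsilon> L \<cdot>\<^bsub>M\<^esub> ((h \<cdot> r) \<unrhd>\<^bsub>M\<^esub> idt M X) = \<epsilon> L \<cdot>\<^bsub>M\<^esub> ((\<rho> L \<cdot> (h \<boxtimes> idt C A)) \<unrhd>\<^bsub>M\<^esub> idt M X)" .
  qed simp_all
  \<comment> \<open>Linearity turns \<open>h \<cdot> r\<close> into \<open>R q\<close> composed with
    an isomorphism, and \<open>R\<close> preserves the epi \<open>q\<close>.\<close>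
  have "epi C (h \<cdot> r)"
  proof -
    have "\<phi> (fobj R L) X \<cdot> (h \<boxtimes> idt C A) = farr R (h \<unrhd>\<^bsub>M\<^esub> idt M X) \<cdot> \<phi> N X"
      using lax_nat[of h "idt M X"] by simp
    then have "h \<cdot> r = farr R (\<epsilon> L \<cdot>\<^bsub>M\<^esub> (h \<unrhd>\<^bsub>M\<^esub> idt M X)) \<cdot> \<phi> N X"
      unfolding h_map by (simp add: \<rho>_def)
    then have "h \<cdot> r = farr R q \<cdot> \<phi> N X" by (simp only: hq)
    moreover have "epi C (farr R q \<cdot> \<phi> N X)"
      by (rule C.epi_cmp[OF C.iso_epi R_epi[OF M.is_cokernel_epi[OF q]]]) simp_all
    ultimately show ?thesis by simp
  qed
  then have "epi C h" by (rule C.epi_of_cmp) simp_all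
  moreover have "mono C h"
    unfolding mono_def
  proof (intro conjI allI ballI impI)
    \<comment> \<open>With enough projectives, injectivity of \<open>h\<close> need only be tested
      on arrows out of projectives.\<close>
    have zero: "y = vzero C P N" if P: "projective C P" and y: "y \<in> hom C P N" "h \<cdot> y = vzero C P (fobj R L)"
      for y P
    proof -
      have [simp]: "y \<in> arr C" "src C y = P" "trg C y = N" "P \<in> obj C" using y by (auto simp: hom_def)
      have v0: "vzero C P (fobj R L) \<unrhd>\<^bsub>M\<^esub> idt M X = vzero M (P \<rhd>\<^bsub>M\<^esub> X) (fobj R L \<rhd>\<^bsub>M\<^esub> X)"
        using aarr_scale_left[of "vzero C P (fobj R L)" P "fobj R L" "idt M X" X X 0]
          M.vscale_0[of "vzero C P (fobj R L) \<unrhd>\<^bsub>M\<^esub> idt M X" "P \<rhd>\<^bsub>M\<^esub> X" "fobj R L \<rhd>\<^bsub>M\<^esub> X"]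
        by (simp add: hom_def C.vscale_vzero)
      \<comment> \<open>Both sides are the transpose of \<open>h \<cdot> y\<close>, which is zero.
        Exactness at \<open>N \<rhd> X\<close> then lifts \<open>y \<rhd> X\<close> through
        \<open>d\<close>, as \<open>P \<rhd> X\<close> is projective.\<close>
      have "q \<cdot>\<^bsub>M\<^esub> (y \<unrhd>\<^bsub>M\<^esub> idt M X) = \<epsilon> L \<cdot>\<^bsub>M\<^esub> ((h \<cdot> y) \<unrhd>\<^bsub>M\<^esub> idt M X)"
        by (simp add: M.cmp_ext[OF hq])
      also have "\<dots> = vzero M (P \<rhd>\<^bsub>M\<^esub> X) L" by (simp only: y v0) simp
      finally obtain z where z: "z \<in> hom M (P \<rhd>\<^bsub>M\<^esub> X) ((N \<otimes> A) \<rhd>\<^bsub>M\<^esub> X)" "d \<cdot>\<^bsub>M\<^esub> z = y \<unrhd>\<^bsub>M\<^esub> idt M X"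
        using M.projective_lift_exact[OF q act_projective[OF P], of "y \<unrhd>\<^bsub>M\<^esub> idt M X"]
        by (auto simp: in_hom_iff)
      have [simp]: "z \<in> arr M" "src M z = P \<rhd>\<^bsub>M\<^esub> X" "trg M z = (N \<otimes> A) \<rhd>\<^bsub>M\<^esub> X" using z by (auto simp: hom_def)
      \<comment> \<open>The lift lives in \<open>M\<close>; the bijection at
        \<open>V = N \<otimes> A\<close> brings it into \<open>C\<close>.\<close>
      obtain w where w: "w \<in> hom C P ((N \<otimes> A) \<otimes> A)"
        "(idt C (N \<otimes> A) \<unrhd>\<^bsub>M\<^esub> \<epsilon> X) \<cdot>\<^bsub>M\<^esub> aassoc M (N \<otimes> A) A X \<cdot>\<^bsub>M\<^esub> (w \<unrhd>\<^bsub>M\<^esub> idt M X) = z"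
        using counit_surj_on_free[of "N \<otimes> A" X P z] by auto
      have [simp]: "w \<in> arr C" "src C w = P" "trg C w = (N \<otimes> A) \<otimes> A" using w by (auto simp: hom_def)
      \<comment> \<open>\<open>?w1\<close> and \<open>?w2\<close> push \<open>w\<close> along the
        two arrows \<open>(N \<otimes> A) \<otimes> A \<rightarrow> N \<otimes> A\<close>, acting on
        \<open>N\<close> and multiplying in \<open>A\<close>. \<open>?y\<close> is \<open>y\<close>
        followed by insertion of the unit, a section of \<open>r\<close>.\<close>
      let ?w1 = "(r \<boxtimes> idt C A) \<cdot> w" and ?w2 = "(idt C N \<boxtimes> \<rho> X) \<cdot> tassoc C N A A \<cdot> w"
        and ?y = "(idt C N \<boxtimes> alg_unit Alg) \<cdot> inv_arr C (trunit C N) \<cdot> y"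
      have 1: "(r \<unrhd>\<^bsub>M\<^esub> idt M X) \<cdot>\<^bsub>M\<^esub> z = m \<cdot>\<^bsub>M\<^esub> (?w1 \<unrhd>\<^bsub>M\<^esub> idt M X)"
        by (simp add: m_def flip: w(2))
          (simp add: M.cmp_ext[OF interchange'] M.cmp_ext[OF aassoc_nat])
      have "m \<cdot>\<^bsub>M\<^esub> z = (idt C N \<unrhd>\<^bsub>M\<^esub> \<epsilon> X) \<cdot>\<^bsub>M\<^esub> (idt C N \<unrhd>\<^bsub>M\<^esub> idt C A \<unrhd>\<^bsub>M\<^esub> \<epsilon> X) \<cdot>\<^bsub>M\<^esub> (idt C N \<unrhd>\<^bsub>M\<^esub> aassoc M A A X)
          \<cdot>\<^bsub>M\<^esub> aassoc M N (A \<otimes> A) X \<cdot>\<^bsub>M\<^esub> (tassoc C N A A \<unrhd>\<^bsub>M\<^esub> idt M X) \<cdot>\<^bsub>M\<^esub> (w \<unrhd>\<^bsub>M\<^esub> idt M X)"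
        using M.cmp_ext[OF action_pentagon[of N A A X, symmetric], of "w \<unrhd>\<^bsub>M\<^esub> idt M X"]
        by (simp add: m_def M.cmp_ext[OF aassoc_nat_idt] flip: w(2))
      also have "\<dots> = (idt C N \<unrhd>\<^bsub>M\<^esub> (\<epsilon> X \<cdot>\<^bsub>M\<^esub> (\<rho> X \<unrhd>\<^bsub>M\<^esub> idt M X))) \<cdot>\<^bsub>M\<^esub> aassoc M N (A \<otimes> A) X
          \<cdot>\<^bsub>M\<^esub> (tassoc C N A A \<unrhd>\<^bsub>M\<^esub> idt M X) \<cdot>\<^bsub>M\<^esub> (w \<unrhd>\<^bsub>M\<^esub> idt M X)"
        by (simp add: counit_rho)
      also have "\<dots> = m \<cdot>\<^bsub>M\<^esub> (?w2 \<unrhd>\<^bsub>M\<^esub> idt M X)"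
        by (simp add: m_def M.cmp_ext[OF aassoc_nat])
      finally have 2: "m \<cdot>\<^bsub>M\<^esub> z = m \<cdot>\<^bsub>M\<^esub> (?w2 \<unrhd>\<^bsub>M\<^esub> idt M X)" .
      have "m \<cdot>\<^bsub>M\<^esub> (?y \<unrhd>\<^bsub>M\<^esub> idt M X) = (idt C N \<unrhd>\<^bsub>M\<^esub> (\<epsilon> X \<cdot>\<^bsub>M\<^esub> (alg_unit Alg \<unrhd>\<^bsub>M\<^esub> idt M X)))
          \<cdot>\<^bsub>M\<^esub> aassoc M N (tone C) X \<cdot>\<^bsub>M\<^esub> (inv_arr C (trunit C N) \<unrhd>\<^bsub>M\<^esub> idt M X) \<cdot>\<^bsub>M\<^esub> (y \<unrhd>\<^bsub>M\<^esub> idt M X)"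
        by (simp add: m_def M.cmp_ext[OF aassoc_nat])
      also have "\<dots> = (trunit C N \<unrhd>\<^bsub>M\<^esub> idt M X) \<cdot>\<^bsub>M\<^esub> (inv_arr C (trunit C N) \<unrhd>\<^bsub>M\<^esub> idt M X) \<cdot>\<^bsub>M\<^esub> (y \<unrhd>\<^bsub>M\<^esub> idt M X)"
        by (simp only: counit_alg_unit) (simp add: M.cmp_ext[OF action_triangle])
      also have "\<dots> = y \<unrhd>\<^bsub>M\<^esub> idt M X"
        by (simp add: aarr_cmp_merge del: aarr_whisker)
      finally have 3: "m \<cdot>\<^bsub>M\<^esub> (?y \<unrhd>\<^bsub>M\<^esub> idt M X) = y \<unrhd>\<^bsub>M\<^esub> idt M X" .
      have "m \<cdot>\<^bsub>M\<^esub> (?y \<unrhd>\<^bsub>M\<^esub> idt M X) = m \<cdot>\<^bsub>M\<^esub> ((?w1 \<oplus> vscale C (-1) ?w2) \<unrhd>\<^bsub>M\<^esub> idt M X)"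
      proof -
        have "m \<cdot>\<^bsub>M\<^esub> (?y \<unrhd>\<^bsub>M\<^esub> idt M X) = d \<cdot>\<^bsub>M\<^esub> z" by (simp only: 3 z)
        also have "\<dots> = (r \<unrhd>\<^bsub>M\<^esub> idt M X) \<cdot>\<^bsub>M\<^esub> z \<oplus>\<^bsub>M\<^esub> vscale M (-1) (m \<cdot>\<^bsub>M\<^esub> z)"
          by (simp add: d_def M.cmp_vadd M.cmp_vscale)
        also have "\<dots> = m \<cdot>\<^bsub>M\<^esub> (?w1 \<unrhd>\<^bsub>M\<^esub> idt M X) \<oplus>\<^bsub>M\<^esub> vscale M (-1) (m \<cdot>\<^bsub>M\<^esub> (?w2 \<unrhd>\<^bsub>M\<^esub> idt M X))"
          by (simp only: 1 2)
        also have "\<dots> = m \<cdot>\<^bsub>M\<^esub> ((?w1 \<unrhd>\<^bsub>M\<^esub> idt M X) \<oplus>\<^bsub>M\<^esub> vscale M (-1) (?w2 \<unrhd>\<^bsub>M\<^esub> idt M X))"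
          by (simp add: M.cmp_vadd M.cmp_vscale del: aarr_whisker)
        also have "\<dots> = m \<cdot>\<^bsub>M\<^esub> ((?w1 \<oplus> vscale C (-1) ?w2) \<unrhd>\<^bsub>M\<^esub> idt M X)"
          using aarr_add_left[of ?w1 P "N \<otimes> A" "vscale C (-1) ?w2" "idt M X" X X]
            aarr_scale_left[of ?w2 P "N \<otimes> A" "idt M X" X X "-1"]
          by (simp add: in_hom_iff del: aarr_whisker)
        finally show ?thesis .
      qed
      \<comment> \<open>The bijection at \<open>V = N\<close> removes \<open>m\<close>, so the
        equation descends from \<open>M\<close> to \<open>C\<close>.\<close>
      then have yw: "?y = ?w1 \<oplus> vscale C (-1) ?w2"
        unfolding m_def by (intro counit_mono_on_free[of N X]) simp_all
      \<comment> \<open>Applying \<open>r\<close> recovers \<open>y\<close> from \<open>?y\<close>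
        by the unit law, while associativity of \<open>r\<close> identifies the images of
        \<open>?w1\<close> and \<open>?w2\<close>.\<close>
      have "y = (r \<cdot> (idt C N \<boxtimes> alg_unit Alg)) \<cdot> inv_arr C (trunit C N) \<cdot> y"
        by (simp add: r_unit)
      also have "\<dots> = r \<cdot> ?y" by simp
      also have "\<dots> = (r \<cdot> (r \<boxtimes> idt C A)) \<cdot> w \<oplus> vscale C (-1) ((r \<cdot> (idt C N \<boxtimes> \<rho> X) \<cdot> tassoc C N A A) \<cdot> w)"
        unfolding yw by (simp add: C.cmp_vadd C.cmp_vscale)
      also have "\<dots> = vzero C P N"
        unfolding r_assoc by (rule C.vadd_neg) (simp add: in_hom_iff)
      finally show ?thesis .
    qed
    fix Z x x' assume "x \<in> hom C Z (src C h)" "x' \<in> hom C Z (src C h)" and eq: "h \<cdot> x = h \<cdot> x'"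
    then have [simp]: "x \<in> arr C" "x' \<in> arr C" "src C x = Z" "src C x' = Z" "trg C x = N" "trg C x' = N"
      "Z \<in> obj C" by (auto simp: hom_def)
    obtain P p where P: "projective C P" "p \<in> hom C P Z" "epi C p"
      by (rule enough_projectivesD[OF enough_C \<open>Z \<in> obj C\<close>])
    have [simp]: "p \<in> arr C" "src C p = P" "trg C p = Z" "P \<in> obj C" using P by (auto simp: hom_def)
    let ?y = "x \<cdot> p \<oplus> vscale C (-1) (x' \<cdot> p)"
    have "h \<cdot> ?y = h \<cdot> x \<cdot> p \<oplus> vscale C (-1) (h \<cdot> x' \<cdot> p)"
      by (simp add: C.cmp_vadd C.cmp_vscale)
    also have "\<dots> = vzero C P (fobj R L)"
      unfolding C.cmp_ext[OF eq, simplified, of p] C.vadd_neg_eq_zero_iff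
      by (subst C.vadd_neg_eq_zero_iff) (simp_all add: in_hom_iff C.cmp_ext[OF eq])
    finally have "?y = vzero C P N"
      by (intro zero[OF P(1)]) (simp_all add: in_hom_iff)
    then have "x \<cdot> p = x' \<cdot> p"
      using C.vadd_neg_eq_zero_iff[of "x \<cdot> p" P N "x' \<cdot> p"] by (simp add: in_hom_iff)
    then show "x = x'" by (rule C.epi_cancel[OF P(3)]) simp_all
  qed simp
  ultimately have iso: "iso C h" by (intro C.mono_epi_iso)
  interpret S: module_structure C "{X. right_module C Alg X}"
   "\<lambda>X Y f. f \<cdot> snd X = snd Y \<cdot> (f \<boxtimes> idt C A)"
   "\<lambda>V X. (idt C V \<boxtimes> snd X) \<cdot> tassoc C V (fst X) A"
    by (rule Mods_structure)
  have inv_map: "inv_arr C h \<cdot> \<rho> L = r \<cdot> (inv_arr C h \<boxtimes> idt C A)"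
    using S.H_inv[of "(N, r)" "(fobj R L, \<rho> L)" h] mod rho_module[of L] iso h_map by (simp add: in_hom_iff)
  have "(fobj K L, inv_arr C h, Y) \<in> hom Mods (fobj K L) Y" "iso Mods (fobj K L, inv_arr C h, Y)"
    unfolding Mods_hom_iff
    using mod rho_module[of L] iso inv_map Y
    by (auto simp: in_hom_iff intro!: Mods_iso)
  then show "\<exists>L \<in> obj M. \<exists>e \<in> hom Mods (fobj K L) Y. iso Mods e"
    by (intro bexI[of _ L] bexI[of _ "(fobj K L, inv_arr C h, Y)"]) simp_all
qed

end

section \<open>Opposite categories\<close>

text \<open>A relation that concerns the linear structure alone, so that one set of transfer lemmas
  serves both \<open>op_mon\<close> and \<open>op_mod\<close>, whose further fields differ.\<close>

definition opposite :: "('k, 'o, 'a, 'n) lincat_scheme \<Rightarrow> ('k, 'o, 'a, 'm) lincat_scheme \<Rightarrow> bool" where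
  "opposite D C \<longleftrightarrow> obj D = obj C \<and> arr D = arr C \<and> src D = trg C \<and> trg D = src C \<and> idt D = idt C \<and>
     cmp D = (\<lambda>g f. cmp C f g) \<and> vadd D = vadd C \<and> vzero D = (\<lambda>A B. vzero C B A) \<and>
     vscale D = vscale C"

lemma opposite_simps:
  assumes "opposite D C"
  shows "obj D = obj C" "arr D = arr C" "src D = trg C" "trg D = src C" "idt D = idt C"
    "cmp D g f = cmp C f g" "vadd D = vadd C" "vzero D Y Z = vzero C Z Y" "vscale D = vscale C"
  using assms by (simp_all add: opposite_def)

lemma opposite_hom: assumes "opposite D C" shows "hom D Y Z = hom C Z Y"
  by (auto simp: hom_def opposite_simps[OF assms])

lemma opposite_iso:
  assumes "opposite D C"
  shows "inverse_arrows D = inverse_arrows C" "iso D = iso C" "inv_arr D = inv_arr C"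
proof -
  show 1: "inverse_arrows D = inverse_arrows C"
    by (intro ext) (auto simp: inverse_arrows_def opposite_simps[OF assms] opposite_hom[OF assms])
  show "iso D = iso C" "inv_arr D = inv_arr C"
    by (intro ext, simp add: iso_def inv_arr_def 1)+
qed

lemma opposite_mono_epi:
  assumes "opposite D C" shows "mono D = epi C" "epi D = mono C"
  by (intro ext, simp add: mono_def epi_def opposite_simps[OF assms] opposite_hom[OF assms])+

lemma opposite_projective:
  assumes "opposite D C"
  shows "projective D = injective C" "enough_projectives D = enough_injectives C"
proof -
  show 1: "projective D = injective C"
    by (intro ext) (simp add: projective_def injective_def opposite_mono_epi[OF assms]
      opposite_simps[OF assms] opposite_hom[OF assms])
  show "enough_projectives D = enough_injectives C"
    by (simp add: enough_projectives_def enough_injectives_def 1 opposite_mono_epi[OF assms]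
      opposite_simps[OF assms] opposite_hom[OF assms])
qed

lemma opposite_biproduct:
  assumes "opposite D C" shows "biproduct D Y Z S i j p q \<longleftrightarrow> biproduct C Y Z S p q i j"
  unfolding biproduct_def opposite_simps[OF assms] opposite_hom[OF assms] by blast

lemma opposite_direct_summand:
  assumes "opposite D C" shows "direct_summand D Y S \<longleftrightarrow> direct_summand C Y S"
  unfolding direct_summand_def opposite_simps[OF assms] opposite_biproduct[OF assms] by blast

lemma opposite_kernel:
  assumes "opposite D C" shows "is_kernel D = is_cokernel C" "is_cokernel D = is_kernel C"
  by (intro ext, simp add: is_kernel_def is_cokernel_def opposite_simps[OF assms] opposite_hom[OF assms])+

lemma opposite_linear:
  assumes op: "opposite D C" and "linear_category C" shows "linear_category D"
proof -
  interpret C: linear_category C by fact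
  show ?thesis
    by (unfold_locales; unfold opposite_simps[OF op] opposite_hom[OF op])
      (auto intro: C.idt_hom C.cmp_hom C.vadd_hom C.vzero_hom C.vscale_hom C.vadd_assoc C.vadd_commute
        C.vzero_add C.vscale_add_right C.vscale_add_left C.vscale_vscale C.vscale_one C.cmp_add_left
        C.cmp_add_right C.cmp_scale_left C.cmp_scale_right C.idt_cmp C.cmp_idt
        C.cmp_assoc[symmetric] dest: C.vadd_inverse)
qed

lemma opposite_abelian:
  assumes op: "opposite D C" and "abelian_category C" shows "abelian_category D"
proof -
  interpret C: abelian_category C by fact
  interpret D: linear_category D by (rule opposite_linear[OF op C.linear_category_axioms])
  show ?thesis
  proof
    show "\<exists>Z. zero_object D Z"
    proof -
      obtain Z where "zero_object C Z" using C.ex_zero_object by blast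
      then have "zero_object D Z"
        by (simp add: zero_object_def opposite_simps[OF op] opposite_hom[OF op])
      then show ?thesis by blast
    qed
    show "\<exists>S \<in> obj D. \<exists>i j p q. biproduct D Y Z S i j p q" if "Y \<in> obj D" "Z \<in> obj D" for Y Z
      using C.ex_biproduct[of Y Z] that
      unfolding opposite_simps[OF op] opposite_biproduct[OF op] by blast
  qed (simp_all add: opposite_simps[OF op] opposite_kernel[OF op] opposite_mono_epi[OF op]
    C.ex_kernel C.ex_cokernel C.mono_is_kernel C.epi_is_cokernel)
qed

lemma opposite_linear_functor:
  assumes A: "opposite A' A" and B: "opposite B' B" and "linear_functor A B F"
  shows "linear_functor A' B' F"
proof -
  interpret F: linear_functor A B F by fact
  show ?thesis
    by (intro linear_functor.intro linear_functor_axioms.intro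
      opposite_linear[OF A F.A.linear_category_axioms] opposite_linear[OF B F.B.linear_category_axioms];
      unfold opposite_simps[OF A] opposite_simps[OF B] opposite_hom[OF A] opposite_hom[OF B])
      (auto intro: F.farr_hom F.farr_idt F.farr_cmp F.farr_add F.farr_scale)
qed

lemma opposite_natural:
  assumes A: "opposite A' A" and B: "opposite B' B"
  shows "natural_transformation A' B' F G t \<longleftrightarrow> natural_transformation A B G F t"
  unfolding natural_transformation_def opposite_simps[OF A] opposite_simps[OF B]
    opposite_hom[OF A] opposite_hom[OF B] by (auto dest: sym)

lemma opposite_adjunction:
  assumes A: "opposite A' A" and B: "opposite B' B" and "adjunction A B F G \<eta> \<epsilon>"
  shows "adjunction B' A' G F \<epsilon> \<eta>"
proof -
  interpret F: adjunction A B F G \<eta> \<epsilon> by fact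
  show ?thesis
    by (intro adjunction.intro adjunction_axioms.intro opposite_linear_functor[OF A B]
        opposite_linear_functor[OF B A] F.F.linear_functor_axioms F.G.linear_functor_axioms;
      unfold opposite_simps[OF A] opposite_simps[OF B] opposite_natural[OF A A] opposite_natural[OF B B])
      (auto intro: F.unit_natural F.counit_natural F.triangle_left F.triangle_right)
qed

section \<open>Opposites of monoidal and module categories\<close>

definition op_lin :: "('k, 'o, 'a, 'm) lincat_scheme \<Rightarrow> ('k, 'o, 'a, 'm) lincat_scheme" where
  "op_lin C = C\<lparr>src := trg C, trg := src C, cmp := \<lambda>g f. cmp C f g, vzero := \<lambda>Y Z. vzero C Z Y\<rparr>"

text \<open>The order of the tensor product is kept, so left actions stay left actions and right
  modules become right comodules. The constraints are inverted to have the direction required after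
  reversal.\<close>

definition op_mon :: "('k, 'o, 'a, 'm) moncat_scheme \<Rightarrow> ('k, 'o, 'a, 'm) moncat_scheme" where
  "op_mon C = (op_lin C)\<lparr>tassoc := \<lambda>U V W. inv_arr C (tassoc C U V W),
     tlunit := \<lambda>V. inv_arr C (tlunit C V), trunit := \<lambda>V. inv_arr C (trunit C V)\<rparr>"

definition op_mod :: "('k, 'o, 'a, 'p, 'b, 'n) modcat_scheme \<Rightarrow> ('k, 'o, 'a, 'p, 'b, 'n) modcat_scheme" where
  "op_mod M = (op_lin M)\<lparr>aassoc := \<lambda>V W N. inv_arr M (aassoc M V W N),
     aunit := \<lambda>N. inv_arr M (aunit M N)\<rparr>"

lemma opposite_op_mon: "opposite (op_mon C) C"
  by (simp add: opposite_def op_mon_def op_lin_def)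

lemma opposite_op_mod: "opposite (op_mod M) M"
  by (simp add: opposite_def op_mod_def op_lin_def)

lemmas op_mon_simps [simp] = opposite_simps [OF opposite_op_mon] opposite_hom [OF opposite_op_mon]
  opposite_iso [OF opposite_op_mon]

lemmas op_mod_simps [simp] = opposite_simps [OF opposite_op_mod] opposite_hom [OF opposite_op_mod]
  opposite_iso [OF opposite_op_mod]

lemma op_mon_tensor [simp]:
  "tobj (op_mon C) = tobj C" "tarr (op_mon C) = tarr C" "tone (op_mon C) = tone C"
  "tassoc (op_mon C) U V W = inv_arr C (tassoc C U V W)"
  "tlunit (op_mon C) V = inv_arr C (tlunit C V)" "trunit (op_mon C) V = inv_arr C (trunit C V)"
  by (simp_all add: op_mon_def op_lin_def)

lemma op_mod_action [simp]:
  "aobj (op_mod M) = aobj M" "aarr (op_mod M) = aarr M"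
  "aassoc (op_mod M) V W N = inv_arr M (aassoc M V W N)" "aunit (op_mod M) N = inv_arr M (aunit M N)"
  by (simp_all add: op_mod_def op_lin_def)

lemma (in category) inv_arr_of_cmp:
  "\<lbrakk>iso C f; iso C g; src C g = trg C f\<rbrakk> \<Longrightarrow> inv_arr C (g \<cdot> f) = inv_arr C f \<cdot> inv_arr C g"
  by (rule inv_arr_eqI[OF inverse_arrows_cmp])

text \<open>Taking inverses on both sides of the pentagon and the triangle reverses the order of the
  factors, exactly as the opposite composition demands.\<close>

lemma (in module_category) opposite_module_axioms:
  assumes "monoidal_category (op_mon C)"
  shows "module_category (op_mon C) (op_mod M)"
proof (intro module_category.intro assms opposite_linear[OF opposite_op_mod M.linear_category_axioms]
    module_category_axioms.intro, unfold op_mon_simps op_mod_simps op_mon_tensor op_mod_action)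
  show "inv_arr M (aassoc M V W N) \<in> hom M (V \<rhd>\<^bsub>M\<^esub> W \<rhd>\<^bsub>M\<^esub> N) ((V \<otimes>\<^bsub>C\<^esub> W) \<rhd>\<^bsub>M\<^esub> N)" "iso M (inv_arr M (aassoc M V W N))"
    if "V \<in> obj C" "W \<in> obj C" "N \<in> obj M" for V W N
    using that by (simp_all add: in_hom_iff)
  show "inv_arr M (aunit M N) \<in> hom M N (tone C \<rhd>\<^bsub>M\<^esub> N)" "iso M (inv_arr M (aunit M N))"
    if "N \<in> obj M" for N
    using that by (simp_all add: in_hom_iff)
  show "((f \<boxtimes>\<^bsub>C\<^esub> f') \<unrhd>\<^bsub>M\<^esub> g) \<cdot>\<^bsub>M\<^esub> inv_arr M (aassoc M V' W' N') = inv_arr M (aassoc M V W N) \<cdot>\<^bsub>M\<^esub> (f \<unrhd>\<^bsub>M\<^esub> f' \<unrhd>\<^bsub>M\<^esub> g)"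
    if "f \<in> hom C V' V" "f' \<in> hom C W' W" "g \<in> hom M N' N" for f V V' f' W W' g N N'
  proof -
    have [simp]: "f \<in> arr C" "f' \<in> arr C" "g \<in> arr M" "src C f = V'" "trg C f = V" "src C f' = W'"
      "trg C f' = W" "src M g = N'" "trg M g = N" "V \<in> obj C" "V' \<in> obj C" "W \<in> obj C" "W' \<in> obj C"
      "N \<in> obj M" "N' \<in> obj M"
      using that by (auto simp: hom_def)
    show ?thesis
      by (rule M.inv_arr_natural[symmetric]) (simp_all add: aassoc_nat)
  qed
  show "(idt C (tone C) \<unrhd>\<^bsub>M\<^esub> g) \<cdot>\<^bsub>M\<^esub> inv_arr M (aunit M N') = inv_arr M (aunit M N) \<cdot>\<^bsub>M\<^esub> g"
    if "g \<in> hom M N' N" for g N N'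
  proof -
    have [simp]: "g \<in> arr M" "src M g = N'" "trg M g = N" "N \<in> obj M" "N' \<in> obj M"
      using that by (auto simp: hom_def)
    show ?thesis
      by (rule M.inv_arr_natural[symmetric]) (simp_all add: aunit_nat)
  qed
  show "((inv_arr C (tassoc C U V W) \<unrhd>\<^bsub>M\<^esub> idt M N) \<cdot>\<^bsub>M\<^esub> inv_arr M (aassoc M U (V \<otimes>\<^bsub>C\<^esub> W) N))
      \<cdot>\<^bsub>M\<^esub> (idt C U \<unrhd>\<^bsub>M\<^esub> inv_arr M (aassoc M V W N))
    = inv_arr M (aassoc M (U \<otimes>\<^bsub>C\<^esub> V) W N) \<cdot>\<^bsub>M\<^esub> inv_arr M (aassoc M U V (W \<rhd>\<^bsub>M\<^esub> N))"
    if [simp]: "U \<in> obj C" "V \<in> obj C" "W \<in> obj C" "N \<in> obj M" for U V W N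
    using arg_cong[OF action_pentagon[OF that], of "inv_arr M"]
    by (simp add: M.inv_arr_of_cmp C.iso_idt M.iso_idt)
  show "inv_arr M (aassoc M V (tone C) N) \<cdot>\<^bsub>M\<^esub> (idt C V \<unrhd>\<^bsub>M\<^esub> inv_arr M (aunit M N))
    = inv_arr C (trunit C V) \<unrhd>\<^bsub>M\<^esub> idt M N"
    if [simp]: "V \<in> obj C" "N \<in> obj M" for V N
    using arg_cong[OF action_triangle[OF that], of "inv_arr M"]
    by (simp add: M.inv_arr_of_cmp C.iso_idt M.iso_idt)
qed (auto intro: aarr_hom aarr_cmp aarr_add_left aarr_add_right aarr_scale_left aarr_scale_right)

lemma (in monoidal_category) opposite_monoidal: "monoidal_category (op_mon C)"
proof (intro monoidal_category.intro opposite_linear[OF opposite_op_mon linear_category_axioms]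
    monoidal_category_axioms.intro, unfold op_mon_simps op_mon_tensor)
  show "inv_arr C (tassoc C U V W) \<in> hom C (U \<otimes> (V \<otimes> W)) (U \<otimes> V \<otimes> W)" "iso C (inv_arr C (tassoc C U V W))"
    if "U \<in> obj C" "V \<in> obj C" "W \<in> obj C" for U V W
    using that by (simp_all add: in_hom_iff)
  show "inv_arr C (tlunit C V) \<in> hom C V (tone C \<otimes> V)" "iso C (inv_arr C (tlunit C V))"
    "inv_arr C (trunit C V) \<in> hom C V (V \<otimes> tone C)" "iso C (inv_arr C (trunit C V))"
    if "V \<in> obj C" for V
    using that by (simp_all add: in_hom_iff)
  show "((f \<boxtimes> g) \<boxtimes> h) \<cdot> inv_arr C (tassoc C U' V' W') = inv_arr C (tassoc C U V W) \<cdot> (f \<boxtimes> (g \<boxtimes> h))"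
    if "f \<in> hom C U' U" "g \<in> hom C V' V" "h \<in> hom C W' W" for f U U' g V V' h W W'
  proof -
    have [simp]: "f \<in> arr C" "g \<in> arr C" "h \<in> arr C" "src C f = U'" "trg C f = U" "src C g = V'"
      "trg C g = V" "src C h = W'" "trg C h = W" "U \<in> obj C" "U' \<in> obj C" "V \<in> obj C" "V' \<in> obj C"
      "W \<in> obj C" "W' \<in> obj C"
      using that by (auto simp: hom_def)
    show ?thesis
      by (rule inv_arr_natural[symmetric]) (simp_all add: tassoc_nat)
  qed
  show "(idt C (tone C) \<boxtimes> f) \<cdot> inv_arr C (tlunit C W) = inv_arr C (tlunit C V) \<cdot> f"
    "(f \<boxtimes> idt C (tone C)) \<cdot> inv_arr C (trunit C W) = inv_arr C (trunit C V) \<cdot> f"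
    if "f \<in> hom C W V" for f V W
  proof -
    have [simp]: "f \<in> arr C" "src C f = W" "trg C f = V" "V \<in> obj C" "W \<in> obj C"
      using that by (auto simp: hom_def)
    show "(idt C (tone C) \<boxtimes> f) \<cdot> inv_arr C (tlunit C W) = inv_arr C (tlunit C V) \<cdot> f"
      "(f \<boxtimes> idt C (tone C)) \<cdot> inv_arr C (trunit C W) = inv_arr C (trunit C V) \<cdot> f"
      by (rule inv_arr_natural[symmetric]; simp add: tlunit_nat trunit_nat)+
  qed
  show "((inv_arr C (tassoc C U V W) \<boxtimes> idt C Z) \<cdot> inv_arr C (tassoc C U (V \<otimes> W) Z))
      \<cdot> (idt C U \<boxtimes> inv_arr C (tassoc C V W Z))
    = inv_arr C (tassoc C (U \<otimes> V) W Z) \<cdot> inv_arr C (tassoc C U V (W \<otimes> Z))"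
    if [simp]: "U \<in> obj C" "V \<in> obj C" "W \<in> obj C" "Z \<in> obj C" for U V W Z
    using arg_cong[OF pentagon[OF that], of "inv_arr C"]
    by (simp add: inv_arr_of_cmp iso_idt)
  show "inv_arr C (tassoc C V (tone C) W) \<cdot> (idt C V \<boxtimes> inv_arr C (tlunit C W))
    = inv_arr C (trunit C V) \<boxtimes> idt C W"
    if [simp]: "V \<in> obj C" "W \<in> obj C" for V W
    using arg_cong[OF triangle[OF that], of "inv_arr C"]
    by (simp add: inv_arr_of_cmp iso_idt)
qed (auto intro: tarr_hom tarr_cmp tarr_add_left tarr_add_right tarr_scale_left tarr_scale_right)

lemma (in module_category) opposite_module: "module_category (op_mon C) (op_mod M)"
  by (rule opposite_module_axioms[OF C.opposite_monoidal])

text \<open>Reversed, each zigzag identity becomes the other one. Left duals thereby become right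
  duals, which is why rigidity passes to the opposite.\<close>

lemma (in monoidal_category) opposite_dual_pair:
  assumes "dual_pair C Y X ev coev" shows "dual_pair (op_mon C) X Y coev ev"
proof -
  have [simp]: "X \<in> obj C" "Y \<in> obj C" "ev \<in> arr C" "src C ev = Y \<otimes> X" "trg C ev = tone C"
    "coev \<in> arr C" "src C coev = tone C" "trg C coev = X \<otimes> Y"
    using assms by (auto simp: dual_pair_def hom_def)
  show ?thesis
    using assms unfolding dual_pair_def by (simp add: in_hom_iff)
qed

lemma (in rigid_category) opposite_rigid: "rigid_category (op_mon C)"
proof (intro rigid_category.intro opposite_monoidal rigid_category_axioms.intro)
  fix X assume "X \<in> obj (op_mon C)"
  then have "X \<in> obj C" by simp
  then show "\<exists>Y ev coev. dual_pair (op_mon C) Y X ev coev" "\<exists>Y ev coev. dual_pair (op_mon C) X Y ev coev"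
    using ex_right_dual[of X] ex_left_dual[of X] opposite_dual_pair by blast+
qed

theorem (in projective_generator) reconstruction:
  "module_equivalent C M (mod_cat C (end_algebra C M X R \<eta> \<epsilon>))"
  unfolding module_equivalent_def
  using K_module_functor linear_functor.equivalence[OF K_linear K_fully_faithful K_essentially_surjective]
  unfolding Mods_def Alg_def by blast

section \<open>Coalgebras as algebras in the opposite category\<close>

text \<open>Comodule laws are written with the constraints, module laws in the opposite category
  with their inverses. Moving an isomorphism across the equation matches them.\<close>

lemma (in category) iso_move:
  assumes "iso C a" "x \<in> arr C" "y \<in> arr C" "trg C x = src C a" "trg C y = trg C a"
  shows "x = inv_arr C a \<cdot> y \<longleftrightarrow> a \<cdot> x = y"
proof
  show "a \<cdot> x = y" if "x = inv_arr C a \<cdot> y" unfolding that using assms by simp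
  show "x = inv_arr C a \<cdot> y" if "a \<cdot> x = y" unfolding that[symmetric] using assms iso_arr[OF assms(1)] by simp
qed

lemma (in category) eq_inv_arr_iff:
  assumes "iso C a" "x \<in> arr C" "trg C x = src C a" "src C x = trg C a"
  shows "x = inv_arr C a \<longleftrightarrow> a \<cdot> x = idt C (trg C a)"
  using iso_move[of a x "idt C (trg C a)"] assms iso_arr[OF assms(1)] by simp

text \<open>Arrows change direction, hence the swapped arguments of \<open>H\<close>. The
  constraints of the opposite are inverses of those of \<open>C\<close>, and \<open>H_inv\<close>
  carries compatibility from one to the other.\<close>

lemma (in monoidal_category) opposite_structure:
  assumes "module_structure (op_mon C) S H act"
  shows "module_structure C S (\<lambda>X Y. H Y X) act"
proof -
  interpret op: module_structure "op_mon C" S H act by fact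
  note S_obj = op.S_obj[simplified op_mon_simps] and act_S = op.act_S[simplified op_mon_simps op_mon_tensor]
  show ?thesis
  proof
    fix X Y Z f g and c :: 'k and V V' W v
    assume X: "X \<in> S"
    note [simp] = S_obj[OF X]
    show "fst X \<in> obj C" "H X X (idt C (fst X))"
      using op.H_idt[OF X] by simp_all
    show "(V \<otimes> fst X, act V X) \<in> S" if "V \<in> obj C" using act_S[OF that X] .
    show "H X (tone C \<otimes> fst X, act (tone C) X) (tlunit C (fst X))"
      using op.H_inv[OF _ _ _ _ op.H_unit[OF X]] act_S[OF tone_obj X] X by (simp add: in_hom_iff)
    show "H (V \<otimes> (W \<otimes> fst X), act V (W \<otimes> fst X, act W X)) (V \<otimes> W \<otimes> fst X, act (V \<otimes> W) X) (tassoc C V W (fst X))"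
      if VW: "V \<in> obj C" "W \<in> obj C"
      using op.H_inv[OF _ _ _ _ op.H_assoc[OF _ _ X, of V W]] VW act_S[OF tobj_obj[OF VW] X]
        act_S[OF VW(1) act_S[OF VW(2) X]]
      by (simp add: in_hom_iff)
    assume Y: "Y \<in> S"
    show "H Y X (vzero C (fst X) (fst Y))" using op.H_vzero[OF Y X] by simp
    assume f: "f \<in> hom C (fst X) (fst Y)" and Hf: "H Y X f"
    show "H Y X (vscale C c f)" using op.H_vscale[OF Y X _ Hf] f by simp
    show "H X Y (inv_arr C f)" if "iso C f" using op.H_inv[OF Y X _ _ Hf] f that by simp
    show "H (V' \<otimes> fst Y, act V' Y) (V \<otimes> fst X, act V X) (v \<boxtimes> f)" if "v \<in> hom C V V'"
      using op.H_act[of v V' V Y X f] X Y f Hf that by simp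
    show "H Y X (f \<oplus> g)" if "g \<in> hom C (fst X) (fst Y)" "H Y X g"
      using op.H_vadd[OF Y X _ _ Hf that(2)] f that by simp
    assume Z: "Z \<in> S"
    show "H Z X (g \<cdot> f)" if "g \<in> hom C (fst Y) (fst Z)" "H Z Y g"
      using op.H_cmp[OF Z Y X _ _ that(2) Hf] f that by simp
  qed
qed

text \<open>Algebras and coalgebras are different record types; the locale records that the fields
  of \<open>Q'\<close> are those of an algebra in the opposite category.\<close>

locale coalgebra_in = monoidal_category C
  for C :: "('k::field, 'o, 'a, 'm) moncat_scheme" (structure) +
  fixes Q :: "('o, 'a) algebra" and Q' :: "('o, 'a) coalgebra"
  assumes algebra_op: "algebra_object (op_mon C) Q"
    and Q': "coalg_obj Q' = alg_obj Q" "coalg_comult Q' = alg_mult Q" "coalg_counit Q' = alg_unit Q"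
begin

lemma co_simps [simp]:
  "alg_obj Q \<in> obj C" "alg_mult Q \<in> arr C" "src C (alg_mult Q) = alg_obj Q"
  "trg C (alg_mult Q) = alg_obj Q \<otimes> alg_obj Q" "alg_unit Q \<in> arr C" "src C (alg_unit Q) = alg_obj Q"
  "trg C (alg_unit Q) = tone C"
  using algebra_op by (auto simp: algebra_object_def Let_def in_hom_iff)

lemma coalgebra: "coalgebra_object C Q'"
  using algebra_op
  by (simp add: algebra_object_def coalgebra_object_def Let_def Q' in_hom_iff iso_move eq_inv_arr_iff)

lemma right_comodule_iff: "right_comodule C Q' Y \<longleftrightarrow> right_module (op_mon C) Q Y"
  by (auto simp: right_module_def right_comodule_def Let_def Q' in_hom_iff iso_move eq_inv_arr_iff)

text \<open>The right side is phrased with the operations of the opposite, in the shape that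
  \<open>opposite_structure\<close> produces from the category of modules there.\<close>

lemma comod_cat_eq: "comod_cat C Q' = structured_modcat C {Y. right_module (op_mon C) Q Y}
   (\<lambda>X Y f. cmp (op_mon C) f (snd Y) = cmp (op_mon C) (snd X) (tarr (op_mon C) f (idt (op_mon C) (alg_obj Q))))
   (\<lambda>V X. cmp (op_mon C) (tarr (op_mon C) (idt (op_mon C) V) (snd X)) (tassoc (op_mon C) V (fst X) (alg_obj Q)))"
  by (simp add: comod_cat_def right_comodule_iff Q')

end

section \<open>Reconstruction from injective objects\<close>

locale injective_generator = module_category C M + C: rigid_category C + C: abelian_category C
    + M: abelian_category M
  for C :: "('k::field, 'o, 'a, 'm) moncat_scheme" (structure)
    and M :: "('k, 'o, 'a, 'p, 'b, 'n) modcat_scheme" +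
  fixes X :: 'p and L :: "('p, 'b, 'o, 'a) functr" and \<eta> :: "'p \<Rightarrow> 'b" and \<epsilon> :: "'o \<Rightarrow> 'a"
  assumes X_obj: "X \<in> obj M" and adj: "adjunction M C L (act_on M X) \<eta> \<epsilon>"
    and enough: "enough_injectives C" "enough_injectives M"
    and act_injective: "injective C I \<Longrightarrow> injective M (I \<rhd>\<^bsub>M\<^esub> X)"
    and injective_summand: "injective M J \<Longrightarrow> \<exists>I. injective C I \<and> direct_summand M J (I \<rhd>\<^bsub>M\<^esub> X)"
begin

lemma opposite_generator: "projective_generator (op_mon C) (op_mod M) X L \<epsilon> \<eta>"
proof -
  have "act_on (op_mod M) X = act_on M X" by (simp add: act_on_def)
  then have "adjunction (op_mon C) (op_mod M) (act_on (op_mod M) X) L \<epsilon> \<eta>"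
    using opposite_adjunction[OF opposite_op_mod opposite_op_mon adj] by simp
  then show ?thesis
    using X_obj enough act_injective injective_summand
    by (intro projective_generator.intro action_adjunction.intro action_adjunction_axioms.intro
        projective_generator_axioms.intro opposite_module C.opposite_rigid
        opposite_abelian[OF opposite_op_mon C.abelian_category_axioms]
        opposite_abelian[OF opposite_op_mod M.abelian_category_axioms])
      (simp_all add: opposite_projective[OF opposite_op_mon] opposite_projective[OF opposite_op_mod]
        opposite_direct_summand[OF opposite_op_mod])
qed

sublocale op: projective_generator "op_mon C" "op_mod M" X L \<epsilon> \<eta>
  by (rule opposite_generator)

sublocale L: linear_functor M C L
  using adj by (simp add: adjunction_def)

abbreviation \<psi> :: "'o \<Rightarrow> 'p \<Rightarrow> 'a" where "\<psi> \<equiv> oplax_structure C M X L \<eta> \<epsilon>"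

text \<open>In the opposite categories the formula for the lax structure is literally that for the
  oplax structure, so all results on \<phi> hold for \<psi>.\<close>

lemma lax_opposite [simp]: "op.\<phi> V N = \<psi> V N"
  by (simp add: lax_structure_def oplax_structure_def)

lemma oplax_simps [simp]:
  assumes "V \<in> obj C" "N \<in> obj M"
  shows "\<psi> V N \<in> arr C" "src C (\<psi> V N) = fobj L (V \<rhd>\<^bsub>M\<^esub> N)" "trg C (\<psi> V N) = V \<otimes> fobj L N" "iso C (\<psi> V N)"
  using op.lax_simps[of V N] op.iso_lax[of V N] assms by simp_all

lemma unit_simps [simp]:
  assumes "N \<in> obj M"
  shows "\<eta> N \<in> arr M" "src M (\<eta> N) = N" "trg M (\<eta> N) = fobj L N \<rhd>\<^bsub>M\<^esub> X"
  using op.counit_simps[of N] assms by simp_all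

definition Coalg :: "('o, 'a) coalgebra" where "Coalg = coend_coalgebra C M X L \<eta> \<epsilon>"

lemma Coalg_simps:
  "coalg_obj Coalg = alg_obj op.Alg" "coalg_comult Coalg = alg_mult op.Alg"
  "coalg_counit Coalg = alg_unit op.Alg"
  using X_obj
  by (simp_all add: Coalg_def op.Alg_def coend_coalgebra_def end_algebra_def Let_def monad_mult_def
    monad_unit_def comonad_comult_def comonad_counit_def)

lemma Coalg_in: "coalgebra_in C op.Alg Coalg"
  by (intro coalgebra_in.intro coalgebra_in_axioms.intro C.monoidal_category_axioms op.Alg_algebra Coalg_simps)

section \<open>The comparison functor to comodules\<close>

definition Comods :: "('k, 'o, 'a, 'o \<times> 'a, ('o, 'a) sarr) modcat" where "Comods = comod_cat C Coalg"

lemmas Comods_eq = coalgebra_in.comod_cat_eq [OF Coalg_in, folded Comods_def, unfolded op.alg_obj]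

lemmas Comods_structure = C.opposite_structure [OF op.Mods_structure]

lemmas Comods_simps = module_structure.D_simps [OF Comods_structure, folded Comods_eq]
lemmas Comods_hom_iff = module_structure.D_hom_iff [OF Comods_structure, folded Comods_eq]
lemmas Comods_iso = module_structure.D_iso [OF Comods_structure, folded Comods_eq]
lemmas Comods_module = module_structure.D_module [OF Comods_structure, folded Comods_eq]

text \<open>The comparison functor of the opposite situation, with the triples rebuilt: arrows
  record their source and target, and these are exchanged when leaving the opposite.\<close>

definition J :: "('p, 'b, 'o \<times> 'a, ('o, 'a) sarr) functr" where
  "J = \<lparr>fobj = (\<lambda>N. (fobj L N, op.\<rho> N)),
     farr = (\<lambda>f. ((fobj L (src M f), op.\<rho> (src M f)), farr L f, (fobj L (trg M f), op.\<rho> (trg M f))))\<rparr>"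

lemma J_simps [simp]:
  "fobj J N = (fobj L N, op.\<rho> N)"
  "farr J f = ((fobj L (src M f), op.\<rho> (src M f)), farr L f, (fobj L (trg M f), op.\<rho> (trg M f)))"
  by (simp_all add: J_def)

text \<open>An oplax structure already points in the direction of a module functor, so \<psi>
  appears uninverted, in contrast to \<open>Kstr\<close>.\<close>

definition Jstr :: "'o \<Rightarrow> 'p \<Rightarrow> ('o, 'a) sarr" where
  "Jstr V N = ((fobj L (V \<rhd>\<^bsub>M\<^esub> N), op.\<rho> (V \<rhd>\<^bsub>M\<^esub> N)), \<psi> V N, aobj Comods V (fobj L N, op.\<rho> N))"

definition flip_arr :: "('o, 'a) sarr \<Rightarrow> ('o, 'a) sarr" where "flip_arr = (\<lambda>(Y, f, Z). (Z, f, Y))"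

lemma flip_arr_simps [simp]: "flip_arr (Y, f, Z) = (Z, f, Y)" "flip_arr (flip_arr t) = t"
  by (auto simp: flip_arr_def split: prod.split)

lemma Comods_hom: "t \<in> hom Comods Y Z \<longleftrightarrow> flip_arr t \<in> hom op.Mods Z Y"
  by (cases t) (auto simp: Comods_hom_iff op.Mods_hom_iff)

lemma Comods_iso_flip:
  assumes "iso op.Mods t" shows "iso Comods (flip_arr t)"
proof -
  obtain t' where "inverse_arrows op.Mods t t'" using assms by (auto simp: iso_def)
  then have "inverse_arrows Comods (flip_arr t) (flip_arr t')"
    by (cases t; cases t') (auto simp: inverse_arrows_def op.Mods_simps Comods_simps Comods_hom_iff op.Mods_hom_iff)
  then show ?thesis by (rule inverse_arrows_iso)
qed

lemma J_linear: "linear_functor M Comods J"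
proof -
  interpret N: module_category C Comods by (rule Comods_module)
  show ?thesis
  proof
    show "fobj J N \<in> obj Comods" if "N \<in> obj M" for N
      using that op.rho_module by (simp add: Comods_simps)
    show "farr J f \<in> hom Comods (fobj J N) (fobj J N')" if "f \<in> hom M N N'" for f N N'
      using that linear_functor.farr_hom[OF op.K_linear, of f N' N]
      by (auto simp: Comods_hom in_hom_iff[of f])
    show "farr J (idt M N) = idt Comods (fobj J N)" if "N \<in> obj M" for N
      using that by (simp add: Comods_simps L.farr_idt)
    show "farr J (cmp M g f) = cmp Comods (farr J g) (farr J f)" if "f \<in> hom M N N'" "g \<in> hom M N' N''" for f g N N' N''
      using that L.farr_cmp[OF that] by (auto simp: Comods_simps hom_def)
    show "farr J (vadd M f g) = vadd Comods (farr J f) (farr J g)" if "f \<in> hom M N N'" "g \<in> hom M N N'" for f g N N'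
      using that L.farr_add[OF that] by (auto simp: Comods_simps hom_def)
    show "farr J (vscale M c f) = vscale Comods c (farr J f)" if "f \<in> hom M N N'" for f c N N'
      using that L.farr_scale[OF that] by (auto simp: Comods_simps hom_def)
  qed
qed

lemma J_fully_faithful: "fully_faithful M Comods J"
  unfolding fully_faithful_def
proof (intro ballI)
  fix N N' assume N: "N \<in> obj M" "N' \<in> obj M"
  have 1: "bij_betw (farr op.K) (hom M N N') (hom op.Mods (fobj op.K N') (fobj op.K N))"
    using op.K_fully_faithful N by (simp add: fully_faithful_def)
  have 2: "bij_betw flip_arr (hom op.Mods (fobj op.K N') (fobj op.K N)) (hom Comods (fobj J N) (fobj J N'))"
    by (rule bij_betw_byWitness[where f' = flip_arr]) (auto simp: Comods_hom)
  have "farr J = flip_arr \<circ> farr op.K" by (intro ext) simp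
  then show "bij_betw (farr J) (hom M N N') (hom Comods (fobj J N) (fobj J N'))"
    using bij_betw_trans[OF 1 2] by simp
qed

lemma J_essentially_surjective: "essentially_surjective M Comods J"
  unfolding essentially_surjective_def
proof
  interpret N: module_category C Comods by (rule Comods_module)
  fix Y assume "Y \<in> obj Comods"
  then have "Y \<in> obj op.Mods" by (simp add: Comods_simps op.Mods_simps)
  then obtain N t where N: "N \<in> obj M" "t \<in> hom op.Mods (fobj op.K N) Y" "iso op.Mods t"
    using op.K_essentially_surjective unfolding essentially_surjective_def by auto
  have t: "flip_arr t \<in> hom Comods Y (fobj J N)" "iso Comods (flip_arr t)"
    using N by (simp_all add: Comods_hom Comods_iso_flip)
  \<comment> \<open>The isomorphism found in the opposite category points from \<open>Y\<close> to
    the image of \<open>N\<close> once flipped, so it is inverted.\<close>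
  have "inv_arr Comods (flip_arr t) \<in> hom Comods (fobj J N) Y" "iso Comods (inv_arr Comods (flip_arr t))"
    using t by (simp_all add: in_hom_iff)
  then show "\<exists>N \<in> obj M. \<exists>e \<in> hom Comods (fobj J N) Y. iso Comods e"
    using N(1) by blast
qed

lemma J_module_functor: "module_functor C M Comods J Jstr"
proof (intro module_functor.intro module_functor_axioms.intro module_category_axioms Comods_module J_linear)
  show "Jstr V N \<in> hom Comods (fobj J (V \<rhd>\<^bsub>M\<^esub> N)) (aobj Comods V (fobj J N))" "iso Comods (Jstr V N)"
    if VN [simp]: "V \<in> obj C" "N \<in> obj M" for V N
  proof -
    interpret S: module_structure "op_mon C" "{X. right_module (op_mon C) op.Alg X}"
     "\<lambda>X Y f. cmp (op_mon C) f (snd X) = cmp (op_mon C) (snd Y) (tarr (op_mon C) f (idt (op_mon C) op.A))"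
     "\<lambda>V X. cmp (op_mon C) (tarr (op_mon C) (idt (op_mon C) V) (snd X)) (tassoc (op_mon C) V (fst X) op.A)"
      by (rule op.Mods_structure)
    have 1: "right_module (op_mon C) op.Alg (fobj L (V \<rhd>\<^bsub>M\<^esub> N), op.\<rho> (V \<rhd>\<^bsub>M\<^esub> N))"
      using op.rho_module[of "V \<rhd>\<^bsub>M\<^esub> N"] by simp
    have 2: "aobj Comods V (fobj L N, op.\<rho> N) \<in> {X. right_module (op_mon C) op.Alg X}"
      using S.act_S[of V "(fobj L N, op.\<rho> N)"] op.rho_module[of N] by (simp add: Comods_simps)
    note 3 = op.lax_module_map[of V N, simplified]
    show "Jstr V N \<in> hom Comods (fobj J (V \<rhd>\<^bsub>M\<^esub> N)) (aobj Comods V (fobj J N))"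
      unfolding Comods_hom_iff Jstr_def using 1 2 3 by (simp add: Comods_simps in_hom_iff)
    show "iso Comods (Jstr V N)"
      unfolding Jstr_def
      by (rule Comods_iso) (use 1 2 3 in \<open>simp_all add: in_hom_iff Comods_simps\<close>)
  qed
  show "cmp Comods (Jstr V' N') (farr J (f \<unrhd>\<^bsub>M\<^esub> g)) = cmp Comods (aarr Comods f (farr J g)) (Jstr V N)"
    if "f \<in> hom C V V'" "g \<in> hom M N N'" for f V V' g N N'
    using that op.lax_nat[of f g, simplified] by (auto simp: Jstr_def Comods_simps hom_def)
  show "cmp Comods (aassoc Comods V W (fobj J N)) (Jstr (V \<otimes> W) N)
    = cmp Comods (aarr Comods (idt C V) (Jstr W N)) (cmp Comods (Jstr V (W \<rhd>\<^bsub>M\<^esub> N)) (farr J (aassoc M V W N)))"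
    if [simp]: "V \<in> obj C" "W \<in> obj C" "N \<in> obj M" for V W N
  proof -
    let ?a = "tassoc C V W (fobj L N)"
    \<comment> \<open>In the opposite category \<open>lax_assoc\<close> is an equation between
      inverse associators. Composing with the associator of \<open>C\<close> on one side and that of
      the action on the other removes the inverses.\<close>
    have "?a \<cdot> \<psi> (V \<otimes> W) N \<cdot> farr L (inv_arr M (aassoc M V W N)) \<cdot> farr L (aassoc M V W N)
      = ?a \<cdot> inv_arr C ?a \<cdot> (idt C V \<boxtimes> \<psi> W N) \<cdot> \<psi> V (W \<rhd>\<^bsub>M\<^esub> N) \<cdot> farr L (aassoc M V W N)"
      using C.cmp_ext[OF op.lax_assoc[of V W N, simplified, symmetric], of "farr L (aassoc M V W N)"] by simp
    moreover have "farr L (inv_arr M (aassoc M V W N)) \<cdot> farr L (aassoc M V W N) = idt C (fobj L ((V \<otimes> W) \<rhd>\<^bsub>M\<^esub> N))"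
      using L.farr_cmp[of "aassoc M V W N" "(V \<otimes> W) \<rhd>\<^bsub>M\<^esub> N" "V \<rhd>\<^bsub>M\<^esub> W \<rhd>\<^bsub>M\<^esub> N" "inv_arr M (aassoc M V W N)" "(V \<otimes> W) \<rhd>\<^bsub>M\<^esub> N"]
      by (simp add: in_hom_iff L.farr_idt)
    ultimately show ?thesis by (simp add: Jstr_def Comods_simps)
  qed
  show "cmp Comods (aunit Comods (fobj J N)) (Jstr (tone C) N) = farr J (aunit M N)"
    if [simp]: "N \<in> obj M" for N
  proof -
    let ?l = "tlunit C (fobj L N)"
    \<comment> \<open>The same device removes the inverse unitors from \<open>lax_unit\<close> of
      the opposite category.\<close>
    have "?l \<cdot> \<psi> (tone C) N \<cdot> farr L (inv_arr M (aunit M N)) \<cdot> farr L (aunit M N) = ?l \<cdot> inv_arr C ?l \<cdot> farr L (aunit M N)"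
      using C.cmp_ext[OF op.lax_unit[of N, simplified], of "farr L (aunit M N)"] by simp
    moreover have "farr L (inv_arr M (aunit M N)) \<cdot> farr L (aunit M N) = idt C (fobj L (tone C \<rhd>\<^bsub>M\<^esub> N))"
      using L.farr_cmp[of "aunit M N" "tone C \<rhd>\<^bsub>M\<^esub> N" N "inv_arr M (aunit M N)" "tone C \<rhd>\<^bsub>M\<^esub> N"]
      by (simp add: in_hom_iff L.farr_idt)
    ultimately show ?thesis by (simp add: Jstr_def Comods_simps)
  qed
qed

theorem reconstruction:
  "coalgebra_object C (coend_coalgebra C M X L \<eta> \<epsilon>)"
  "module_equivalent C M (comod_cat C (coend_coalgebra C M X L \<eta> \<epsilon>))"
  using coalgebra_in.coalgebra[OF Coalg_in] J_module_functor
    linear_functor.equivalence[OF J_linear J_fully_faithful J_essentially_surjective]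
  unfolding module_equivalent_def Comods_def Coalg_def by blast+

end

theorem theorem1:
  fixes C :: "('k::field, 'o, 'a) moncat"
    and M :: "('k, 'o, 'a, 'p, 'b) modcat"
  assumes "rigid_category C" and "abelian_category C"
    and "module_category C M" and "abelian_category M"
  shows
    "(enough_projectives C \<and> enough_projectives M \<longrightarrow>
      (\<forall>X R \<eta> \<epsilon>.
         X \<in> obj M \<and>
         adjunction C M (act_on M X) R \<eta> \<epsilon> \<and>
         (\<forall>P. projective C P \<longrightarrow> projective M (P \<rhd>\<^bsub>M\<^esub> X)) \<and>
         (\<forall>Q. projective M Q \<longrightarrow> (\<exists>P. projective C P \<and> direct_summand M Q (P \<rhd>\<^bsub>M\<^esub> X)))
         \<longrightarrow> algebra_object C (end_algebra C M X R \<eta> \<epsilon>) \<and>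
             module_equivalent C M (mod_cat C (end_algebra C M X R \<eta> \<epsilon>)))) \<and>
     (enough_injectives C \<and> enough_injectives M \<longrightarrow>
      (\<forall>X L \<eta> \<epsilon>.
         X \<in> obj M \<and>
         adjunction M C L (act_on M X) \<eta> \<epsilon> \<and>
         (\<forall>I. injective C I \<longrightarrow> injective M (I \<rhd>\<^bsub>M\<^esub> X)) \<and>
         (\<forall>J. injective M J \<longrightarrow> (\<exists>I. injective C I \<and> direct_summand M J (I \<rhd>\<^bsub>M\<^esub> X)))
         \<longrightarrow> coalgebra_object C (coend_coalgebra C M X L \<eta> \<epsilon>) \<and>
             module_equivalent C M (comod_cat C (coend_coalgebra C M X L \<eta> \<epsilon>))))"
proof (intro conjI impI allI; elim conjE)
  fix X R \<eta> \<epsilon>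
  assume "enough_projectives C" "enough_projectives M" "X \<in> obj M" "adjunction C M (act_on M X) R \<eta> \<epsilon>"
    "\<forall>P. projective C P \<longrightarrow> projective M (P \<rhd>\<^bsub>M\<^esub> X)"
    "\<forall>Q. projective M Q \<longrightarrow> (\<exists>P. projective C P \<and> direct_summand M Q (P \<rhd>\<^bsub>M\<^esub> X))"
  then interpret projective_generator C M X R \<eta> \<epsilon>
    using assms
    by (intro projective_generator.intro action_adjunction.intro action_adjunction_axioms.intro
      projective_generator_axioms.intro) simp_all
  show "algebra_object C (end_algebra C M X R \<eta> \<epsilon>)" using Alg_algebra by (simp add: Alg_def)
  show "module_equivalent C M (mod_cat C (end_algebra C M X R \<eta> \<epsilon>))" by (rule reconstruction)
next
  fix X L \<eta> \<epsilon>
  assume "enough_injectives C" "enough_injectives M" "X \<in> obj M" "adjunction M C L (act_on M X) \<eta> \<epsilon>"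
    "\<forall>I. injective C I \<longrightarrow> injective M (I \<rhd>\<^bsub>M\<^esub> X)"
    "\<forall>J. injective M J \<longrightarrow> (\<exists>I. injective C I \<and> direct_summand M J (I \<rhd>\<^bsub>M\<^esub> X))"
  then interpret injective_generator C M X L \<eta> \<epsilon>
    using assms by (intro injective_generator.intro injective_generator_axioms.intro) simp_all
  show "coalgebra_object C (coend_coalgebra C M X L \<eta> \<epsilon>)"
    "module_equivalent C M (comod_cat C (coend_coalgebra C M X L \<eta> \<epsilon>))"
    by (rule reconstruction)+
qed

end
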